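(* Let $M\ge 1$ and $R_1,\dots,R_M\in\mathbb{R}^3$ be fixed, and let $d$ be fixed with $d\in(0,\infty)$ if $M=1$ and $d\in(0,\frac12\min_{\alpha\ne\beta}|R_\alpha-R_\beta|)$ if $M\ge 2$. For $N\in\mathbb{N}$ and $\underline{Z}=(Z_1,\dots,Z_M)$ with all $Z_\alpha>0$, denote $Z:=\sum_{\alpha=1}^M Z_\alpha$, and let $(x_1^{(N,\underline{Z})},\dots,x_N^{(N,\underline{Z})})$ be any minimizer of $V_{N,\underline{Z}}$ on $\mathcal{A}_N$ (both defined in the context). Let $S_\alpha=\{x\in\mathbb{R}^3:|x-R_\alpha|=d\}$. Then in the limit $$N=Z\to\infty,\qquad \frac{Z_\alpha}{Z}\to z_\alpha\quad(\alpha=1,\dots,M),$$ the following hold. a) (Neutrality) For every $\alpha\in\{1,\dots,M\}$, $$\frac{\sharp\{x_i^{(N,\underline{Z})} : x_i^{(N,\underline{Z})}\in S_\alpha\}}{Z_\alpha}\longrightarrow 1.$$ b) (Equidistribution) For every $\alpha\in\{1,\dots,M\}$ and any measurable $\Omega\subseteq S_\alpha$ with $\mathrm{area}(\partial\Omega)=0$, $$\frac{\sharp\{x_i^{(N,\underline{Z})} : x_i^{(N,\underline{Z})}\in\Omega\}}{N}\longrightarrow z_\alpha\,\frac{\mathrm{area}(\Omega)}{\mathrm{area}(S_\alpha)}.$$ c) (Limit energy) $$\frac{V_{N,\underline{Z}}(x_1^{(N,\underline{Z})},\dots,x_N^{(N,\underline{Z})})}{N^2}\longrightarrow -\frac12\sum_{\alpha=1}^M\frac{z_\alpha^2}{d}-\sum_{1\le\alpha<\beta\le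 M}\frac{z_\alpha z_\beta}{|R_\alpha-R_\beta|}.$$
   Context: For $\underline{Z}=(Z_1,\dots,Z_M)$ with $Z_\alpha>0$, define $$V_{N,\underline{Z}}(x_1,\dots,x_N):=\sum_{i=1}^N v(x_i)+\sum_{1\le i<j\le N}\frac{1}{|x_i-x_j|},\qquad v(x)=\sum_{\alpha=1}^M\frac{-Z_\alpha}{|x-R_\alpha|}.$$ The admissible set is $$\mathcal{A}_N:=\{(x_1,\dots,x_N)\in\mathbb{R}^{3N} : |x_i-R_\alpha|\ge d\text{ for all } i,\alpha\}.$$ Here $\sharp$ denotes the number of points, "area" is two-dimensional surface measure on the sphere $S_\alpha$, and $\partial\Omega$ is the boundary of $\Omega$ relative to $S_\alpha$.
   Formalization: Part a) is stated only for those α with z_α > 0; for z_α = 0 it can fail, e.g. M = 2, Z_1 = 1/2, Z_2 = N − 1/2, where the ratio is always an even integer. Parts b) and c) are unchanged. *)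

theory Defs
  imports "HOL-Analysis.Analysis"
begin

text \<open>
  A configuration of \<open>N\<close> points in \<open>\<real>\<^sup>3\<close> is a function \<open>x :: nat \<Rightarrow> real^3\<close>, of which only the values
  at \<open>1, \<dots>, N\<close> matter; the nuclei \<open>R\<close> and charges \<open>Z\<close> are likewise used at the indices \<open>1, \<dots>, M\<close>.
\<close>

definition nuclear_potential :: "nat \<Rightarrow> (nat \<Rightarrow> real^3) \<Rightarrow> (nat \<Rightarrow> real) \<Rightarrow> real^3 \<Rightarrow> real" where
  "nuclear_potential M R Z x = (\<Sum>\<alpha>=1..M. - Z \<alpha> / norm (x - R \<alpha>))"

text \<open>
  The energy is extended-real valued so that coinciding electrons have energy \<open>1/0 = \<infinity>\<close>. With the
  real-number convention \<open>1/0 = 0\<close> they would not repel each other, and minimizers would collapse.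
\<close>

definition coulomb_energy ::
  "nat \<Rightarrow> (nat \<Rightarrow> real^3) \<Rightarrow> nat \<Rightarrow> (nat \<Rightarrow> real) \<Rightarrow> (nat \<Rightarrow> real^3) \<Rightarrow> ereal" where
  "coulomb_energy M R N Z x =
     ereal (\<Sum>i=1..N. nuclear_potential M R Z (x i)) +
     (\<Sum>i=1..N. \<Sum>j=i+1..N. 1 / ereal (norm (x i - x j)))"

definition admissible :: "nat \<Rightarrow> (nat \<Rightarrow> real^3) \<Rightarrow> real \<Rightarrow> nat \<Rightarrow> (nat \<Rightarrow> real^3) set" where
  "admissible M R d N = {x. \<forall>i\<in>{1..N}. \<forall>\<alpha>\<in>{1..M}. norm (x i - R \<alpha>) \<ge> d}"

definition energy_minimizer ::
  "nat \<Rightarrow> (nat \<Rightarrow> real^3) \<Rightarrow> real \<Rightarrow> nat \<Rightarrow> (nat \<Rightarrow> real) \<Rightarrow> (nat \<Rightarrow> real^3) \<Rightarrow> bool" where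
  "energy_minimizer M R d N Z x \<longleftrightarrow>
     is_arg_min (coulomb_energy M R N Z) (\<lambda>y. y \<in> admissible M R d N) x"

definition sphere_param :: "real^3 \<Rightarrow> real \<Rightarrow> real \<times> real \<Rightarrow> real^3" where
  "sphere_param c r = (\<lambda>(\<theta>, \<phi>). c + r *\<^sub>R vector [sin \<theta> * cos \<phi>, sin \<theta> * sin \<phi>, cos \<theta>])"

text \<open>
  Surface measure on the sphere of radius \<open>r\<close> about \<open>c\<close>, as a measure on \<open>\<real>\<^sup>3\<close> carried by that sphere:
  in spherical coordinates the surface element is \<open>r\<^sup>2 sin \<theta> d\<theta> d\<phi>\<close>. The completion makes all
  Lebesgue measurable subsets of the sphere measurable, not only the Borel ones.
\<close>

definition sphere_area :: "real^3 \<Rightarrow> real \<Rightarrow> (real^3) measure" where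
  "sphere_area c r = completion
     (distr (density lborel (\<lambda>p. ennreal (r\<^sup>2 * sin (fst p)) * indicator ({0..pi} \<times> {0..2*pi}) p))
        borel (sphere_param c r))"

end

theory Submission
  imports Defs "HOL-Probability.Distributions"
begin

text \<open>
  By Newton's theorem the nuclear attraction of an admissible electron is the potential of the charges
  \<open>Z \<alpha>\<close> spread uniformly over the spheres. Let \<open>D\<close> be the Coulomb energy of that sphere charge.
  Completing the square, \<open>2 V + D\<close> is, up to electron self energies, the Coulomb energy of the difference
  between the electron and the sphere charges.

  Upper bound: in a minimizer no electron gains by being moved, in particular not on average when it is
  redistributed according to the sphere charge; summing over the electrons gives \<open>V \<le> - D / 2\<close>.
  Lower bound: replace \<open>1 / r\<close> by the smaller positive definite kernel \<open>1 / sqrt (r\<^sup>2 + \<epsilon>\<^sup>2)\<close> with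
  \<open>\<epsilon> = 1 / sqrt N\<close>, at a total cost of order \<open>N powr (3/2)\<close>. This gives the limit energy and shows that the
  softened energy of the difference tends to \<open>0\<close>. The kernel is a mixture of Gaussians, and a Gaussian kernel is a
  series of squares of moments, so all moments of the difference, weighted by a fixed Gaussian, tend to \<open>0\<close>;
  by Stone--Weierstrass this is weak convergence. Finally, the strong minimum principle
  for the harmonic potential felt by one electron shows that all electrons lie exactly on the spheres, and
  counting points in sets with negligible boundary follows from weak convergence.
\<close>

section \<open>The uniform measure on the sphere\<close>

text \<open>Point charges have infinite self energy, so positivity of the Coulomb form cannot be
  used on the electrons directly. Softening makes each self energy \<open>1 / \<epsilon>\<close> and
  costs an error of order \<open>\<epsilon>\<close> per unit of charge in every electron-nucleus
  interaction; the totals N / \<epsilon> and N^2 \<epsilon> balance at the chosen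
  \<open>\<epsilon>\<close>. The energy is thus small at a shrinking \<open>\<epsilon>\<close>, but
  weak convergence is read off at the fixed value 1. Passing between them uses the Gaussian mixture:
  for signed charges, comparing kernels pointwise says nothing about energies. Weak convergence
  alone cannot count points on a sphere, which has empty interior: electrons hovering just outside
  would be missed. Exact location on the spheres supplies the lower bounds, and confines all charges
  to a ball independent of N, as the uniform constants and the polynomial approximation require.
  Since N is the sum of the charges, the random relocation of an electron has total weight exactly
  N, and the upper energy bound has no error term.\<close>

lemma vector_3_continuous_on [continuous_intros]:
  assumes "continuous_on S f" "continuous_on S g" "continuous_on S h"
  shows "continuous_on S (\<lambda>x. vector [f x, g x, h x] :: real^3)"
proof -
  have eq: "(\<lambda>x. vector [f x, g x, h x] :: real^3)
      = (\<lambda>x. f x *\<^sub>R axis 1 1 + g x *\<^sub>R axis 2 1 + h x *\<^sub>R axis 3 1)"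
    by (auto simp: fun_eq_iff vec_eq_iff forall_3 axis_def)
  show ?thesis unfolding eq by (intro continuous_intros assms)
qed

lemma emeasure_lborel_Times:
  assumes "A \<in> sets borel" "B \<in> sets borel"
  shows "emeasure lborel (A \<times> B) = emeasure lborel A * emeasure lborel B"
  using assms by (simp add: lborel_prod[symmetric] lborel.emeasure_pair_measure_Times)

text \<open>Opens the way to Tonelli in the three coordinates; agreement on boxes suffices, since it
  characterizes Lebesgue measure.\<close>

lemma lborel_real_3:
  "(lborel :: (real^3) measure) = distr lborel borel (\<lambda>(a, b, c). vector [a, b, c])"
proof (rule lborel_eqI)
  fix l u :: "real^3"
  assume le: "\<And>b. b \<in> Basis \<Longrightarrow> l \<bullet> b \<le> u \<bullet> b"
  have le': "l $ i \<le> u $ i" for i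
    using le[of "axis i 1"] by (simp add: inner_axis)
  have pre: "(\<lambda>(a, b, c). vector [a, b, c] :: real^3) -` box l u
     = box (l $ 1) (u $ 1) \<times> box (l $ 2) (u $ 2) \<times> box (l $ 3) (u $ 3)"
    by (auto simp: mem_box_cart forall_3)
  have [measurable]: "(\<lambda>(a, b, c). vector [a, b, c] :: real^3) \<in> borel_measurable borel"
    unfolding case_prod_beta by (intro borel_measurable_continuous_onI continuous_intros)
  have prod3: "prod f (UNIV :: 3 set) = f 1 * f 2 * f 3" for f :: "3 \<Rightarrow> real"
    unfolding UNIV_3 by (simp add: mult.assoc)
  have inj: "inj (\<lambda>i::3. axis i (1::real))"
    by (auto simp: inj_def axis_eq_axis)
  have "emeasure (distr lborel borel (\<lambda>(a, b, c). vector [a, b, c])) (box l u)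
      = emeasure lborel (box (l $ 1) (u $ 1) \<times> box (l $ 2) (u $ 2) \<times> box (l $ 3) (u $ 3))"
    by (subst emeasure_distr) (auto simp: pre)
  also have "\<dots> = ennreal (u $ 1 - l $ 1) * (ennreal (u $ 2 - l $ 2) * ennreal (u $ 3 - l $ 3))"
    by (simp add: emeasure_lborel_Times le' borel_open open_box open_Times box_real)
  also have "\<dots> = ennreal (\<Prod>i\<in>UNIV. u $ i - l $ i)"
    unfolding prod3 using le' by (simp add: mult.assoc ennreal_mult)
  also have "(\<Prod>i\<in>UNIV. u $ i - l $ i) = (\<Prod>b\<in>Basis. (u - l) \<bullet> b)"
  proof -
    have B: "(Basis :: (real^3) set) = (\<lambda>i. axis i 1) ` UNIV"
      by (auto simp: Basis_vec_def)
    show ?thesis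
      unfolding B by (subst prod.reindex) (auto simp: inj inner_axis)
  qed
  finally show "emeasure (distr lborel borel (\<lambda>(a, b, c). vector [a, b, c])) (box l u)
      = ennreal (\<Prod>b\<in>Basis. (u - l) \<bullet> b)" .
qed simp

text \<open>The density of \<open>sphere_area\<close> for radius 1, divided by the total area
  \<open>4 * pi\<close>, so that integrals against it are spherical averages.\<close>

definition unit_sphere_measure :: "(real^3) measure" where
  "unit_sphere_measure = distr
     (density lborel (\<lambda>p. ennreal (sin (fst p) / (4 * pi)) * indicator ({0..pi} \<times> {0..2*pi}) p))
     borel (sphere_param 0 1)"

text \<open>Surface measure as the volume of cones: this turns rotation invariance into that of Lebesgue measure.\<close>

definition radial_cone :: "(real^3) set \<Rightarrow> (real^3) set" where
  "radial_cone A = {x. x \<noteq> 0 \<and> norm x < 1 \<and> x /\<^sub>R norm x \<in> A}"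

lemma sphere_param_0_1: "sphere_param 0 1 (\<theta>, \<phi>) = vector [sin \<theta> * cos \<phi>, sin \<theta> * sin \<phi>, cos \<theta>]"
  by (simp add: sphere_param_def)

lemma sphere_param_eq: "sphere_param c r p = c + r *\<^sub>R sphere_param 0 1 p"
  by (simp add: sphere_param_def split: prod.splits)

lemma sphere_param_measurable [measurable]: "sphere_param c r \<in> borel_measurable borel"
  unfolding sphere_param_def case_prod_beta by (intro borel_measurable_continuous_onI continuous_intros)

lemma norm_sphere_param [simp]: "norm (sphere_param 0 1 p) = 1"
proof -
  obtain \<theta> \<phi> where p: "p = (\<theta>, \<phi>)" by (cases p)
  have "(sin \<theta> * cos \<phi>) * (sin \<theta> * cos \<phi>) + (sin \<theta> * sin \<phi>) * (sin \<theta> * sin \<phi>) + cos \<theta> * cos \<theta> = 1"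
    using sin_cos_squared_add[of \<theta>] sin_cos_squared_add[of \<phi>] by algebra
  then show ?thesis
    by (simp add: p sphere_param_0_1 norm_eq_sqrt_inner inner_vec_def sum_3)
qed

section \<open>Spherical coordinates and the volume of cones\<close>

text \<open>Radius, polar angle and azimuth are packed into one vector because the change of
  variables formula concerns maps of a vector space into itself.\<close>

definition spherical :: "real^3 \<Rightarrow> real^3" where
  "spherical p = p $ 1 *\<^sub>R sphere_param 0 1 (p $ 2, p $ 3)"

definition spherical' :: "real^3 \<Rightarrow> real^3 \<Rightarrow> real^3" where
  "spherical' p h = vector
    [h $ 1 * (sin (p $ 2) * cos (p $ 3)) + p $ 1 * (h $ 2 * cos (p $ 2) * cos (p $ 3) - h $ 3 * sin (p $ 2) * sin (p $ 3)),
     h $ 1 * (sin (p $ 2) * sin (p $ 3)) + p $ 1 * (h $ 2 * cos (p $ 2) * sin (p $ 3) + h $ 3 * sin (p $ 2) * cos (p $ 3)),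
     h $ 1 * cos (p $ 2) - p $ 1 * h $ 2 * sin (p $ 2)]"

lemma has_derivative_spherical: "(spherical has_derivative spherical' p) (at p within S)"
proof (subst has_derivative_componentwise_within, intro ballI)
  fix b :: "real^3" assume "b \<in> Basis"
  then obtain i where b: "b = axis i 1" by (auto simp: Basis_vec_def)
  have nth: "((\<lambda>x::real^3. x $ j) has_derivative (\<lambda>x. x $ j)) (at p within S)" for j
    by (rule bounded_linear_imp_has_derivative) (rule bounded_linear_vec_nth)
  have "((\<lambda>x. spherical x $ i) has_derivative (\<lambda>x. spherical' p x $ i)) (at p within S)"
    using exhaust_3[of i] unfolding spherical_def spherical'_def sphere_param_0_1
    by (auto intro!: derivative_eq_intros nth simp: algebra_simps fun_eq_iff)
  then show "((\<lambda>x. spherical x \<bullet> b) has_derivative (\<lambda>x. spherical' p x \<bullet> b)) (at p within S)"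
    by (simp add: b inner_axis)
qed

lemma det_spherical': "det (matrix (spherical' p)) = (p $ 1)\<^sup>2 * sin (p $ 2)"
proof -
  \<comment> \<open>Once sines and cosines are named, the determinant is a polynomial identity
    modulo the two Pythagorean relations.\<close>
  define s2 where "s2 = sin (p $ 2)"
  define c2 where "c2 = cos (p $ 2)"
  define s3 where "s3 = sin (p $ 3)"
  define c3 where "c3 = cos (p $ 3)"
  have "s2\<^sup>2 + c2\<^sup>2 = 1" "s3\<^sup>2 + c3\<^sup>2 = 1"
    by (auto simp: s2_def c2_def s3_def c3_def)
  then show ?thesis
    unfolding det_3 matrix_def spherical'_def s2_def[symmetric] c2_def[symmetric] s3_def[symmetric] c3_def[symmetric]
    by (simp add: axis_def) algebra
qed


text \<open>The norm recovers the radius and the third coordinate the polar angle,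
  \<open>cos\<close> being injective on [0, pi]. Cancelling the positive sine leaves an azimuth
  known modulo 2 pi, inside an open interval of that length.\<close>

lemma inj_on_spherical:
  "inj_on spherical {p. 0 < p $ 1 \<and> 0 < p $ 2 \<and> p $ 2 < pi \<and> 0 < p $ 3 \<and> p $ 3 < 2 * pi}"
proof (rule inj_onI, clarify)
  fix p q :: "real^3"
  assume p: "0 < p $ 1" "0 < p $ 2" "p $ 2 < pi" "0 < p $ 3" "p $ 3 < 2 * pi"
    and q: "0 < q $ 1" "0 < q $ 2" "q $ 2 < pi" "0 < q $ 3" "q $ 3 < 2 * pi"
    and eq: "spherical p = spherical q"
  have "norm (spherical p) = norm (spherical q)" using eq by simp
  then have 1: "p $ 1 = q $ 1" using p q by (simp add: spherical_def)
  then have "sphere_param 0 1 (p $ 2, p $ 3) = sphere_param 0 1 (q $ 2, q $ 3)"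
    using eq p by (simp add: spherical_def)
  then have e: "sin (p $ 2) * cos (p $ 3) = sin (q $ 2) * cos (q $ 3)"
     "sin (p $ 2) * sin (p $ 3) = sin (q $ 2) * sin (q $ 3)" "cos (p $ 2) = cos (q $ 2)"
    by (auto simp: sphere_param_0_1 vec_eq_iff forall_3)
  have 2: "p $ 2 = q $ 2" by (rule cos_inj_pi) (use e(3) p q in auto)
  moreover have "sin (q $ 2) > 0" using q by (intro sin_gt_zero) auto
  ultimately have "sin (p $ 3) = sin (q $ 3) \<and> cos (p $ 3) = cos (q $ 3)" using e by auto
  then obtain n :: int where n: "p $ 3 = q $ 3 + 2 * pi * n"
    using sin_cos_eq_iff by blast
  have "2 * pi * real_of_int n < 2 * pi * 1" "2 * pi * (-1) < 2 * pi * real_of_int n" using p q n by linarith+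
  then have "real_of_int n < 1" "- 1 < real_of_int n"
    using mult_less_cancel_left_pos[of "2 * pi" "real_of_int n" 1]
      mult_less_cancel_left_pos[of "2 * pi" "- 1" "real_of_int n"] pi_gt_zero by linarith+
  then have "n = 0" by linarith
  then show "p = q" using n 1 2 by (simp add: vec_eq_iff forall_3)
qed

lemma norm_real_3: "norm (x :: real^3) = sqrt ((x $ 1)\<^sup>2 + (x $ 2)\<^sup>2 + (x $ 3)\<^sup>2)"
  by (simp add: norm_eq_sqrt_inner inner_vec_def sum_3 power2_eq_square)

text \<open>The points left out form the half great circle of azimuth 0, poles included, which the
  open parameter rectangle does not reach.\<close>

lemma sphere_param_surj:
  assumes "norm u = 1" and "u $ 2 \<noteq> 0 \<or> u $ 1 < 0"
  obtains \<theta> \<phi> where "0 < \<theta>" "\<theta> < pi" "0 < \<phi>" "\<phi> < 2 * pi" "sphere_param 0 1 (\<theta>, \<phi>) = u"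
proof -
  have n: "(u $ 1)\<^sup>2 + (u $ 2)\<^sup>2 + (u $ 3)\<^sup>2 = 1"
    using assms(1) by (simp add: norm_real_3)
  have pos: "(u $ 1)\<^sup>2 + (u $ 2)\<^sup>2 > 0"
    using assms(2) by (auto simp: sum_power2_gt_zero_iff)
  define s where "s = sqrt ((u $ 1)\<^sup>2 + (u $ 2)\<^sup>2)"
  have s: "s > 0" "s\<^sup>2 = (u $ 1)\<^sup>2 + (u $ 2)\<^sup>2" using pos by (auto simp: s_def)
  have "(u $ 3)\<^sup>2 + s\<^sup>2 = 1" using n s by simp
  moreover have "0 \<le> s" using s by simp
  ultimately obtain \<theta> where \<theta>: "0 \<le> \<theta>" "\<theta> \<le> pi" "u $ 3 = cos \<theta>" "s = sin \<theta>"
    using sincos_total_pi[of s "u $ 3"] by blast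
  have "\<theta> \<noteq> 0" "\<theta> \<noteq> pi" using \<theta> s by auto
  have "(u $ 1 / s)\<^sup>2 + (u $ 2 / s)\<^sup>2 = ((u $ 1)\<^sup>2 + (u $ 2)\<^sup>2) / s\<^sup>2"
    by (simp add: power_divide add_divide_distrib)
  also have "\<dots> = 1"
    unfolding s(2) using pos by (intro divide_self) linarith
  finally have "(u $ 1 / s)\<^sup>2 + (u $ 2 / s)\<^sup>2 = 1" .
  then obtain \<phi> where \<phi>: "0 \<le> \<phi>" "\<phi> < 2 * pi" "u $ 1 / s = cos \<phi>" "u $ 2 / s = sin \<phi>"
    by (rule sincos_total_2pi)
  have u: "u $ 1 = s * cos \<phi>" "u $ 2 = s * sin \<phi>" using \<phi>(3,4) s(1) by (simp_all add: field_simps)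
  then have "\<phi> \<noteq> 0" using s(1) assms(2) by auto
  have "sphere_param 0 1 (\<theta>, \<phi>) = u"
    using \<theta> u by (simp add: sphere_param_0_1 vec_eq_iff forall_3)
  with \<theta> \<phi> \<open>\<theta> \<noteq> 0\<close> \<open>\<theta> \<noteq> pi\<close> \<open>\<phi> \<noteq> 0\<close> show ?thesis by (intro that[of \<theta> \<phi>]) auto
qed

lemma radial_cone_measurable [measurable]:
  assumes "A \<in> sets borel"
  shows "radial_cone A \<in> sets borel"
proof -
  have "(\<lambda>x. x /\<^sub>R norm x) \<in> borel_measurable (borel :: (real^3) measure)" by measurable
  then have "(\<lambda>x. x /\<^sub>R norm x) -` A \<in> sets (borel :: (real^3) measure)"
    using assms by (rule measurable_sets_borel)
  then have "((\<lambda>x. x /\<^sub>R norm x) -` A \<inter> ball 0 1) - {0} \<in> sets (borel :: (real^3) measure)"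
    by auto
  also have "((\<lambda>x. x /\<^sub>R norm x) -` A \<inter> ball 0 1) - {0} = radial_cone A"
    by (auto simp: radial_cone_def)
  finally show ?thesis .
qed

text \<open>Change of variables: \<open>spherical\<close> maps \<open>S\<close> injectively into the
  cone and can miss only points of the plane \<open>x $ 2 = 0\<close>, a null set.\<close>

lemma cone_measure_aux:
  assumes A[measurable]: "A \<in> sets borel"
  defines "S \<equiv> {p :: real^3. 0 < p $ 1 \<and> p $ 1 < 1 \<and> 0 < p $ 2 \<and> p $ 2 < pi \<and> 0 < p $ 3 \<and> p $ 3 < 2 * pi
      \<and> sphere_param 0 1 (p $ 2, p $ 3) \<in> A}"
  shows "emeasure lborel (radial_cone A) = (\<integral>\<^sup>+p. ennreal ((p $ 1)\<^sup>2 * sin (p $ 2)) * indicator S p \<partial>lborel)"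
    and "S \<in> sets borel"
proof -
  have nth[measurable]: "(\<lambda>p::real^3. p $ i) \<in> borel_measurable borel" for i
    by (intro borel_measurable_continuous_onI continuous_intros)
  have [measurable]: "(\<lambda>p::real^3. sphere_param 0 1 (p $ 2, p $ 3)) \<in> borel_measurable borel"
    unfolding sphere_param_0_1 by (intro borel_measurable_continuous_onI continuous_intros)
  show S[measurable]: "S \<in> sets borel" unfolding S_def by measurable
  have sin: "0 \<le> sin (p $ 2)" if "p \<in> S" for p
    using that by (auto simp: S_def intro!: sin_ge_zero)
  have sub: "S \<subseteq> box 0 (vector [1, pi, 2 * pi])"
    by (auto simp: S_def mem_box_cart forall_3)
  have fin: "emeasure lborel S < \<infinity>"
    by (rule le_less_trans[OF emeasure_mono[OF sub] emeasure_lborel_box_finite]) (simp add: borel_open)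
  have int: "set_integrable lborel S (\<lambda>p. (p $ 1)\<^sup>2 * sin (p $ 2))"
    unfolding set_integrable_def
  proof (rule integrableI_bounded_set_indicator[where B=1])
    show "AE x \<in> S in lborel. norm ((x $ 1)\<^sup>2 * sin (x $ 2)) \<le> 1"
    proof (intro AE_I2 impI)
      fix x assume "x \<in> S"
      then have "(x $ 1)\<^sup>2 \<le> 1" by (auto simp: S_def power_le_one)
      then have "(x $ 1)\<^sup>2 * \<bar>sin (x $ 2)\<bar> \<le> 1 * 1" by (intro mult_mono) auto
      then show "norm ((x $ 1)\<^sup>2 * sin (x $ 2)) \<le> 1" by (simp add: abs_mult)
    qed
  qed (use fin in auto)
  define I where "I = (LINT p:S|lborel. (p $ 1)\<^sup>2 * sin (p $ 2))"
  have hint: "((\<lambda>p. (p $ 1)\<^sup>2 * sin (p $ 2)) has_integral I) S"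
    using set_borel_integral_eq_integral[OF int] unfolding I_def by (simp add: has_integral_integrable_integral)
  \<comment> \<open>Polar angles in \<open>S\<close> lie between 0 and pi, so the Jacobian is
    nonnegative there.\<close>
  then have "((\<lambda>p. \<bar>det (matrix (spherical' p))\<bar>) has_integral I) S"
    by (rule has_integral_eq[rotated]) (auto simp: det_spherical' sin)
  moreover have "inj_on spherical S"
    by (rule inj_on_subset[OF inj_on_spherical]) (auto simp: S_def)
  moreover have "S \<in> sets lebesgue" by simp
  ultimately have im: "spherical ` S \<in> lmeasurable" "measure lebesgue (spherical ` S) = I"
    using has_measure_differentiable_image[of S spherical spherical' I] has_derivative_spherical by auto
  have sym: "sym_diff (spherical ` S) (radial_cone A) \<subseteq> {x. x $ 2 = 0}"
  proof -
    have "spherical ` S \<subseteq> radial_cone A"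
      by (auto simp: S_def radial_cone_def spherical_def abs_mult)
         (metis norm_eq_zero norm_sphere_param zero_neq_one)+
    moreover have "x \<in> spherical ` S" if x: "x \<in> radial_cone A" "x $ 2 \<noteq> 0" for x
    proof -
      have "norm (x /\<^sub>R norm x) = 1" "(x /\<^sub>R norm x) $ 2 \<noteq> 0" using x by (auto simp: radial_cone_def)
      then obtain \<theta> \<phi> where t: "0 < \<theta>" "\<theta> < pi" "0 < \<phi>" "\<phi> < 2 * pi" "sphere_param 0 1 (\<theta>, \<phi>) = x /\<^sub>R norm x"
        using sphere_param_surj by metis
      have "vector [norm x, \<theta>, \<phi>] \<in> S" using t x by (auto simp: S_def radial_cone_def)
      moreover have "spherical (vector [norm x, \<theta>, \<phi>]) = x" using t x by (auto simp: spherical_def radial_cone_def)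
      ultimately show ?thesis by (metis image_eqI)
    qed
    ultimately show ?thesis by blast
  qed
  have neg: "negligible (sym_diff (spherical ` S) (radial_cone A))"
    by (rule negligible_subset[OF _ sym]) (rule negligible_standard_hyperplane_cart)
  have "radial_cone A \<in> lmeasurable" "measure lebesgue (radial_cone A) = I"
    using lmeasurable_negligible_symdiff[OF im(1) neg] measure_negligible_symdiff[OF _ neg] im by auto
  then have I: "emeasure lebesgue (radial_cone A) = ennreal I"
    using emeasure_eq_measure2 by metis
  have "emeasure lborel (radial_cone A) = emeasure lebesgue (radial_cone A)"
    using radial_cone_measurable[OF A] by (simp add: emeasure_completion)
  also note I
  also have "ennreal I = (\<integral>\<^sup>+p. ennreal (indicator S p *\<^sub>R ((p $ 1)\<^sup>2 * sin (p $ 2))) \<partial>lborel)"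
    unfolding I_def set_lebesgue_integral_def
    by (rule nn_integral_eq_integral[symmetric])
       (use int in \<open>auto simp: set_integrable_def indicator_def intro!: AE_I2 mult_nonneg_nonneg sin\<close>)
  also have "\<dots> = (\<integral>\<^sup>+p. ennreal ((p $ 1)\<^sup>2 * sin (p $ 2)) * indicator S p \<partial>lborel)"
    by (intro nn_integral_cong) (auto simp: indicator_def)
  finally show "emeasure lborel (radial_cone A) = (\<integral>\<^sup>+p. ennreal ((p $ 1)\<^sup>2 * sin (p $ 2)) * indicator S p \<partial>lborel)" .
qed

text \<open>The radial variable separates off with integral 1/3; together with the normalization 1 /
  (4 pi) this produces the reciprocal of the volume of the unit ball.\<close>

lemma emeasure_unit_sphere_cone:
  assumes A[measurable]: "A \<in> sets borel"
  shows "emeasure unit_sphere_measure A = ennreal (3 / (4 * pi)) * emeasure lborel (radial_cone A)"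
proof -
  define S where "S = {p :: real^3. 0 < p $ 1 \<and> p $ 1 < 1 \<and> 0 < p $ 2 \<and> p $ 2 < pi \<and> 0 < p $ 3 \<and> p $ 3 < 2 * pi
      \<and> sphere_param 0 1 (p $ 2, p $ 3) \<in> A}"
  note aux = cone_measure_aux[OF A, folded S_def]
  define G where "G q = ennreal (sin (fst q)) * indicator ({0<..<pi} \<times> {0<..<2*pi}) q * indicator A (sphere_param 0 1 q)"
    for q :: "real \<times> real"
  have rect[measurable]: "{0..pi} \<times> {0..2*pi} \<in> sets (borel :: (real \<times> real) measure)"
    by (intro borel_closed closed_Times) auto
  have [measurable]: "{0<..<pi} \<times> {0<..<2*pi} \<in> sets (borel :: (real \<times> real) measure)"
    by (intro borel_open open_Times) auto
  have sf[measurable]: "(\<lambda>q :: real \<times> real. sin (fst q)) \<in> borel_measurable borel"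
    by (intro borel_measurable_continuous_onI continuous_intros)
  have G[measurable]: "G \<in> borel_measurable borel" unfolding G_def by measurable
  have nth[measurable]: "(\<lambda>p::real^3. p $ i) \<in> borel_measurable borel" for i
    by (intro borel_measurable_continuous_onI continuous_intros)
  have [measurable]: "S \<in> sets borel" using aux by simp
  have vm[measurable]: "(\<lambda>(a, b, c). vector [a, b, c] :: real^3) \<in> borel_measurable borel"
    unfolding case_prod_beta by (intro borel_measurable_continuous_onI continuous_intros)
  have "emeasure lborel (radial_cone A) = (\<integral>\<^sup>+p. ennreal ((p $ 1)\<^sup>2 * sin (p $ 2)) * indicator S p \<partial>lborel)"
    by (rule aux)
  also have "\<dots> = (\<integral>\<^sup>+(a, q). ennreal (a\<^sup>2) * indicator {0<..<1} a * G q \<partial>(lborel \<Otimes>\<^sub>M lborel))"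
    by (subst lborel_real_3, subst nn_integral_distr)
       (auto simp: lborel_prod S_def G_def indicator_def ennreal_mult' intro!: nn_integral_cong split: prod.splits)
  also have "\<dots> = (\<integral>\<^sup>+a. \<integral>\<^sup>+q. ennreal (a\<^sup>2) * indicator {0<..<1} a * G q \<partial>lborel \<partial>lborel)"
    by (subst lborel.nn_integral_fst[symmetric]) (auto simp: case_prod_beta)
  also have "\<dots> = (\<integral>\<^sup>+a. ennreal (a\<^sup>2) * indicator {0<..<1} a \<partial>lborel) * (\<integral>\<^sup>+q. G q \<partial>lborel)"
    by (simp add: nn_integral_cmult nn_integral_multc)
  also have "(\<integral>\<^sup>+a. ennreal (a\<^sup>2) * indicator {0<..<1} a \<partial>lborel) = (\<integral>\<^sup>+a. ennreal (a\<^sup>2) * indicator {0..1} (a::real) \<partial>lborel)"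
    using AE_lborel_singleton[of 0] AE_lborel_singleton[of 1]
    by (intro nn_integral_cong_AE) (auto simp: indicator_def elim!: eventually_elim2)
  also have "\<dots> = ennreal (1 ^ 3 / 3 - 0 ^ 3 / 3)"
    by (rule nn_integral_FTC_Icc) (auto intro!: derivative_eq_intros)
  finally have 1: "emeasure lborel (radial_cone A) = ennreal (1/3) * (\<integral>\<^sup>+q. G q \<partial>lborel)" by simp
  have [measurable]: "sphere_param 0 1 -` A \<in> sets borel"
    by (rule measurable_sets_borel[OF sphere_param_measurable A])
  have "emeasure unit_sphere_measure A = (\<integral>\<^sup>+q. indicator A (sphere_param 0 1 q) *
        (ennreal (sin (fst q) / (4 * pi)) * indicator ({0..pi} \<times> {0..2*pi}) q) \<partial>lborel)"
    unfolding unit_sphere_measure_def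
    by (subst emeasure_distr, simp_all, measurable, subst emeasure_density)
       (auto simp: indicator_def intro!: nn_integral_cong)
  also have "\<dots> = (\<integral>\<^sup>+q. ennreal (1 / (4 * pi)) * G q \<partial>lborel)"
  proof (rule nn_integral_cong_AE)
    \<comment> \<open>The closed rectangle of the definition and the open one in \<open>G\<close>
      differ where the polar angle is 0 or pi, where the sine vanishes, and where the azimuth is 0
      or 2 pi, a null set.\<close>
    have "emeasure lborel (UNIV \<times> {0, 2 * pi} :: (real \<times> real) set) = 0"
      by (subst emeasure_lborel_Times) (auto simp: emeasure_lborel_countable)
    moreover have m: "(UNIV \<times> {0, 2 * pi} :: (real \<times> real) set) \<in> sets lborel"
      by (simp add: borel_closed closed_Times)
    ultimately have "(UNIV \<times> {0, 2 * pi} :: (real \<times> real) set) \<in> null_sets lborel" by auto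
    then have "AE q in lborel. (q :: real \<times> real) \<notin> UNIV \<times> {0, 2 * pi}" by (rule AE_not_in)
    then show "AE q in lborel. indicator A (sphere_param 0 1 q) *
        (ennreal (sin (fst q) / (4 * pi)) * indicator ({0..pi} \<times> {0..2*pi}) q) = ennreal (1 / (4 * pi)) * G q"
    proof (rule eventually_mono)
      fix q :: "real \<times> real" assume q: "q \<notin> UNIV \<times> {0, 2 * pi}"
      obtain a b where ab: "q = (a, b)" by (cases q)
      have "sin a = 0" if "a = 0 \<or> a = pi" using that by auto
      moreover have "ennreal (sin a / (4 * pi)) = ennreal (1 / (4 * pi)) * ennreal (sin a)"
        by (simp flip: ennreal_mult')
      ultimately show "indicator A (sphere_param 0 1 q) *
        (ennreal (sin (fst q) / (4 * pi)) * indicator ({0..pi} \<times> {0..2*pi}) q) = ennreal (1 / (4 * pi)) * G q"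
        using q unfolding ab G_def by (auto simp: indicator_def)
    qed
  qed
  also have "\<dots> = ennreal (1 / (4 * pi)) * (\<integral>\<^sup>+q. G q \<partial>lborel)"
    by (rule nn_integral_cmult) simp
  also have "\<dots> = ennreal (3 / (4 * pi)) * emeasure lborel (radial_cone A)"
    unfolding 1 mult.assoc[symmetric] by (subst ennreal_mult'[symmetric]) auto
  finally show ?thesis .
qed

section \<open>Rotation invariance and the law of one coordinate\<close>

lemma sets_unit_sphere_measure [simp, measurable_cong]: "sets unit_sphere_measure = sets borel"
  and space_unit_sphere_measure [simp]: "space unit_sphere_measure = UNIV"
  by (auto simp: unit_sphere_measure_def)

lemma prob_space_unit_sphere_measure: "prob_space unit_sphere_measure"
proof
  have "radial_cone UNIV = ball 0 1 - {0}"
    by (auto simp: radial_cone_def)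
  then have "emeasure lborel (radial_cone UNIV) = emeasure lborel (ball (0 :: real^3) 1)"
    by (simp add: emeasure_Diff_null_set finite_imp_null_set_lborel)
  also have "\<dots> = ennreal (4 / 3 * pi)"
    by (simp add: emeasure_ball unit_ball_vol_3)
  finally show "emeasure unit_sphere_measure (space unit_sphere_measure) = 1"
    by (simp add: emeasure_unit_sphere_cone flip: ennreal_mult')
qed

interpretation usm: prob_space unit_sphere_measure
  by (rule prob_space_unit_sphere_measure)

lemma AE_unit_sphere_norm: "AE y in unit_sphere_measure. norm y = 1"
proof (rule AE_I)
  have "radial_cone (- sphere 0 1) = {}"
    by (auto simp: radial_cone_def) (metis left_inverse norm_eq_zero)
  then show "emeasure unit_sphere_measure (- sphere 0 1) = 0"
    by (simp add: emeasure_unit_sphere_cone borel_closed)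
qed (auto simp: borel_closed)

lemma orthogonal_transformation_bij_preimage:
  fixes T :: "real^3 \<Rightarrow> real^3"
  assumes "orthogonal_transformation T"
  obtains S where "orthogonal_transformation S" "\<And>A. T -` A = S ` A"
proof -
  have b: "bij T" by (rule orthogonal_transformation_bij[OF assms])
  show ?thesis
  proof (rule that[of "inv T"])
    show "orthogonal_transformation (inv T)" by (rule orthogonal_transformation_inv[OF assms])
    show "T -` A = inv T ` A" for A by (rule bij_vimage_eq_inv_image[OF b])
  qed
qed

text \<open>A linear isometry commutes with normalization of vectors, so the cone over a preimage is
  the preimage of the cone, and Lebesgue measure is invariant under isometries.\<close>

lemma distr_unit_sphere_orthogonal:
  assumes T: "orthogonal_transformation T"
  shows "distr unit_sphere_measure borel T = unit_sphere_measure"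
proof (rule measure_eqI)
  fix A assume "A \<in> sets (distr unit_sphere_measure borel T)"
  then have A[measurable]: "A \<in> sets borel" by simp
  have lin: "linear T" using T by (rule orthogonal_transformation_linear)
  then have [measurable]: "T \<in> borel_measurable borel"
    by (intro borel_measurable_continuous_onI linear_continuous_on linear_conv_bounded_linear[THEN iffD1])
  have TA: "T -` A \<in> sets borel" by (rule measurable_sets_borel[OF _ A]) measurable
  obtain S where S: "orthogonal_transformation S" "\<And>A. T -` A = S ` A"
    using orthogonal_transformation_bij_preimage[OF T] by metis
  have "radial_cone (T -` A) = S ` radial_cone A"
    unfolding S(2)[symmetric]
    by (auto simp: radial_cone_def orthogonal_transformation_norm[OF T] linear_0[OF lin] linear_scale[OF lin])
       (metis T norm_eq_zero orthogonal_transformation_norm)+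
  moreover have lm: "radial_cone A \<in> lmeasurable"
    by (rule bounded_set_imp_lmeasurable[OF bounded_subset[of "ball 0 1"]])
       (auto simp: radial_cone_def intro!: sets_completionI_sets radial_cone_measurable[unfolded radial_cone_def])
  ultimately have "emeasure lebesgue (radial_cone (T -` A)) = emeasure lebesgue (radial_cone A)"
    using measurable_orthogonal_image[OF S(1) lm] measure_orthogonal_image[OF S(1) lm]
    by (simp only: emeasure_eq_measure2)
  then have "emeasure lborel (radial_cone (T -` A)) = emeasure lborel (radial_cone A)"
    using radial_cone_measurable[OF A] radial_cone_measurable[OF TA] by (simp add: emeasure_completion)
  then show "emeasure (distr unit_sphere_measure borel T) A = emeasure unit_sphere_measure A"
    by (subst emeasure_distr) (simp_all add: emeasure_unit_sphere_cone TA)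
qed simp

text \<open>Archimedes' hat-box theorem; rotation invariance reduces it to the polar axis.\<close>

lemma nn_integral_unit_sphere_inner:
  fixes f :: "real \<Rightarrow> real"
  assumes a: "norm a = 1" and f[measurable]: "f \<in> borel_measurable borel" and nonneg: "\<And>u. 0 \<le> f u"
  shows "(\<integral>\<^sup>+y. ennreal (f (a \<bullet> y)) \<partial>unit_sphere_measure) = ennreal (1/2) * (\<integral>\<^sup>+u. ennreal (f u * indicator {-1..1} u) \<partial>lborel)"
proof -
  define e :: "real^3" where "e = axis 3 1"
  have e: "norm e = 1" by (simp add: e_def)
  have rect[measurable]: "{0..pi} \<times> {0..2*pi} \<in> sets (borel :: (real \<times> real) measure)"
    by (intro borel_closed closed_Times) auto
  have sf[measurable]: "(\<lambda>q :: real \<times> real. sin (fst q)) \<in> borel_measurable borel"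
    by (intro borel_measurable_continuous_onI continuous_intros)
  have cf[measurable]: "(\<lambda>q :: real \<times> real. cos (fst q)) \<in> borel_measurable borel"
    by (intro borel_measurable_continuous_onI continuous_intros)
  have p3: "sphere_param 0 1 q $ 3 = cos (fst q)" for q
    by (cases q) (simp add: sphere_param_0_1)
  have [measurable]: "(\<lambda>p::real^3. p $ i) \<in> borel_measurable borel" for i
    by (intro borel_measurable_continuous_onI continuous_intros)
  \<comment> \<open>Rotating \<open>a\<close> to the polar axis turns the inner product into the
    cosine of the polar angle.\<close>
  obtain T where T: "orthogonal_transformation T" "T a = e"
    using orthogonal_transformation_exists_1[OF a e] by metis
  have lin: "linear T" using T(1) by (rule orthogonal_transformation_linear)
  then have [measurable]: "T \<in> borel_measurable borel"
    by (intro borel_measurable_continuous_onI linear_continuous_on linear_conv_bounded_linear[THEN iffD1])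
  have "(\<integral>\<^sup>+y. ennreal (f (a \<bullet> y)) \<partial>unit_sphere_measure) = (\<integral>\<^sup>+y. ennreal (f (e \<bullet> T y)) \<partial>unit_sphere_measure)"
    using T by (metis orthogonal_transformation_def)
  also have "\<dots> = (\<integral>\<^sup>+y. ennreal (f (e \<bullet> y)) \<partial>distr unit_sphere_measure borel T)"
    by (subst nn_integral_distr) auto
  also have "\<dots> = (\<integral>\<^sup>+y. ennreal (f (e \<bullet> y)) \<partial>unit_sphere_measure)"
    by (simp add: distr_unit_sphere_orthogonal[OF T(1)])
  also have "\<dots> = (\<integral>\<^sup>+y. ennreal (f (y $ 3)) \<partial>unit_sphere_measure)"
    by (simp add: e_def inner_axis')
  also have "\<dots> = (\<integral>\<^sup>+q. ennreal (sin (fst q) / (4 * pi)) * indicator ({0..pi} \<times> {0..2*pi}) q * ennreal (f (cos (fst q))) \<partial>lborel)"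
    unfolding unit_sphere_measure_def
    by (subst nn_integral_distr, simp_all add: p3, subst nn_integral_density) simp_all
  also have "\<dots> = (\<integral>\<^sup>+(a, b). ennreal (f (cos a) * sin a * indicator {0..pi} a) * (ennreal (1 / (4 * pi)) * indicator {0..2*pi} b) \<partial>(lborel \<Otimes>\<^sub>M lborel))"
    unfolding lborel_prod
  proof (intro nn_integral_cong, clarsimp, goal_cases)
    case (1 a b)
    have "ennreal (sin a / (4 * pi)) * ennreal (f (cos a)) = ennreal (f (cos a) * sin a) * ennreal (1 / (4 * pi))" if "0 \<le> a" "a \<le> pi"
      using sin_ge_zero[OF that] nonneg[of "cos a"] by (simp flip: ennreal_mult add: mult_ac)
    then show ?case by (auto simp: indicator_def)
  qed
  also have "\<dots> = (\<integral>\<^sup>+a. \<integral>\<^sup>+b. ennreal (f (cos a) * sin a * indicator {0..pi} a) * (ennreal (1 / (4 * pi)) * indicator {0..2*pi} b) \<partial>lborel \<partial>lborel)"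
    by (subst lborel.nn_integral_fst[symmetric]) (auto simp: case_prod_beta)
  also have "\<dots> = (\<integral>\<^sup>+a. ennreal (f (cos a) * sin a * indicator {0..pi} a) \<partial>lborel) * (\<integral>\<^sup>+b. ennreal (1 / (4 * pi)) * indicator {0..2*pi} (b::real) \<partial>lborel)"
    by (simp add: nn_integral_cmult nn_integral_multc)
  also have "(\<integral>\<^sup>+b. ennreal (1 / (4 * pi)) * indicator {0..2*pi} (b::real) \<partial>lborel) = ennreal (1/2)"
    by (subst nn_integral_cmult_indicator) (auto simp flip: ennreal_mult)
  also have "(\<integral>\<^sup>+a. ennreal (f (cos a) * sin a * indicator {0..pi} a) \<partial>lborel)
      = (\<integral>\<^sup>+u. ennreal (f (- u) * indicator {- cos 0..- cos pi} u) \<partial>lborel)"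
  \<comment> \<open>The substitution is u = - cos a, which is increasing on [0, pi] with derivative
    sin a; the sign is undone afterwards by reflecting Lebesgue measure.\<close>
  proof -
    have "(\<integral>\<^sup>+x. (\<lambda>u. f (- u)) x * indicator {- cos 0..- cos pi} x \<partial>lborel) =
             (\<integral>\<^sup>+x. (\<lambda>u. f (- u)) (- cos x) * sin x * indicator {0..pi} x \<partial>lborel)"
      by (rule nn_integral_substitution)
         (auto simp: set_borel_measurable_def intro!: derivative_eq_intros continuous_intros sin_ge_zero)
    then show ?thesis by simp
  qed
  also have "\<dots> = (\<integral>\<^sup>+u. ennreal (f u * indicator {-1..1} u) \<partial>lborel)"
  proof -
    have "(\<integral>\<^sup>+u. ennreal (f u * indicator {-1..1} u) \<partial>lborel)
        = (\<integral>\<^sup>+u. ennreal (f u * indicator {-1..1} u) \<partial>distr lborel borel uminus)"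
      by (simp add: lborel_distr_uminus)
    also have "\<dots> = (\<integral>\<^sup>+u. ennreal (f (- u) * indicator {- cos 0..- cos pi} u) \<partial>lborel)"
      by (subst nn_integral_distr) (auto intro!: nn_integral_cong simp: indicator_def)
    finally show ?thesis by simp
  qed
  finally show ?thesis by (simp add: mult.commute)
qed

text \<open>A unit vector \<open>p\<close> is contained in the slice of inner product 1 with
  \<open>p\<close>, which is null by the hat-box theorem. Needed so that a randomly moved electron
  almost surely avoids the others.\<close>

lemma unit_sphere_no_atom: "emeasure unit_sphere_measure {p} = 0"
proof (cases "norm p = 1")
  case False
  then have "radial_cone {p} = {}" by (auto simp: radial_cone_def)
  then show ?thesis by (simp add: emeasure_unit_sphere_cone)
next
  case True
  have "emeasure unit_sphere_measure {p} = (\<integral>\<^sup>+y. indicator {p} y \<partial>unit_sphere_measure)"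
    by simp
  also have "\<dots> \<le> (\<integral>\<^sup>+y. ennreal (indicator {1} (p \<bullet> y)) \<partial>unit_sphere_measure)"
    using True by (intro nn_integral_mono) (auto simp: indicator_def norm_eq_1)
  also have "\<dots> = ennreal (1/2) * (\<integral>\<^sup>+u. ennreal (indicator {1::real} u * indicator {-1..1} u) \<partial>lborel)"
    by (rule nn_integral_unit_sphere_inner[where f = "indicator {1}", OF True]) auto
  also have "(\<integral>\<^sup>+u. ennreal (indicator {1::real} u * indicator {-1..1} u) \<partial>lborel) = (\<integral>\<^sup>+u. indicator {1::real} u \<partial>lborel)"
    by (intro nn_integral_cong) (auto simp: indicator_def)
  also have "\<dots> = 0" by (subst nn_integral_indicator) auto
  finally show ?thesis by simp
qed

text \<open>The cone over an open set is open, and it contains half of \<open>y\<close>. In the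
  minimum principle this turns an almost everywhere equality into one at a given point.\<close>

lemma unit_sphere_open_pos:
  assumes "open U" "y \<in> U" "norm y = 1"
  shows "emeasure unit_sphere_measure U > 0"
proof -
  have "open ((- {0} \<inter> ball 0 1) \<inter> (\<lambda>x::real^3. x /\<^sub>R norm x) -` U)"
    by (rule continuous_open_preimage) (auto intro!: continuous_intros assms)
  also have "(- {0} \<inter> ball 0 1) \<inter> (\<lambda>x::real^3. x /\<^sub>R norm x) -` U = radial_cone U"
    by (auto simp: radial_cone_def)
  finally have op: "open (radial_cone U)" .
  have "(1/2) *\<^sub>R y \<in> radial_cone U"
    using assms by (auto simp: radial_cone_def)
  then have "\<not> negligible (radial_cone U)" using open_not_negligible[OF op] by blast
  then have "emeasure lborel (radial_cone U) \<noteq> 0"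
    using op by (auto simp: negligible_iff_emeasure0 borel_open emeasure_completion)
  then show ?thesis
    using assms by (auto simp: emeasure_unit_sphere_cone borel_open zero_less_iff_neq_zero ennreal_mult_eq_top_iff)
qed

section \<open>Spherical averages of the softened kernel\<close>

text \<open>At \<open>\<epsilon> = 0\<close> this is the Coulomb kernel, with value 0 on the
  diagonal, so a single averaging formula serves both kernels.\<close>

definition soft_coulomb :: "real \<Rightarrow> real^3 \<Rightarrow> real^3 \<Rightarrow> real" where
  "soft_coulomb \<epsilon> x y = 1 / sqrt ((norm (x - y))\<^sup>2 + \<epsilon>\<^sup>2)"

text \<open>Potential at distance \<rho> from the centre of a unit charge spread uniformly over a
  sphere of radius r. At \<open>\<epsilon> = 0\<close> and positive radii it is 1 / max \<rho> r,
  Newton's theorem.\<close>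

definition sphere_potential :: "real \<Rightarrow> real \<Rightarrow> real \<Rightarrow> real" where
  "sphere_potential \<epsilon> r \<rho> = (sqrt ((\<rho> + r)\<^sup>2 + \<epsilon>\<^sup>2) - sqrt ((\<rho> - r)\<^sup>2 + \<epsilon>\<^sup>2)) / (2 * \<rho> * r)"

text \<open>On the sphere the squared distance to \<open>x\<close> is affine in the inner product
  with the direction of \<open>x - c\<close>, so the hat-box theorem leaves a one-dimensional
  integral with explicit primitive.\<close>

lemma has_bochner_integral_soft_coulomb_sphere:
  assumes "r > 0" "x \<noteq> c"
  shows "has_bochner_integral unit_sphere_measure (\<lambda>y. soft_coulomb \<epsilon> x (c + r *\<^sub>R y)) (sphere_potential \<epsilon> r (norm (x - c)))"
proof -
  define \<rho> where "\<rho> = norm (x - c)"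
  have \<rho>: "\<rho> > 0" using assms by (simp add: \<rho>_def)
  define a where "a = (x - c) /\<^sub>R \<rho>"
  have a: "norm a = 1" "x - c = \<rho> *\<^sub>R a" using \<rho> by (auto simp: a_def \<rho>_def)
  define A where "A = \<rho>\<^sup>2 + r\<^sup>2 + \<epsilon>\<^sup>2"
  define f where "f u = 1 / sqrt (A - 2 * \<rho> * r * u) * indicator {-1..1} u" for u
  have A: "A - 2 * \<rho> * r * u \<ge> 0" if "u \<le> 1" for u
  proof -
    have "2 * \<rho> * r * u \<le> 2 * \<rho> * r * 1" using \<rho> assms that by (intro mult_left_mono) auto
    also have "\<dots> \<le> \<rho>\<^sup>2 + r\<^sup>2" using sum_squares_bound[of \<rho> r] by simp
    finally show ?thesis by (simp add: A_def add_increasing2)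
  qed
  have A': "A - 2 * \<rho> * r * u > 0" if "u < 1" for u
  proof -
    have "2 * \<rho> * r * u < 2 * \<rho> * r * 1" using \<rho> assms that by (intro mult_strict_left_mono) auto
    with A[of 1] show ?thesis by simp
  qed
  have f[measurable]: "f \<in> borel_measurable borel" unfolding f_def by measurable
  have nonneg: "f u \<ge> 0" for u using A[of u] by (auto simp: f_def indicator_def)
  define F where "F u = - sqrt (A - 2 * \<rho> * r * u) / (\<rho> * r)" for u
  \<comment> \<open>For \<open>\<epsilon> = 0\<close> and \<open>\<rho> = r\<close> the integrand is
    singular at u = 1, hence the version of the fundamental theorem that differentiates only in the
    interior.\<close>
  have "((\<lambda>u. 1 / sqrt (A - 2 * \<rho> * r * u)) has_integral (F 1 - F (-1))) {-1..1}"
  proof (rule fundamental_theorem_of_calculus_interior)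
    show "continuous_on {-1..1} F" unfolding F_def using \<rho> assms by (intro continuous_intros) auto
    fix u :: real assume "u \<in> {-1<..<1}"
    then have "(F has_real_derivative 1 / sqrt (A - 2 * \<rho> * r * u)) (at u)"
      unfolding F_def using A'[of u] \<rho> assms
      by (auto intro!: derivative_eq_intros simp: field_simps)
    then show "(F has_vector_derivative 1 / sqrt (A - 2 * \<rho> * r * u)) (at u)"
      by (simp add: has_real_derivative_iff_has_vector_derivative)
  qed simp
  then have "((\<lambda>u. if u \<in> {-1..1} then 1 / sqrt (A - 2 * \<rho> * r * u) else 0) has_integral (F 1 - F (-1))) UNIV"
    by (simp only: has_integral_restrict_UNIV)
  also have "(\<lambda>u. if u \<in> {-1..1} then 1 / sqrt (A - 2 * \<rho> * r * u) else 0) = f"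
    by (auto simp: f_def fun_eq_iff)
  finally have "(\<integral>\<^sup>+u. ennreal (f u) \<partial>lborel) = ennreal (F 1 - F (-1))"
    by (intro nn_integral_has_integral_lborel nonneg) auto
  moreover have "A - 2 * \<rho> * r * 1 = (\<rho> - r)\<^sup>2 + \<epsilon>\<^sup>2" "A - 2 * \<rho> * r * (-1) = (\<rho> + r)\<^sup>2 + \<epsilon>\<^sup>2"
    by (auto simp: A_def power2_eq_square algebra_simps)
  then have FF: "F 1 - F (-1) = 2 * sphere_potential \<epsilon> r \<rho>"
    using \<rho> assms by (simp add: F_def sphere_potential_def field_simps)
  moreover have "(\<lambda>u. ennreal (f u * indicator {-1..1} u)) = (\<lambda>u. ennreal (f u))"
    by (auto simp: f_def fun_eq_iff indicator_def)
  ultimately have "(\<integral>\<^sup>+y. ennreal (f (a \<bullet> y)) \<partial>unit_sphere_measure) = ennreal (1/2) * ennreal (2 * sphere_potential \<epsilon> r \<rho>)"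
    using nn_integral_unit_sphere_inner[OF a(1) f nonneg] by simp
  moreover have pos: "sphere_potential \<epsilon> r \<rho> \<ge> 0"
    using \<rho> assms by (auto simp: sphere_potential_def intro!: divide_nonneg_nonneg power_mono abs_le_square_iff[THEN iffD1])
  moreover from pos have "ennreal (1/2) * ennreal (2 * sphere_potential \<epsilon> r \<rho>) = ennreal (sphere_potential \<epsilon> r \<rho>)"
    by (subst ennreal_mult[symmetric]) auto
  ultimately have "has_bochner_integral unit_sphere_measure (\<lambda>y. f (a \<bullet> y)) (sphere_potential \<epsilon> r \<rho>)"
    by (intro has_bochner_integral_nn_integral) (auto simp: nonneg)
  moreover have "AE y in unit_sphere_measure. f (a \<bullet> y) = soft_coulomb \<epsilon> x (c + r *\<^sub>R y)"
    using AE_unit_sphere_norm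
  proof eventually_elim
    case (elim y)
    have xy: "x - (c + r *\<^sub>R y) = \<rho> *\<^sub>R a - r *\<^sub>R y" using a by (simp add: algebra_simps)
    have "(norm (x - (c + r *\<^sub>R y)))\<^sup>2 = \<rho>\<^sup>2 * (a \<bullet> a) + r\<^sup>2 * (y \<bullet> y) - 2 * \<rho> * r * (a \<bullet> y)"
      unfolding power2_norm_eq_inner xy
      by (simp add: inner_diff_left inner_diff_right inner_commute power2_eq_square algebra_simps)
    then have *: "(norm (x - (c + r *\<^sub>R y)))\<^sup>2 = \<rho>\<^sup>2 + r\<^sup>2 - 2 * \<rho> * r * (a \<bullet> y)"
      using a elim by (simp add: norm_eq_1)
    have "\<bar>a \<bullet> y\<bar> \<le> 1" using Cauchy_Schwarz_ineq2[of a y] a elim by simp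
    then have "a \<bullet> y \<in> {-1..1}" by (auto simp: abs_le_iff)
    then show ?case unfolding soft_coulomb_def * by (simp add: f_def A_def algebra_simps)
  qed
  ultimately show ?thesis
    unfolding \<rho>_def[symmetric] soft_coulomb_def
    by (subst has_bochner_integral_cong_AE[where g = "\<lambda>y. f (a \<bullet> y)"]) (auto elim: eventually_mono)
qed

section \<open>Positive definiteness of the softened Coulomb kernel\<close>

text \<open>The tail is dominated term by term; the bound is uniform on [-R, R] and vanishes as
  \<open>n\<close> grows.\<close>

lemma exp_partial_sum_bound:
  fixes z :: real
  assumes "\<bar>z\<bar> \<le> R"
  shows "\<bar>exp z - (\<Sum>k<n. z ^ k / fact k)\<bar> \<le> exp R - (\<Sum>k<n. R ^ k / fact k)"
proof -
  have s: "(\<lambda>k. x ^ k / fact k) sums exp x" for x :: real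
    using exp_converges[of x] by (simp add: divide_inverse mult.commute)
  have tail: "(\<lambda>k. x ^ (k + n) / fact (k + n)) sums (exp x - (\<Sum>k<n. x ^ k / fact k))" for x :: real
    by (rule sums_split_initial_segment[OF s])
  have "norm (exp z - (\<Sum>k<n. z ^ k / fact k)) \<le> exp R - (\<Sum>k<n. R ^ k / fact k)"
  proof (rule norm_sums_le[OF tail tail])
    show "norm (z ^ (k + n) / fact (k + n)) \<le> R ^ (k + n) / fact (k + n)" for k
      using power_mono[OF assms abs_ge_zero, of "k + n"] by (simp add: power_abs divide_right_mono)
  qed
  then show ?thesis by simp
qed

lemma has_bochner_integral_gaussian:
  fixes u :: real
  assumes "u > 0"
  shows "has_bochner_integral lborel (\<lambda>t. exp (- u * t\<^sup>2)) (sqrt pi / sqrt u)"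
proof -
  define \<sigma> where "\<sigma> = 1 / sqrt (2 * u)"
  have \<sigma>: "\<sigma> > 0" "\<sigma>\<^sup>2 = 1 / (2 * u)" using assms by (auto simp: \<sigma>_def power_divide)
  have "has_bochner_integral lborel (normal_density 0 \<sigma>) 1"
    using \<sigma> by (simp add: has_bochner_integral_iff)
  then have "has_bochner_integral lborel (\<lambda>t. (sqrt pi / sqrt u) * normal_density 0 \<sigma> t) ((sqrt pi / sqrt u) * 1)"
    by (rule has_bochner_integral_mult_right)
  moreover have "(sqrt pi / sqrt u) * normal_density 0 \<sigma> t = exp (- u * t\<^sup>2)" for t
    using assms by (simp add: normal_density_def \<sigma>(2) real_sqrt_divide field_simps)
  ultimately show ?thesis by simp
qed

text \<open>The signed measure \<open>\<Sum>j\<in>J. w j \<cdot> m j\<close> is represented by the functional it defines.\<close>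

definition lincomb_integral :: "'j set \<Rightarrow> ('j \<Rightarrow> real) \<Rightarrow> ('j \<Rightarrow> (real^3) measure) \<Rightarrow> (real^3 \<Rightarrow> real) \<Rightarrow> real" where
  "lincomb_integral J w m f = (\<Sum>j\<in>J. w j * (\<integral>x. f x \<partial>m j))"

text \<open>Boundedness is asked only on the ball that carries all measures, so that coordinates and
  polynomials qualify.\<close>

definition bounded_borel_on_ball :: "real \<Rightarrow> (real^3 \<Rightarrow> real) \<Rightarrow> bool" where
  "bounded_borel_on_ball B f \<longleftrightarrow> f \<in> borel_measurable borel \<and> (\<exists>K. \<forall>x. norm x \<le> B \<longrightarrow> \<bar>f x\<bar> \<le> K)"

lemma bounded_borel_on_ball_measurable [measurable_dest]:
  "bounded_borel_on_ball B f \<Longrightarrow> f \<in> borel_measurable borel"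
  by (simp add: bounded_borel_on_ball_def)

lemma bounded_borel_on_ball_continuous:
  assumes "continuous_on UNIV f"
  shows "bounded_borel_on_ball B f"
proof -
  have "compact (f ` cball 0 B)"
    by (intro compact_continuous_image continuous_on_subset[OF assms]) auto
  then obtain K where "\<forall>y\<in>f ` cball 0 B. norm y \<le> K"
    using compact_imp_bounded bounded_iff by blast
  then show ?thesis
    using assms by (auto simp: bounded_borel_on_ball_def intro!: borel_measurable_continuous_onI exI[of _ K])
qed

lemma bounded_borel_on_ball_const: "bounded_borel_on_ball B (\<lambda>x. c)"
  by (intro bounded_borel_on_ball_continuous continuous_intros)

lemma bounded_borel_on_ball_nth: "bounded_borel_on_ball B (\<lambda>x. x $ i)"
  by (intro bounded_borel_on_ball_continuous continuous_intros)

lemma bounded_borel_on_ball_add: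
  assumes "bounded_borel_on_ball B f" "bounded_borel_on_ball B g"
  shows "bounded_borel_on_ball B (\<lambda>x. f x + g x)"
proof -
  from assms obtain K1 K2 where "\<And>x. norm x \<le> B \<Longrightarrow> \<bar>f x\<bar> \<le> K1" "\<And>x. norm x \<le> B \<Longrightarrow> \<bar>g x\<bar> \<le> K2"
    by (auto simp: bounded_borel_on_ball_def)
  then have "norm x \<le> B \<longrightarrow> \<bar>f x + g x\<bar> \<le> K1 + K2" for x
    using abs_triangle_ineq[of "f x" "g x"] by (smt (verit, best))
  with assms show ?thesis unfolding bounded_borel_on_ball_def by auto
qed

lemma bounded_borel_on_ball_mult:
  assumes "bounded_borel_on_ball B f" "bounded_borel_on_ball B g"
  shows "bounded_borel_on_ball B (\<lambda>x. f x * g x)"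
proof -
  from assms obtain K1 K2 where "\<And>x. norm x \<le> B \<Longrightarrow> \<bar>f x\<bar> \<le> K1" "\<And>x. norm x \<le> B \<Longrightarrow> \<bar>g x\<bar> \<le> K2"
    by (auto simp: bounded_borel_on_ball_def)
  then have "norm x \<le> B \<longrightarrow> \<bar>f x * g x\<bar> \<le> \<bar>K1\<bar> * \<bar>K2\<bar>" for x
    unfolding abs_mult by (intro impI mult_mono) (auto intro: order_trans[OF _ abs_ge_self])
  with assms show ?thesis unfolding bounded_borel_on_ball_def by auto
qed

lemmas bounded_borel_on_ball_intros =
  bounded_borel_on_ball_const bounded_borel_on_ball_nth bounded_borel_on_ball_add bounded_borel_on_ball_mult

section \<open>Signed combinations of probability measures on a ball\<close>

text \<open>\<open>B\<close> bounds the supports and \<open>C\<close> the total variation. Estimates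
  depend on the family only through these two numbers, so they are uniform along sequences of
  families.\<close>

locale signed_family =
  fixes J :: "'j set" and w :: "'j \<Rightarrow> real" and m :: "'j \<Rightarrow> (real^3) measure" and B C :: real
  assumes finite_J: "finite J"
    and prob: "j \<in> J \<Longrightarrow> prob_space (m j)"
    and sets_m: "j \<in> J \<Longrightarrow> sets (m j) = sets borel"
    and support: "j \<in> J \<Longrightarrow> AE x in m j. norm x \<le> B"
    and weights: "(\<Sum>j\<in>J. \<bar>w j\<bar>) \<le> C"
    and B_pos: "B > 0"
begin

abbreviation L :: "(real^3 \<Rightarrow> real) \<Rightarrow> real" where "L \<equiv> lincomb_integral J w m"

lemma C_nonneg: "C \<ge> 0"
  using weights sum_nonneg[of J "\<lambda>j. \<bar>w j\<bar>"] by linarith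

lemma integrable:
  assumes "bounded_borel_on_ball B f" "j \<in> J"
  shows "integrable (m j) f"
proof -
  interpret prob_space "m j" using prob assms by auto
  from assms obtain K where K: "\<And>x. norm x \<le> B \<Longrightarrow> \<bar>f x\<bar> \<le> K"
    by (auto simp: bounded_borel_on_ball_def)
  show ?thesis
  proof (rule integrable_const_bound[where B=K])
    show "AE x in m j. norm (f x) \<le> K"
      using support[OF assms(2)] by eventually_elim (auto simp: K)
    show "f \<in> borel_measurable (m j)"
      using assms sets_m[OF assms(2)] by (auto simp: bounded_borel_on_ball_def cong: measurable_cong_sets)
  qed
qed

lemma L_add:
  assumes "bounded_borel_on_ball B f" "bounded_borel_on_ball B g"
  shows "L (\<lambda>x. f x + g x) = L f + L g"
  unfolding lincomb_integral_def using integrable assms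
  by (simp add: sum.distrib[symmetric] distrib_left)

lemma L_mult: "L (\<lambda>x. c * f x) = c * L f"
  unfolding lincomb_integral_def by (simp add: sum_distrib_left mult_ac)

lemma L_mult_right: "L (\<lambda>x. f x * c) = L f * c"
  using L_mult[of c f] by (simp add: mult.commute)

lemma L_sum:
  assumes "finite I" "\<And>i. i \<in> I \<Longrightarrow> bounded_borel_on_ball B (f i)"
  shows "L (\<lambda>x. \<Sum>i\<in>I. f i x) = (\<Sum>i\<in>I. L (f i))"
    and "bounded_borel_on_ball B (\<lambda>x. \<Sum>i\<in>I. f i x)"
proof -
  from assms have "L (\<lambda>x. \<Sum>i\<in>I. f i x) = (\<Sum>i\<in>I. L (f i)) \<and> bounded_borel_on_ball B (\<lambda>x. \<Sum>i\<in>I. f i x)"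
  proof (induction rule: finite_induct)
    case empty
    then show ?case using bounded_borel_on_ball_const by (simp add: lincomb_integral_def)
  next
    case (insert i I)
    then show ?case by (simp add: L_add bounded_borel_on_ball_add)
  qed
  then show "L (\<lambda>x. \<Sum>i\<in>I. f i x) = (\<Sum>i\<in>I. L (f i))" "bounded_borel_on_ball B (\<lambda>x. \<Sum>i\<in>I. f i x)" by auto
qed

lemma L_bound:
  assumes f: "f \<in> borel_measurable borel" and K: "\<And>x. norm x \<le> B \<Longrightarrow> \<bar>f x\<bar> \<le> K"
  shows "\<bar>L f\<bar> \<le> C * K"
proof -
  have K0: "0 \<le> K" using K[of 0] B_pos by simp
  have bb: "bounded_borel_on_ball B f" using assms by (auto simp: bounded_borel_on_ball_def)
  have "\<bar>L f\<bar> \<le> (\<Sum>j\<in>J. \<bar>w j * (\<integral>x. f x \<partial>m j)\<bar>)"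
    unfolding lincomb_integral_def by (rule sum_abs)
  also have "\<dots> \<le> (\<Sum>j\<in>J. \<bar>w j\<bar> * K)"
  proof (rule sum_mono)
    fix j assume j: "j \<in> J"
    interpret prob_space "m j" using prob j by auto
    have "\<bar>\<integral>x. f x \<partial>m j\<bar> \<le> (\<integral>x. \<bar>f x\<bar> \<partial>m j)" by (rule integral_abs_bound)
    also have "\<dots> \<le> (\<integral>x. K \<partial>m j)"
      using support[OF j] by (intro integral_mono_AE integrable_abs integrable[OF bb j]) (auto elim!: eventually_mono simp: K)
    also have "\<dots> = K" by (simp add: prob_space)
    finally show "\<bar>w j * (\<integral>x. f x \<partial>m j)\<bar> \<le> \<bar>w j\<bar> * K"
      by (simp add: abs_mult mult_left_mono)
  qed
  also have "\<dots> \<le> C * K" using weights K0 by (simp add: sum_distrib_right[symmetric] mult_right_mono)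
  finally show ?thesis .
qed

lemma L_diff_bound:
  assumes f: "bounded_borel_on_ball B f" and g: "bounded_borel_on_ball B g"
    and K: "\<And>x. norm x \<le> B \<Longrightarrow> \<bar>f x - g x\<bar> \<le> K"
  shows "\<bar>L f - L g\<bar> \<le> C * K"
proof -
  have "L (\<lambda>x. f x + (-1) * g x) = L f + (-1) * L g"
    using L_add[OF f bounded_borel_on_ball_mult[OF bounded_borel_on_ball_const[of B "-1"] g]] L_mult[of "-1" g]
    by simp
  moreover have "\<bar>L (\<lambda>x. f x + (-1) * g x)\<bar> \<le> C * K"
    using f g K by (intro L_bound) auto
  ultimately show ?thesis by simp
qed

lemma L_measurable [measurable]:
  assumes F[measurable]: "case_prod F \<in> borel_measurable (N \<Otimes>\<^sub>M borel)"
  shows "(\<lambda>x. L (F x)) \<in> borel_measurable N"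
  unfolding lincomb_integral_def
proof (intro borel_measurable_sum borel_measurable_times borel_measurable_const)
  fix j assume j: "j \<in> J"
  interpret prob_space "m j" using prob j by auto
  have "sets (N \<Otimes>\<^sub>M m j) = sets (N \<Otimes>\<^sub>M borel)"
    by (rule sets_pair_measure_cong) (auto simp: sets_m j)
  then have "case_prod F \<in> borel_measurable (N \<Otimes>\<^sub>M m j)"
    using F by (simp cong: measurable_cong_sets)
  then show "(\<lambda>x. integral\<^sup>L (m j) (F x)) \<in> borel_measurable N"
    by (rule borel_measurable_lebesgue_integral)
qed

abbreviation LL :: "(real^3 \<Rightarrow> real^3 \<Rightarrow> real) \<Rightarrow> real" where "LL F \<equiv> L (\<lambda>x. L (F x))"

definition bounded_borel2 :: "(real^3 \<Rightarrow> real^3 \<Rightarrow> real) \<Rightarrow> bool" where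
  "bounded_borel2 F \<longleftrightarrow> case_prod F \<in> borel_measurable (borel \<Otimes>\<^sub>M borel) \<and>
     (\<exists>K. \<forall>x y. norm x \<le> B \<longrightarrow> norm y \<le> B \<longrightarrow> \<bar>F x y\<bar> \<le> K)"

lemma bounded_borel2_continuous:
  assumes "continuous_on UNIV (\<lambda>p. F (fst p) (snd p))"
  shows "bounded_borel2 F"
proof -
  let ?f = "\<lambda>p. F (fst p) (snd p)"
  have "compact (?f ` (cball 0 B \<times> cball 0 B))"
    by (intro compact_continuous_image continuous_on_subset[OF assms] compact_Times) auto
  then obtain K where K: "\<forall>y\<in>?f ` (cball 0 B \<times> cball 0 B). norm y \<le> K"
    using compact_imp_bounded bounded_iff by blast
  have "\<bar>F x y\<bar> \<le> K" if "norm x \<le> B" "norm y \<le> B" for x y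
    using bspec[OF K, of "F x y"] that by force
  moreover have "case_prod F \<in> borel_measurable (borel \<Otimes>\<^sub>M borel)"
    using borel_measurable_continuous_onI[OF assms] by (simp add: borel_prod case_prod_beta')
  ultimately show ?thesis unfolding bounded_borel2_def by blast
qed

lemma bounded_borel2_section:
  assumes "bounded_borel2 F" "norm x \<le> B"
  shows "bounded_borel_on_ball B (F x)"
  using assms measurable_Pair2[of "case_prod F" borel borel borel x]
  by (fastforce simp: bounded_borel2_def bounded_borel_on_ball_def)

lemma bounded_borel2_L:
  assumes F: "bounded_borel2 F"
  shows "bounded_borel_on_ball B (\<lambda>x. L (F x))"
proof -
  from F have [measurable]: "case_prod F \<in> borel_measurable (borel \<Otimes>\<^sub>M borel)"
    by (simp add: bounded_borel2_def)
  from F obtain K where K: "\<And>x y. norm x \<le> B \<Longrightarrow> norm y \<le> B \<Longrightarrow> \<bar>F x y\<bar> \<le> K"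
    by (auto simp: bounded_borel2_def)
  have "norm x \<le> B \<longrightarrow> \<bar>L (F x)\<bar> \<le> C * K" for x
    using bounded_borel2_section[OF F] K by (auto intro!: L_bound simp: bounded_borel_on_ball_def)
  then show ?thesis unfolding bounded_borel_on_ball_def by auto
qed

lemma LL_diff_bound:
  assumes F: "bounded_borel2 F" and G: "bounded_borel2 G"
    and K: "\<And>x y. norm x \<le> B \<Longrightarrow> norm y \<le> B \<Longrightarrow> \<bar>F x y - G x y\<bar> \<le> K"
  shows "\<bar>LL F - LL G\<bar> \<le> C\<^sup>2 * K"
proof -
  have "\<bar>LL F - LL G\<bar> \<le> C * (C * K)"
    using F G K by (intro L_diff_bound bounded_borel2_L bounded_borel2_section)
  then show ?thesis by (simp add: power2_eq_square mult.assoc)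
qed

lemma LL_sum:
  assumes "finite I" "\<And>i. i \<in> I \<Longrightarrow> bounded_borel2 (F i)"
  shows "LL (\<lambda>x y. \<Sum>i\<in>I. F i x y) = (\<Sum>i\<in>I. LL (F i))"
proof -
  have "LL (\<lambda>x y. \<Sum>i\<in>I. F i x y) = L (\<lambda>x. \<Sum>i\<in>I. L (F i x))"
    unfolding lincomb_integral_def[of J w m "\<lambda>x. L (\<lambda>y. \<Sum>i\<in>I. F i x y)"] lincomb_integral_def[of J w m "\<lambda>x. \<Sum>i\<in>I. L (F i x)"]
  proof (intro sum.cong refl arg_cong2[where f="(*)"])
    fix j assume j: "j \<in> J"
    show "(\<integral>x. L (\<lambda>y. \<Sum>i\<in>I. F i x y) \<partial>m j) = (\<integral>x. (\<Sum>i\<in>I. L (F i x)) \<partial>m j)"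
    proof (rule integral_cong_AE)
      have I: "(\<lambda>(x, y). \<Sum>i\<in>I. F i x y) \<in> borel_measurable (borel \<Otimes>\<^sub>M borel)"
        using assms unfolding bounded_borel2_def case_prod_beta' by (intro borel_measurable_sum) (auto simp: case_prod_beta')
      show "(\<lambda>x. L (\<lambda>y. \<Sum>i\<in>I. F i x y)) \<in> borel_measurable (m j)"
        using L_measurable[OF I] by (simp cong: measurable_cong_sets add: sets_m[OF j])
      have "(\<lambda>x. (\<Sum>i\<in>I. L (F i x))) \<in> borel_measurable borel"
        using bounded_borel2_L assms by (intro borel_measurable_sum) (auto simp: bounded_borel_on_ball_def)
      then show "(\<lambda>x. (\<Sum>i\<in>I. L (F i x))) \<in> borel_measurable (m j)"
        by (simp cong: measurable_cong_sets add: sets_m[OF j])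
      \<comment> \<open>Sections are controlled only for \<open>x\<close> in the ball, so the inner
        sum rule is available almost everywhere rather than pointwise.\<close>
      show "AE x in m j. L (\<lambda>y. \<Sum>i\<in>I. F i x y) = (\<Sum>i\<in>I. L (F i x))"
        using support[OF j] by eventually_elim (intro L_sum assms bounded_borel2_section)
    qed
  qed
  also have "\<dots> = (\<Sum>i\<in>I. LL (F i))"
    using assms by (intro L_sum bounded_borel2_L) auto
  finally show ?thesis .
qed

text \<open>The squared norm of the k-th moment tensor: unfolding yields the sum, over all index
  tuples of length k, of the squared integrals of \<open>h\<close> times the corresponding
  monomial.\<close>

primrec tensor_norm :: "nat \<Rightarrow> (real^3 \<Rightarrow> real) \<Rightarrow> real" where
  "tensor_norm 0 h = (L h)\<^sup>2"
| "tensor_norm (Suc k) h = (\<Sum>i\<in>UNIV. tensor_norm k (\<lambda>x. x $ i * h x))"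

lemma tensor_norm_nonneg: "tensor_norm k h \<ge> 0"
  by (induction k arbitrary: h) (auto intro: sum_nonneg)

text \<open>The power of the inner product expands over index tuples into products of a monomial in
  \<open>x\<close> with the same monomial in \<open>y\<close>; the double functional squares each of
  them.\<close>

lemma LL_power:
  assumes "continuous_on UNIV h"
  shows "LL (\<lambda>x y. h x * h y * (x \<bullet> y) ^ k) = tensor_norm k h"
  using assms
proof (induction k arbitrary: h)
  case 0
  then show ?case by (simp add: L_mult L_mult_right power2_eq_square)
next
  case (Suc k)
  have eq: "h x * h y * (x \<bullet> y) ^ Suc k = (\<Sum>i\<in>UNIV. (x $ i * h x) * (y $ i * h y) * (x \<bullet> y) ^ k)" for x y
  proof -
    have "h x * h y * (x \<bullet> y) ^ Suc k = (\<Sum>i\<in>UNIV. x $ i * y $ i) * (h x * h y * (x \<bullet> y) ^ k)"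
      by (simp add: inner_vec_def)
    also have "\<dots> = (\<Sum>i\<in>UNIV. (x $ i * h x) * (y $ i * h y) * (x \<bullet> y) ^ k)"
      unfolding sum_distrib_right by (intro sum.cong) auto
    finally show ?thesis .
  qed
  have "LL (\<lambda>x y. h x * h y * (x \<bullet> y) ^ Suc k) = (\<Sum>i\<in>UNIV. LL (\<lambda>x y. (x $ i * h x) * (y $ i * h y) * (x \<bullet> y) ^ k))"
    unfolding eq
    by (rule LL_sum) (auto intro!: bounded_borel2_continuous continuous_intros continuous_on_compose2[OF Suc.prems])
  also have "\<dots> = (\<Sum>i\<in>UNIV. tensor_norm k (\<lambda>x. x $ i * h x))"
    by (intro sum.cong refl Suc.IH continuous_intros Suc.prems)
  finally show ?case by simp
qed

section \<open>Energies of Gaussian kernels\<close>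

definition gauss_energy :: "real \<Rightarrow> real" where
  "gauss_energy s = LL (\<lambda>x y. exp (- s * (norm (x - y))\<^sup>2))"

lemma bounded_borel2_gauss: "bounded_borel2 (\<lambda>x y. exp (- s * (norm (x - y))\<^sup>2))"
  by (intro bounded_borel2_continuous continuous_intros)

text \<open>Expanding \<open>exp (2 s \<langle>x, y\<rangle>)\<close> exhibits the Gaussian kernel as a series of squares.\<close>

lemma gauss_energy_ge_tensor_norm:
  assumes "s \<ge> 0"
  shows "(2 * s) ^ k / fact k * tensor_norm k (\<lambda>x. exp (- s * (norm x)\<^sup>2)) \<le> gauss_energy s"
proof -
  define g :: "real^3 \<Rightarrow> real" where "g x = exp (- s * (norm x)\<^sup>2)" for x
  have g: "continuous_on UNIV g" unfolding g_def by (intro continuous_intros)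
  have g1: "0 \<le> g x" "g x \<le> 1" for x using assms by (auto simp: g_def)
  define P where "P n x y = (\<Sum>k<n. (2 * s) ^ k / fact k * (g x * g y * (x \<bullet> y) ^ k))" for n :: nat and x y
  \<comment> \<open>Bounds the exponent \<open>2 * s * (x \<bullet> y)\<close> in absolute value on
    the ball, so the Taylor remainder is uniform there.\<close>
  define R where "R = 2 * s * B\<^sup>2"
  have gk: "continuous_on UNIV (\<lambda>p::(real^3)\<times>(real^3). g (fst p))" "continuous_on UNIV (\<lambda>p::(real^3)\<times>(real^3). g (snd p))"
    by (auto intro!: continuous_on_compose2[OF g] continuous_intros)
  have LLP: "LL (P n) = (\<Sum>k<n. (2 * s) ^ k / fact k * tensor_norm k g)" for n
    unfolding P_def
    by (subst LL_sum, simp, intro bounded_borel2_continuous continuous_intros gk)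
       (simp only: L_mult LL_power[OF g])
  have "\<bar>gauss_energy s - LL (P n)\<bar> \<le> C\<^sup>2 * (exp R - (\<Sum>k<n. R ^ k / fact k))" for n
    unfolding gauss_energy_def
  proof (rule LL_diff_bound[OF bounded_borel2_gauss])
    show "bounded_borel2 (P n)" unfolding P_def
      by (intro bounded_borel2_continuous continuous_intros gk)
    fix x y :: "real^3" assume xy: "norm x \<le> B" "norm y \<le> B"
    have "\<bar>x \<bullet> y\<bar> \<le> B * B"
      using Cauchy_Schwarz_ineq2[of x y] xy mult_mono[OF xy] by (meson dual_order.trans norm_ge_zero order_trans)
    then have z: "\<bar>2 * s * (x \<bullet> y)\<bar> \<le> R"
      using assms by (simp add: R_def abs_mult power2_eq_square mult_left_mono)
    have "exp (- s * (norm (x - y))\<^sup>2) = g x * g y * exp (2 * s * (x \<bullet> y))"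
      unfolding g_def exp_add[symmetric]
      by (simp add: power2_norm_eq_inner inner_diff_left inner_diff_right inner_commute algebra_simps)
    moreover have "P n x y = g x * g y * (\<Sum>k<n. (2 * s * (x \<bullet> y)) ^ k / fact k)"
      unfolding P_def sum_distrib_left by (intro sum.cong) (auto simp: power_mult_distrib)
    ultimately have "\<bar>exp (- s * (norm (x - y))\<^sup>2) - P n x y\<bar>
        = g x * g y * \<bar>exp (2 * s * (x \<bullet> y)) - (\<Sum>k<n. (2 * s * (x \<bullet> y)) ^ k / fact k)\<bar>"
      using g1[of x] g1[of y] by (simp add: abs_mult flip: right_diff_distrib)
    also have "\<dots> \<le> 1 * 1 * \<bar>exp (2 * s * (x \<bullet> y)) - (\<Sum>k<n. (2 * s * (x \<bullet> y)) ^ k / fact k)\<bar>"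
      using g1[of x] g1[of y] by (intro mult_right_mono mult_mono) auto
    also have "\<dots> \<le> exp R - (\<Sum>k<n. R ^ k / fact k)"
      using exp_partial_sum_bound[OF z, of n] by simp
    finally show "\<bar>exp (- s * (norm (x - y))\<^sup>2) - P n x y\<bar> \<le> exp R - (\<Sum>k<n. R ^ k / fact k)" .
  qed
  moreover have "(\<lambda>n. C\<^sup>2 * (exp R - (\<Sum>k<n. R ^ k / fact k))) \<longlonglongrightarrow> C\<^sup>2 * (exp R - exp R)"
    using exp_converges[of R] by (intro tendsto_intros) (simp add: sums_def divide_inverse mult.commute)
  ultimately have "(\<lambda>n. gauss_energy s - LL (P n)) \<longlonglongrightarrow> 0"
    by (intro Lim_null_comparison[of "\<lambda>n. gauss_energy s - LL (P n)"]) auto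
  then have "(\<lambda>n. LL (P n)) \<longlonglongrightarrow> gauss_energy s"
    by (simp add: LIM_zero_iff tendsto_iff dist_real_def abs_minus_commute)
  \<comment> \<open>All terms of the expansion are nonnegative, so a single one is below every later
    partial sum.\<close>
  moreover have "(2 * s) ^ k / fact k * tensor_norm k g \<le> LL (P n)" if "n \<ge> Suc k" for n
    unfolding LLP using that assms by (intro member_le_sum) (auto intro!: tensor_norm_nonneg mult_nonneg_nonneg divide_nonneg_nonneg)
  ultimately show ?thesis
    unfolding g_def[symmetric] by (intro LIMSEQ_le_const[of _ "gauss_energy s"]) auto
qed

lemma gauss_energy_nonneg: "s \<ge> 0 \<Longrightarrow> gauss_energy s \<ge> 0"
  using gauss_energy_ge_tensor_norm[of s 0] by simp (meson order_trans zero_le_power2)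

text \<open>On the nonnegative reals exp (-a) has Lipschitz constant 1, and squared distances in the
  ball are at most 4 B^2. The constant does not depend on the family.\<close>

lemma gauss_energy_Lipschitz:
  assumes "s \<ge> 0" "s' \<ge> 0"
  shows "\<bar>gauss_energy s - gauss_energy s'\<bar> \<le> C\<^sup>2 * (4 * B\<^sup>2 * \<bar>s - s'\<bar>)"
  unfolding gauss_energy_def
proof (rule LL_diff_bound[OF bounded_borel2_gauss bounded_borel2_gauss])
  fix x y :: "real^3" assume xy: "norm x \<le> B" "norm y \<le> B"
  have lip: "\<bar>exp (- a) - exp (- b)\<bar> \<le> \<bar>a - b\<bar>" if "0 \<le> a" "0 \<le> b" for a b :: real
  proof -
    have *: "exp (- a) - exp (- b) \<le> b - a" if "0 \<le> a" "a \<le> b" for a b :: real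
    proof -
      have e: "1 - exp (- (b - a)) \<le> b - a" using exp_ge_add_one_self[of "- (b - a)"] by linarith
      have "exp (- a) - exp (- b) = exp (- a) * (1 - exp (- (b - a)))"
        by (simp add: right_diff_distrib exp_add[symmetric])
      also have "\<dots> \<le> 1 * (b - a)"
        using that by (intro mult_mono e) auto
      finally show ?thesis by simp
    qed
    show ?thesis
      using *[of a b] *[of b a] that by (cases "a \<le> b") auto
  qed
  have "norm (x - y) \<le> 2 * B" using xy norm_triangle_ineq4[of x y] by linarith
  then have "(norm (x - y))\<^sup>2 \<le> (2 * B)\<^sup>2" by (intro power_mono) auto
  then have u: "(norm (x - y))\<^sup>2 \<le> 4 * B\<^sup>2" by (simp add: power_mult_distrib)
  have "\<bar>exp (- s * (norm (x - y))\<^sup>2) - exp (- s' * (norm (x - y))\<^sup>2)\<bar> \<le> \<bar>s * (norm (x - y))\<^sup>2 - s' * (norm (x - y))\<^sup>2\<bar>"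
    using lip[of "s * (norm (x - y))\<^sup>2" "s' * (norm (x - y))\<^sup>2"] assms by simp
  also have "\<dots> = \<bar>s - s'\<bar> * (norm (x - y))\<^sup>2"
    by (simp add: abs_mult flip: left_diff_distrib)
  also have "\<dots> \<le> 4 * B\<^sup>2 * \<bar>s - s'\<bar>"
    using mult_left_mono[OF u, of "\<bar>s - s'\<bar>"] by (simp add: mult_ac)
  finally show "\<bar>exp (- s * (norm (x - y))\<^sup>2) - exp (- s' * (norm (x - y))\<^sup>2)\<bar> \<le> 4 * B\<^sup>2 * \<bar>s - s'\<bar>" .
qed

text \<open>Fubini for each member of the family; the majorant \<open>b\<close> does not involve
  \<open>x\<close>, so it stays integrable after multiplying with a probability measure.\<close>

lemma L_lborel_integral:
  fixes f :: "real \<Rightarrow> real^3 \<Rightarrow> real"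
  assumes f: "case_prod f \<in> borel_measurable (lborel \<Otimes>\<^sub>M borel)"
    and bound: "\<And>t x. \<bar>f t x\<bar> \<le> b t" and b: "integrable lborel b"
  shows "L (\<lambda>x. \<integral>t. f t x \<partial>lborel) = (\<integral>t. L (f t) \<partial>lborel)"
    and "integrable lborel (\<lambda>t. L (f t))"
proof -
  have *: "(\<integral>x. (\<integral>t. f t x \<partial>lborel) \<partial>m j) = (\<integral>t. (\<integral>x. f t x \<partial>m j) \<partial>lborel) \<and> integrable lborel (\<lambda>t. \<integral>x. f t x \<partial>m j)"
    if j: "j \<in> J" for j
  proof -
    interpret prob_space "m j" using prob j by auto
    interpret pair_sigma_finite lborel "m j" ..
    have S: "sets (lborel \<Otimes>\<^sub>M m j) = sets (lborel \<Otimes>\<^sub>M borel)"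
      by (rule sets_pair_measure_cong) (auto simp: sets_m j)
    then have fm[measurable]: "case_prod f \<in> borel_measurable (lborel \<Otimes>\<^sub>M m j)"
      using f by (subst measurable_cong_sets[OF S refl])
    have ft: "integrable (m j) (f t)" for t
    proof (rule integrable_const_bound[where B="b t"])
      show "f t \<in> borel_measurable (m j)"
        using measurable_Pair2[OF fm, of t] by simp
    qed (simp add: bound)
    have int: "integrable (lborel \<Otimes>\<^sub>M m j) (case_prod f)"
    proof (rule Fubini_integrable[OF fm])
      show "integrable lborel (\<lambda>t. \<integral>x. norm (case_prod f (t, x)) \<partial>m j)"
      proof (rule Bochner_Integration.integrable_bound[OF b])
        show "(\<lambda>t. \<integral>x. norm (case_prod f (t, x)) \<partial>m j) \<in> borel_measurable lborel"
          using fm by measurable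
        show "AE t in lborel. norm (\<integral>x. norm (case_prod f (t, x)) \<partial>m j) \<le> norm (b t)"
        proof (intro AE_I2)
          fix t
          have "0 \<le> b t" using bound[of t 0] by linarith
          have "(\<integral>x. \<bar>f t x\<bar> \<partial>m j) \<le> (\<integral>x. b t \<partial>m j)"
            by (intro integral_mono integrable_abs ft) (auto simp: bound)
          then show "norm (\<integral>x. norm (case_prod f (t, x)) \<partial>m j) \<le> norm (b t)"
            using \<open>0 \<le> b t\<close> by (simp add: prob_space)
        qed
      qed
    qed (simp add: ft)
    show ?thesis
      using Fubini_integral[OF int] integrable_fst[OF int] by simp
  qed
  show "integrable lborel (\<lambda>t. L (f t))"
    unfolding lincomb_integral_def by (intro Bochner_Integration.integrable_sum integrable_mult_right) (use * in auto)
  show "L (\<lambda>x. \<integral>t. f t x \<partial>lborel) = (\<integral>t. L (f t) \<partial>lborel)"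
    unfolding lincomb_integral_def
    by (subst Bochner_Integration.integral_sum) (use * in auto)
qed

section \<open>The softened Coulomb energy as a mixture of Gaussian energies\<close>

definition energy :: "real \<Rightarrow> real" where
  "energy \<epsilon> = LL (soft_coulomb \<epsilon>)"

text \<open>The integral of exp (- u t^2) over the line is sqrt pi / sqrt u; take u to be the
  squared distance plus \<epsilon>^2. The factor exp (- \<epsilon>^2 t^2) is then the integrable
  majorant for exchanging both functionals with the integral.\<close>

lemma energy_gauss:
  assumes \<epsilon>: "\<epsilon> > 0"
  shows "energy \<epsilon> = (\<integral>t. exp (- \<epsilon>\<^sup>2 * t\<^sup>2) * gauss_energy (t\<^sup>2) \<partial>lborel) / sqrt pi"
    and "integrable lborel (\<lambda>t. exp (- \<epsilon>\<^sup>2 * t\<^sup>2) * gauss_energy (t\<^sup>2))"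
proof -
  let ?G = "\<lambda>t x y::real^3. exp (- (t\<^sup>2) * (norm (x - y))\<^sup>2)"
  let ?e = "\<lambda>t. exp (- \<epsilon>\<^sup>2 * t\<^sup>2)"
  have e: "integrable lborel ?e"
    using has_bochner_integral_gaussian[of "\<epsilon>\<^sup>2"] \<epsilon> by (auto simp: has_bochner_integral_iff)
  have k: "soft_coulomb \<epsilon> x y = (\<integral>t. ?e t * ?G t x y \<partial>lborel) * (1 / sqrt pi)" for x y
  proof -
    define u where "u = (norm (x - y))\<^sup>2 + \<epsilon>\<^sup>2"
    have "u > 0" using \<epsilon> by (simp add: u_def add_nonneg_pos)
    then have "(\<integral>t. exp (- u * t\<^sup>2) \<partial>lborel) = sqrt pi / sqrt u"
      using has_bochner_integral_gaussian by (auto simp: has_bochner_integral_iff)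
    moreover have "exp (- u * t\<^sup>2) = ?e t * ?G t x y" for t
      unfolding exp_add[symmetric] by (simp add: u_def algebra_simps)
    ultimately show ?thesis by (simp add: soft_coulomb_def u_def[symmetric])
  qed
  have G1: "0 < ?G t x y" "?G t x y \<le> 1" for t x y by auto
  have bd: "\<bar>?e t * ?G t x y\<bar> \<le> ?e t" for t x y
    using G1[of t x y] by (simp add: abs_mult mult_left_le)
  have cont: "continuous_on UNIV (\<lambda>q. ?e (fst q) * ?G (fst q) x (snd q))" for x
    by (intro continuous_intros)
  have m1: "case_prod (\<lambda>t y. ?e t * ?G t x y) \<in> borel_measurable (lborel \<Otimes>\<^sub>M borel)" for x
    using borel_measurable_continuous_onI[OF cont[of x]]
    by (simp add: borel_prod[symmetric] case_prod_beta' cong: measurable_cong_sets sets_pair_measure_cong)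
  have inner: "L (soft_coulomb \<epsilon> x) = (\<integral>t. ?e t * L (?G t x) \<partial>lborel) * (1 / sqrt pi)" for x
    unfolding k L_mult_right using L_lborel_integral(1)[OF m1 bd e] by (simp add: L_mult)
  have m2: "(\<lambda>(t, x). ?e t * L (?G t x)) \<in> borel_measurable (lborel \<Otimes>\<^sub>M borel)"
  proof -
    have "continuous_on UNIV (\<lambda>q::(real \<times> (real^3)) \<times> (real^3). ?G (fst (fst q)) (snd (fst q)) (snd q))"
      by (intro continuous_intros)
    then have "(\<lambda>(p, y). ?G (fst p) (snd p) y) \<in> borel_measurable (borel \<Otimes>\<^sub>M (borel :: (real^3) measure))"
      using borel_measurable_continuous_onI by (fastforce simp: borel_prod case_prod_beta')
    then have "(\<lambda>p. L (?G (fst p) (snd p))) \<in> borel_measurable (borel :: (real \<times> (real^3)) measure)"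
      by (rule L_measurable)
    moreover have "(\<lambda>p. ?e (fst p)) \<in> borel_measurable (borel :: (real \<times> (real^3)) measure)"
      by (intro borel_measurable_continuous_onI continuous_intros)
    ultimately have "(\<lambda>p. ?e (fst p) * L (?G (fst p) (snd p))) \<in> borel_measurable (borel :: (real \<times> (real^3)) measure)"
      by (rule borel_measurable_times[rotated])
    then show ?thesis
      by (simp add: borel_prod[symmetric] case_prod_beta' cong: measurable_cong_sets sets_pair_measure_cong)
  qed
  have bd2: "\<bar>?e t * L (?G t x)\<bar> \<le> C * ?e t" for t x
  proof -
    have "\<bar>L (?G t x)\<bar> \<le> C * 1"
      by (rule L_bound) (auto intro!: borel_measurable_continuous_onI continuous_intros)
    then show ?thesis by (simp add: abs_mult mult.commute mult_left_mono)
  qed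
  have "energy \<epsilon> = L (\<lambda>x. \<integral>t. ?e t * L (?G t x) \<partial>lborel) * (1 / sqrt pi)"
    unfolding energy_def inner L_mult_right ..
  also have "L (\<lambda>x. \<integral>t. ?e t * L (?G t x) \<partial>lborel) = (\<integral>t. ?e t * gauss_energy (t\<^sup>2) \<partial>lborel)"
    using L_lborel_integral(1)[OF m2 bd2] e by (simp add: L_mult gauss_energy_def)
  finally show "energy \<epsilon> = (\<integral>t. ?e t * gauss_energy (t\<^sup>2) \<partial>lborel) / sqrt pi" by simp
  show "integrable lborel (\<lambda>t. ?e t * gauss_energy (t\<^sup>2))"
    using L_lborel_integral(2)[OF m2 bd2] e by (simp add: L_mult gauss_energy_def)
qed

lemma energy_nonneg:
  assumes "\<epsilon> > 0"
  shows "energy \<epsilon> \<ge> 0"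
  unfolding energy_gauss(1)[OF assms]
  by (intro divide_nonneg_nonneg Bochner_Integration.integral_nonneg mult_nonneg_nonneg gauss_energy_nonneg) auto

text \<open>Monotonicity of the kernel is useless for signed charges. In the mixture, however, the
  Gaussian energies are nonnegative and their weights decrease in \<open>\<epsilon>\<close>.\<close>

lemma energy_antimono:
  assumes "0 < \<epsilon>" "\<epsilon> \<le> \<epsilon>'"
  shows "energy \<epsilon>' \<le> energy \<epsilon>"
proof -
  have \<epsilon>': "\<epsilon>' > 0" using assms by simp
  have "\<epsilon>\<^sup>2 \<le> \<epsilon>'\<^sup>2" using assms by (intro power_mono) auto
  then show ?thesis
    unfolding energy_gauss(1)[OF assms(1)] energy_gauss(1)[OF \<epsilon>']
    by (intro divide_right_mono integral_mono energy_gauss(2) assms \<epsilon>' mult_right_mono gauss_energy_nonneg)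
       (auto intro: mult_right_mono)
qed

text \<open>A large value of the nonnegative Lipschitz function \<open>gauss_energy\<close> at \<open>1\<close> forces a large integral.\<close>

lemma energy_ge_gauss_energy:
  assumes \<delta>: "\<delta> > 0" "gauss_energy 1 \<ge> \<delta>"
  defines "K \<equiv> 12 * B\<^sup>2 * C\<^sup>2 + 1"
  defines "\<eta> \<equiv> min 1 (\<delta> / (2 * K))"
  shows "energy 1 \<ge> exp (- 4) * (\<delta> / 2) * \<eta> / sqrt pi"
proof -
  have K: "K > 0" unfolding K_def by (intro add_nonneg_pos) auto
  have \<eta>: "\<eta> > 0" "\<eta> \<le> 1" "K * \<eta> \<le> \<delta> / 2"
    using K \<delta> by (auto simp: \<eta>_def min_def field_simps)
  \<comment> \<open>On this interval |1 - t^2| is at most 3 \<eta>, so the Lipschitz bound loses at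
    most 12 B^2 C^2 \<eta>, no more than \<delta> / 2; the summand 1 in \<open>K\<close> keeps it
    positive. As t is at most 2, the weight is at least exp (-4).\<close>
  have low: "exp (- 4) * (\<delta> / 2) \<le> exp (- 1\<^sup>2 * t\<^sup>2) * gauss_energy (t\<^sup>2)" if t: "t \<in> {1..1 + \<eta>}" for t
  proof -
    have "t\<^sup>2 \<le> 2\<^sup>2" using t \<eta> by (intro power_mono) auto
    have "\<bar>1 - t\<^sup>2\<bar> = (t - 1) * (t + 1)"
      using one_le_power[of t 2] t by (simp add: power2_eq_square algebra_simps)
    also have "\<dots> \<le> \<eta> * 3" using t \<eta> by (intro mult_mono) auto
    finally have "C\<^sup>2 * (4 * B\<^sup>2 * \<bar>1 - t\<^sup>2\<bar>) \<le> C\<^sup>2 * (4 * B\<^sup>2 * (\<eta> * 3))"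
      by (intro mult_left_mono) auto
    also have "\<dots> \<le> K * \<eta>" using \<eta> by (simp add: K_def algebra_simps)
    also have "\<dots> \<le> \<delta> / 2" by fact
    finally have "gauss_energy (t\<^sup>2) \<ge> \<delta> / 2"
      using gauss_energy_Lipschitz[of 1 "t\<^sup>2"] \<delta> by auto
    then show ?thesis using \<open>t\<^sup>2 \<le> 2\<^sup>2\<close> \<delta> by (intro mult_mono) auto
  qed
  have "(\<integral>t. exp (- 4) * (\<delta> / 2) * indicator {1..1 + \<eta>} t \<partial>lborel) \<le> (\<integral>t. exp (- 1\<^sup>2 * t\<^sup>2) * gauss_energy (t\<^sup>2) \<partial>lborel)"
  proof (intro integral_mono energy_gauss(2) zero_less_one)
    show "integrable lborel (\<lambda>t. exp (- 4) * (\<delta> / 2) * indicator {1..1 + \<eta>} t)"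
      by (intro integrable_mult_right integrable_real_indicator) (auto simp: emeasure_lborel_Icc_eq)
    show "exp (- 4) * (\<delta> / 2) * indicator {1..1 + \<eta>} t \<le> exp (- 1\<^sup>2 * t\<^sup>2) * gauss_energy (t\<^sup>2)" for t
    proof (cases "t \<in> {1..1 + \<eta>}")
      case True
      then show ?thesis using low[OF True] by simp
    next
      case False
      then show ?thesis by (simp add: gauss_energy_nonneg)
    qed
  qed
  moreover have "(\<integral>t. exp (- 4) * (\<delta> / 2) * indicator {1..1 + \<eta>} t \<partial>lborel) = exp (- 4) * (\<delta> / 2) * \<eta>"
    using \<eta> by simp
  ultimately show ?thesis
    unfolding energy_gauss(1)[OF zero_less_one] by (intro divide_right_mono) auto
qed

section \<open>From vanishing energy to weak convergence\<close>

lemma tensor_norm_add: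
  assumes "bounded_borel_on_ball B h" "bounded_borel_on_ball B h'"
  shows "tensor_norm k (\<lambda>x. h x + h' x) \<le> 2 * tensor_norm k h + 2 * tensor_norm k h'"
  using assms
proof (induction k arbitrary: h h')
  case 0
  have "(L h + L h')\<^sup>2 \<le> 2 * (L h)\<^sup>2 + 2 * (L h')\<^sup>2"
    using zero_le_power2[of "L h - L h'"] by (simp add: power2_eq_square algebra_simps)
  then show ?case using 0 by (simp add: L_add)
next
  case (Suc k)
  have "tensor_norm (Suc k) (\<lambda>x. h x + h' x) = (\<Sum>i\<in>UNIV. tensor_norm k (\<lambda>x. x $ i * h x + x $ i * h' x))"
    by (simp add: distrib_left)
  also have "\<dots> \<le> (\<Sum>i\<in>UNIV. 2 * tensor_norm k (\<lambda>x. x $ i * h x) + 2 * tensor_norm k (\<lambda>x. x $ i * h' x))"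
    by (intro sum_mono Suc.IH bounded_borel_on_ball_intros Suc.prems)
  finally show ?case by (simp add: sum.distrib sum_distrib_left)
qed

lemma tensor_norm_nth: "tensor_norm k (\<lambda>x. x $ i * h x) \<le> tensor_norm (Suc k) h"
  by simp (intro member_le_sum tensor_norm_nonneg; simp)

lemma tensor_norm_mult: "tensor_norm k (\<lambda>x. c * h x) = c\<^sup>2 * tensor_norm k h"
proof (induction k arbitrary: h)
  case 0
  then show ?case by (simp add: L_mult power_mult_distrib)
next
  case (Suc k)
  have "tensor_norm (Suc k) (\<lambda>x. c * h x) = (\<Sum>i\<in>UNIV. tensor_norm k (\<lambda>x. c * (x $ i * h x)))"
    by (simp add: mult.left_commute)
  then show ?case by (simp add: Suc.IH sum_distrib_left)
qed

end

text \<open>Functions whose tensor norms of every order vanish in the limit are closed under sums,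
  scalar multiples and multiplication by coordinates. All orders are needed at once, since a
  coordinate factor raises the order by one.\<close>

lemma tensor_norm_polynomial_tendsto_0:
  assumes fam: "\<And>n. signed_family (J n) (w n) (m n) B C"
    and p: "real_polynomial_function p"
    and h: "bounded_borel_on_ball B h" "\<And>k. (\<lambda>n. signed_family.tensor_norm (J n) (w n) (m n) k h) \<longlonglongrightarrow> 0"
  shows "(\<lambda>n. signed_family.tensor_norm (J n) (w n) (m n) k (\<lambda>x. p x * h x)) \<longlonglongrightarrow> 0"
proof -
  let ?T = "\<lambda>n. signed_family.tensor_norm (J n) (w n) (m n)"
  define H where "H h \<longleftrightarrow> bounded_borel_on_ball B h \<and> (\<forall>k. (\<lambda>n. ?T n k h) \<longlonglongrightarrow> 0)" for h
  note nonneg = signed_family.tensor_norm_nonneg[OF fam]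
  have add: "H (\<lambda>x. f x + g x)" if "H f" "H g" for f g
    unfolding H_def
  proof (intro conjI allI)
    show "bounded_borel_on_ball B (\<lambda>x. f x + g x)" using that by (auto simp: H_def intro: bounded_borel_on_ball_add)
    fix k
    have lim: "(\<lambda>n. 2 * ?T n k f + 2 * ?T n k g) \<longlonglongrightarrow> 0"
      using that by (auto simp: H_def intro!: tendsto_eq_intros)
    have le: "?T n k (\<lambda>x. f x + g x) \<le> 2 * ?T n k f + 2 * ?T n k g" for n
      using that by (intro signed_family.tensor_norm_add[OF fam]) (simp_all add: H_def)
    show "(\<lambda>n. ?T n k (\<lambda>x. f x + g x)) \<longlonglongrightarrow> 0"
      by (rule tendsto_sandwich[OF _ _ tendsto_const lim]) (simp_all only: nonneg le eventually_True)
  qed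
  have scale: "H (\<lambda>x. c * f x)" if "H f" for c f
    unfolding H_def
  proof (intro conjI allI)
    show "bounded_borel_on_ball B (\<lambda>x. c * f x)" using that by (auto simp: H_def intro: bounded_borel_on_ball_intros)
    show "(\<lambda>n. ?T n k (\<lambda>x. c * f x)) \<longlonglongrightarrow> 0" for k
      using that by (simp add: signed_family.tensor_norm_mult[OF fam] H_def tendsto_mult_right_zero)
  qed
  have nth: "H (\<lambda>x. x $ i * f x)" if "H f" for i f
    unfolding H_def
  proof (intro conjI allI)
    show "bounded_borel_on_ball B (\<lambda>x. x $ i * f x)" using that by (auto simp: H_def intro: bounded_borel_on_ball_intros)
    fix k
    have lim: "(\<lambda>n. ?T n (Suc k) f) \<longlonglongrightarrow> 0"
      using that unfolding H_def by blast
    show "(\<lambda>n. ?T n k (\<lambda>x. x $ i * f x)) \<longlonglongrightarrow> 0"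
      by (rule tendsto_sandwich[OF _ _ tendsto_const lim]) (simp_all only: nonneg signed_family.tensor_norm_nth[OF fam] eventually_True)
  qed
  have "H f \<Longrightarrow> H (\<lambda>x. p x * f x)" for f
    using p
  proof (induction arbitrary: f rule: real_polynomial_function.induct)
    case (linear q)
    have "q x * f x = q (axis 1 1) * (x $ 1 * f x) + (q (axis 2 1) * (x $ 2 * f x) + q (axis 3 1) * (x $ 3 * f x))" for x
    proof -
      have "x = x $ 1 *\<^sub>R axis 1 1 + x $ 2 *\<^sub>R axis 2 1 + x $ 3 *\<^sub>R axis 3 1"
        by (auto simp: vec_eq_iff forall_3 axis_def)
      then have "q x = q (x $ 1 *\<^sub>R axis 1 1 + x $ 2 *\<^sub>R axis 2 1 + x $ 3 *\<^sub>R axis 3 1)" by simp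
      also have "\<dots> = x $ 1 * q (axis 1 1) + x $ 2 * q (axis 2 1) + x $ 3 * q (axis 3 1)"
        using linear(1) by (simp add: linear_simps)
      finally show ?thesis by (simp add: algebra_simps)
    qed
    then show ?case using linear by (auto intro!: add scale nth)
  next
    case (const c)
    then show ?case by (rule scale)
  next
    case (add f1 f2)
    then show ?case by (simp add: distrib_right \<open>\<And>g f. H f \<Longrightarrow> H g \<Longrightarrow> H (\<lambda>x. f x + g x)\<close>)
  next
    case (mult f1 f2)
    then show ?case by (simp add: mult.assoc)
  qed
  then show ?thesis using h by (auto simp: H_def)
qed

theorem lincomb_integral_tendsto_0:
  assumes fam: "\<And>n. signed_family (J n) (w n) (m n) B C"
    and E: "(\<lambda>n. signed_family.energy (J n) (w n) (m n) 1) \<longlonglongrightarrow> 0"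
    and f: "continuous_on UNIV f"
  shows "(\<lambda>n. lincomb_integral (J n) (w n) (m n) f) \<longlonglongrightarrow> 0"
proof -
  let ?T = "\<lambda>n. signed_family.tensor_norm (J n) (w n) (m n)"
  let ?L = "\<lambda>n. lincomb_integral (J n) (w n) (m n)"
  let ?G = "\<lambda>n. signed_family.gauss_energy (J n) (w n) (m n) 1"
  note nonneg = signed_family.tensor_norm_nonneg[OF fam]
  have B: "B > 0" using signed_family.B_pos[OF fam] .
  have C: "C \<ge> 0" using signed_family.C_nonneg[OF fam] .
  define K where "K = 12 * B\<^sup>2 * C\<^sup>2 + 1"
  have K: "K > 0" unfolding K_def by (intro add_nonneg_pos) auto
  \<comment> \<open>If the Gaussian energy were at least \<delta>, then \<open>energy\<close> at 1
    would exceed a positive number depending only on \<delta>, \<open>B\<close> and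
    \<open>C\<close>.\<close>
  have G0: "?G \<longlonglongrightarrow> 0"
  proof (rule LIMSEQ_I)
    fix \<delta> :: real assume \<delta>: "\<delta> > 0"
    have "exp (- 4) * (\<delta> / 2) * min 1 (\<delta> / (2 * K)) / sqrt pi > 0" using \<delta> K by simp
    with E have "\<forall>\<^sub>F n in sequentially. signed_family.energy (J n) (w n) (m n) 1 < exp (- 4) * (\<delta> / 2) * min 1 (\<delta> / (2 * K)) / sqrt pi"
      by (rule order_tendstoD)
    then have "\<forall>\<^sub>F n in sequentially. norm (?G n - 0) < \<delta>"
    proof eventually_elim
      case (elim n)
      then have "?G n < \<delta>"
        using signed_family.energy_ge_gauss_energy[OF fam \<delta>, of n] unfolding K_def by linarith
      with signed_family.gauss_energy_nonneg[OF fam, of 1 n] show ?case by simp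
    qed
    then show "\<exists>no. \<forall>n\<ge>no. norm (?G n - 0) < \<delta>" by (simp add: eventually_sequentially)
  qed
  define g :: "real^3 \<Rightarrow> real" where "g x = exp (- ((norm x)\<^sup>2))" for x
  have g: "continuous_on UNIV g" unfolding g_def by (intro continuous_intros)
  have g1: "0 < g x" "g x \<le> 1" for x by (auto simp: g_def)
  have T0: "(\<lambda>n. ?T n k g) \<longlonglongrightarrow> 0" for k
  proof -
    have lim: "(\<lambda>n. fact k / 2 ^ k * ?G n) \<longlonglongrightarrow> 0"
      by (rule tendsto_mult_right_zero[OF G0])
    have le: "?T n k g \<le> fact k / 2 ^ k * ?G n" for n
      using signed_family.gauss_energy_ge_tensor_norm[OF fam, of 1 k n]
      by (simp add: g_def[symmetric] field_simps)
    show ?thesis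
      by (rule tendsto_sandwich[OF _ _ tendsto_const lim]) (simp_all only: nonneg le eventually_True)
  qed
  have poly: "(\<lambda>n. ?L n (\<lambda>x. p x * g x)) \<longlonglongrightarrow> 0" if p: "real_polynomial_function p" for p
  proof -
    have "(\<lambda>n. ?T n 0 (\<lambda>x. p x * g x)) \<longlonglongrightarrow> 0"
      by (rule tensor_norm_polynomial_tendsto_0[OF fam p bounded_borel_on_ball_continuous[OF g] T0])
    then have "(\<lambda>n. (?L n (\<lambda>x. p x * g x))\<^sup>2) \<longlonglongrightarrow> 0"
      by (simp add: signed_family.tensor_norm.simps[OF fam])
    then have "(\<lambda>n. sqrt ((?L n (\<lambda>x. p x * g x))\<^sup>2)) \<longlonglongrightarrow> sqrt 0"
      by (rule tendsto_real_sqrt)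
    then show ?thesis by (simp add: tendsto_rabs_zero_iff)
  qed
  show ?thesis
  proof (rule LIMSEQ_I)
    fix \<delta> :: real assume \<delta>: "\<delta> > 0"
    define e where "e = \<delta> / (2 * (C + 1))"
    have e: "e > 0" "C * e \<le> \<delta> / 2" using \<delta> C by (auto simp: e_def field_simps)
    \<comment> \<open>Only moments weighted by \<open>g\<close> are under control, so f / g is
      approximated instead of f; multiplying back by \<open>g\<close>, which is at most 1, does not
      enlarge the error.\<close>
    have fg: "continuous_on (cball 0 B) (\<lambda>x. f x / g x)"
      using g1(1) by (intro continuous_intros continuous_on_subset[OF f] continuous_on_subset[OF g]) (auto simp: less_imp_neq[symmetric])
    obtain p where p: "real_polynomial_function p" "\<And>x. x \<in> cball 0 B \<Longrightarrow> \<bar>f x / g x - p x\<bar> < e"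
      using Stone_Weierstrass_real_polynomial_function[OF compact_cball fg e(1)] by metis
    have "\<forall>\<^sub>F n in sequentially. norm (?L n (\<lambda>x. p x * g x) - 0) < \<delta> / 2"
      using tendstoD[OF poly[OF p(1)], of "\<delta>/2"] \<delta> by (simp add: dist_norm)
    then have "\<forall>\<^sub>F n in sequentially. norm (?L n f - 0) < \<delta>"
    proof eventually_elim
      case (elim n)
      have "\<bar>?L n f - ?L n (\<lambda>x. p x * g x)\<bar> \<le> C * e"
      proof (rule signed_family.L_diff_bound[OF fam])
        show "bounded_borel_on_ball B f" by (rule bounded_borel_on_ball_continuous[OF f])
        show "bounded_borel_on_ball B (\<lambda>x. p x * g x)"
          using p(1) by (intro bounded_borel_on_ball_continuous continuous_intros g continuous_at_imp_continuous_on) (auto intro: continuous_real_polymonial_function)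
        fix x :: "real^3" assume x: "norm x \<le> B"
        have "\<bar>f x - p x * g x\<bar> = \<bar>f x / g x - p x\<bar> * g x"
        proof -
          have "f x - p x * g x = (f x / g x - p x) * g x" using g1[of x] by (simp add: left_diff_distrib)
          then show ?thesis using g1[of x] by (simp add: abs_mult)
        qed
        also have "\<dots> \<le> e * 1" using p(2)[of x] x g1[of x] by (intro mult_mono) auto
        finally show "\<bar>f x - p x * g x\<bar> \<le> e" by simp
      qed
      with elim e show ?case by auto
    qed
    then show "\<exists>no. \<forall>n\<ge>no. norm (?L n f - 0) < \<delta>" by (simp add: eventually_sequentially)
  qed
qed

section \<open>Energy of minimizers\<close>

text \<open>Turns sums over pairs into full double sums. In both applications the diagonal vanishes
  through the convention 1/0 = 0.\<close>

lemma sum_upper_triangle_symmetric: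
  fixes g :: "nat \<Rightarrow> nat \<Rightarrow> real"
  assumes sym: "\<And>i j. g i j = g j i" and diag: "\<And>i. g i i = 0"
  shows "2 * (\<Sum>i=1..N. \<Sum>j=i+1..N. g i j) = (\<Sum>i=1..N. \<Sum>j=1..N. g i j)"
proof -
  have "(\<Sum>j=1..N. g i j) = (\<Sum>j=1..N. if i < j then g i j else 0) + (\<Sum>j=1..N. if j < i then g i j else 0)" for i
    unfolding sum.distrib[symmetric] by (intro sum.cong) (auto simp: diag)
  then have "(\<Sum>i=1..N. \<Sum>j=1..N. g i j) = (\<Sum>i=1..N. \<Sum>j=1..N. if i < j then g i j else 0)
      + (\<Sum>i=1..N. \<Sum>j=1..N. if j < i then g i j else 0)"
    by (simp add: sum.distrib)
  also have "(\<Sum>i=1..N. \<Sum>j=1..N. if j < i then g i j else 0) = (\<Sum>i=1..N. \<Sum>j=1..N. if i < j then g i j else 0)"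
    by (subst sum.swap) (intro sum.cong refl, auto simp: sym)
  also have "(\<Sum>i=1..N. \<Sum>j=1..N. if i < j then g i j else 0) = (\<Sum>i=1..N. \<Sum>j=i+1..N. g i j)"
  proof (rule sum.cong[OF refl])
    fix i assume "i \<in> {1..N}"
    then show "(\<Sum>j=1..N. if i < j then g i j else 0) = (\<Sum>j=i+1..N. g i j)"
      by (subst sum.inter_filter[symmetric]) (auto intro!: sum.cong)
  qed
  finally show ?thesis by simp
qed

section \<open>Newton's theorem and its softened version\<close>

lemma sqrt_diff_le:
  fixes a b e :: real
  assumes "0 \<le> b" "b \<le> a"
  shows "sqrt (a\<^sup>2 + e\<^sup>2) - sqrt (b\<^sup>2 + e\<^sup>2) \<le> a - b"
proof -
  have "b * 1 \<le> sqrt (b\<^sup>2 + e\<^sup>2)" using assms real_sqrt_le_mono[of "b\<^sup>2" "b\<^sup>2 + e\<^sup>2"] by simp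
  then have "a\<^sup>2 + e\<^sup>2 \<le> (sqrt (b\<^sup>2 + e\<^sup>2) + (a - b))\<^sup>2"
    using assms mult_left_mono[of "b * 1" "sqrt (b\<^sup>2 + e\<^sup>2)" "2 * (a - b)"]
    by (simp add: power2_sum) (simp add: power2_eq_square algebra_simps)
  then have "sqrt (a\<^sup>2 + e\<^sup>2) \<le> sqrt (b\<^sup>2 + e\<^sup>2) + (a - b)"
    using assms by (intro real_le_lsqrt) auto
  then show ?thesis by simp
qed

lemma sphere_potential_le:
  assumes "0 < r" "r \<le> \<rho>"
  shows "sphere_potential \<epsilon> r \<rho> \<le> 1 / \<rho>"
proof -
  have "sqrt ((\<rho> + r)\<^sup>2 + \<epsilon>\<^sup>2) - sqrt ((\<rho> - r)\<^sup>2 + \<epsilon>\<^sup>2) \<le> 2 * r"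
    using sqrt_diff_le[of "\<rho> - r" "\<rho> + r" \<epsilon>] assms by simp
  then have "sphere_potential \<epsilon> r \<rho> \<le> 2 * r / (2 * \<rho> * r)"
    unfolding sphere_potential_def using assms by (intro divide_right_mono) auto
  then show ?thesis using assms by simp
qed

text \<open>The first root is at least \<rho> + r, the second at most \<rho> - r + \<epsilon>. The
  resulting loss, uniform outside the sphere, is the source of the N^2 \<epsilon> error in the lower
  energy bound.\<close>

lemma sphere_potential_ge:
  assumes "0 < r" "r \<le> \<rho>" "0 \<le> \<epsilon>"
  shows "1 / \<rho> - \<epsilon> / (2 * r\<^sup>2) \<le> sphere_potential \<epsilon> r \<rho>"
proof -
  have "\<rho> + r \<le> sqrt ((\<rho> + r)\<^sup>2 + \<epsilon>\<^sup>2)"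
    using assms by (intro real_le_rsqrt) auto
  moreover have "sqrt ((\<rho> - r)\<^sup>2 + \<epsilon>\<^sup>2) \<le> (\<rho> - r) + \<epsilon>"
    using sqrt_sum_squares_le_sum[of "\<rho> - r" \<epsilon>] assms by simp
  ultimately have "2 * r - \<epsilon> \<le> sqrt ((\<rho> + r)\<^sup>2 + \<epsilon>\<^sup>2) - sqrt ((\<rho> - r)\<^sup>2 + \<epsilon>\<^sup>2)"
    by linarith
  then have "(2 * r - \<epsilon>) / (2 * \<rho> * r) \<le> sphere_potential \<epsilon> r \<rho>"
    unfolding sphere_potential_def using assms by (intro divide_right_mono) auto
  moreover have "(2 * r - \<epsilon>) / (2 * \<rho> * r) = 1 / \<rho> - \<epsilon> / (2 * \<rho> * r)"
    using assms by (simp add: diff_divide_distrib)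
  moreover have "\<epsilon> / (2 * \<rho> * r) \<le> \<epsilon> / (2 * r\<^sup>2)"
    using assms by (intro divide_left_mono) (auto simp: power2_eq_square intro: mult_right_mono)
  ultimately show ?thesis by linarith
qed

lemma sphere_potential_0:
  assumes "0 < r" "r \<le> \<rho>"
  shows "sphere_potential 0 r \<rho> = 1 / \<rho>"
  using sphere_potential_le[OF assms, of 0] sphere_potential_ge[OF assms, of 0] by simp

text \<open>Newton's theorem, covering also a point \<open>q\<close> on the sphere itself, where the
  kernel is singular but integrable; electrons do sit there.\<close>

lemma has_bochner_integral_coulomb_sphere:
  assumes "r > 0" "r \<le> norm (q - c)"
  shows "has_bochner_integral unit_sphere_measure (\<lambda>y. 1 / norm ((c + r *\<^sub>R y) - q)) (1 / norm (q - c))"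
proof -
  have "q \<noteq> c" using assms by auto
  then show ?thesis
    using has_bochner_integral_soft_coulomb_sphere[of r q c 0] assms
    by (simp add: soft_coulomb_def sphere_potential_0 norm_minus_commute)
qed

text \<open>Mutual Coulomb energy of unit charges spread uniformly over the spheres about
  \<open>R \<alpha>\<close> and \<open>R \<beta>\<close>, the diagonal being the interaction of a
  sphere with itself.\<close>

definition nuclear_interaction :: "(nat \<Rightarrow> real^3) \<Rightarrow> real \<Rightarrow> nat \<Rightarrow> nat \<Rightarrow> real" where
  "nuclear_interaction R d \<alpha> \<beta> = (if \<alpha> = \<beta> then 1 / d else 1 / norm (R \<alpha> - R \<beta>))"

definition sphere_self_energy :: "nat \<Rightarrow> (nat \<Rightarrow> real^3) \<Rightarrow> real \<Rightarrow> (nat \<Rightarrow> real) \<Rightarrow> real" where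
  "sphere_self_energy M R d Z = (\<Sum>\<alpha>=1..M. \<Sum>\<beta>=1..M. Z \<alpha> * Z \<beta> * nuclear_interaction R d \<alpha> \<beta>)"

locale nuclei =
  fixes M :: nat and R :: "nat \<Rightarrow> real^3" and d :: real
  assumes M: "M \<ge> 1" and d: "d > 0"
    and separated: "\<alpha> \<in> {1..M} \<Longrightarrow> \<beta> \<in> {1..M} \<Longrightarrow> \<alpha> \<noteq> \<beta> \<Longrightarrow> 2 * d < norm (R \<alpha> - R \<beta>)"
begin

text \<open>Makes every point of the spheres an admissible place for an electron.\<close>

lemma sphere_outside:
  assumes "\<alpha> \<in> {1..M}" "\<beta> \<in> {1..M}" "norm (p - R \<alpha>) = d"
  shows "norm (p - R \<beta>) \<ge> d"
proof (cases "\<alpha> = \<beta>")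
  case False
  have "norm (R \<alpha> - R \<beta>) \<le> norm (p - R \<alpha>) + norm (p - R \<beta>)"
    using norm_triangle_ineq4[of "p - R \<beta>" "p - R \<alpha>"] by (simp add: norm_minus_commute)
  then show ?thesis using separated[OF assms(1,2) False] assms(3) by linarith
qed (use assms in auto)

lemma has_bochner_integral_nuclear_interaction:
  assumes "\<alpha> \<in> {1..M}" "\<beta> \<in> {1..M}"
  shows "has_bochner_integral unit_sphere_measure (\<lambda>y. 1 / norm ((R \<alpha> + d *\<^sub>R y) - R \<beta>)) (nuclear_interaction R d \<alpha> \<beta>)"
proof (cases "\<alpha> = \<beta>")
  case True
  have "has_bochner_integral unit_sphere_measure (\<lambda>y. 1 / d) (1 / d)"
    using usm.prob_space by (simp add: has_bochner_integral_iff)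
  moreover have "AE y in unit_sphere_measure. 1 / d = 1 / norm ((R \<alpha> + d *\<^sub>R y) - R \<beta>)"
    using AE_unit_sphere_norm by eventually_elim (use d True in simp)
  ultimately show ?thesis
    by (subst has_bochner_integral_cong_AE[where g="\<lambda>y. 1 / d"])
       (auto simp: nuclear_interaction_def True elim: eventually_mono)
next
  case False
  then show ?thesis
    using has_bochner_integral_coulomb_sphere[of d "R \<beta>" "R \<alpha>"] separated[OF assms False] d
    by (simp add: nuclear_interaction_def norm_minus_commute)
qed

end

section \<open>Minimizers and the potential felt by one electron\<close>

locale ground_state = nuclei +
  fixes N :: nat and Z :: "nat \<Rightarrow> real" and x :: "nat \<Rightarrow> real^3"
  assumes Z_pos: "\<alpha> \<in> {1..M} \<Longrightarrow> Z \<alpha> > 0"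
    and neutral: "real N = (\<Sum>\<alpha>=1..M. Z \<alpha>)"
    and minimizer: "energy_minimizer M R d N Z x"
begin

lemma N_pos: "N > 0"
proof -
  have "real N > 0" unfolding neutral using M Z_pos by (intro sum_pos) auto
  then show ?thesis by simp
qed

lemma admissible: "i \<in> {1..N} \<Longrightarrow> \<alpha> \<in> {1..M} \<Longrightarrow> norm (x i - R \<alpha>) \<ge> d"
  using minimizer by (auto simp: energy_minimizer_def is_arg_min_def admissible_def)

lemma energy_le:
  assumes "\<And>i \<alpha>. i \<in> {1..N} \<Longrightarrow> \<alpha> \<in> {1..M} \<Longrightarrow> norm (y i - R \<alpha>) \<ge> d"
  shows "coulomb_energy M R N Z x \<le> coulomb_energy M R N Z y"
proof -
  have "y \<in> Defs.admissible M R d N" unfolding admissible_def using assms by blast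
  then show ?thesis
    using minimizer by (auto simp: energy_minimizer_def is_arg_min_def not_less)
qed

definition attraction :: "(nat \<Rightarrow> real^3) \<Rightarrow> real" where
  "attraction y = (\<Sum>i=1..N. nuclear_potential M R Z (y i))"

text \<open>Since \<open>1/0 = 0\<close>, the diagonal does not contribute.\<close>

definition repulsion :: "(nat \<Rightarrow> real^3) \<Rightarrow> real" where
  "repulsion y = (\<Sum>i=1..N. \<Sum>j=1..N. 1 / norm (y i - y j)) / 2"

lemma coulomb_energy_distinct:
  assumes "inj_on y {1..N}"
  shows "coulomb_energy M R N Z y = ereal (attraction y + repulsion y)"
proof -
  have "(\<Sum>i=1..N. \<Sum>j=i+1..N. 1 / ereal (norm (y i - y j))) = (\<Sum>i=1..N. \<Sum>j=i+1..N. ereal (1 / norm (y i - y j)))"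
  proof (intro sum.cong refl)
    fix i j assume "i \<in> {1..N}" "j \<in> {i+1..N}"
    then have "y i \<noteq> y j" using assms by (auto dest: inj_onD)
    then show "1 / ereal (norm (y i - y j)) = ereal (1 / norm (y i - y j))"
      by (simp add: one_ereal_def)
  qed
  also have "\<dots> = ereal (\<Sum>i=1..N. \<Sum>j=i+1..N. 1 / norm (y i - y j))"
    by simp
  also have "(\<Sum>i=1..N. \<Sum>j=i+1..N. 1 / norm (y i - y j)) = repulsion y"
    using sum_upper_triangle_symmetric[of "\<lambda>i j. 1 / norm (y i - y j)" N]
    by (simp add: repulsion_def norm_minus_commute)
  finally show ?thesis unfolding coulomb_energy_def attraction_def by simp
qed

lemma coulomb_energy_coincidence:
  assumes "\<not> inj_on y {1..N}"
  shows "coulomb_energy M R N Z y = \<infinity>"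
proof -
  from assms obtain i j where ij: "i \<in> {1..N}" "j \<in> {1..N}" "i \<noteq> j" "y i = y j"
    by (auto simp: inj_on_def)
  have "\<exists>i j. i \<in> {1..N} \<and> j \<in> {i+1..N} \<and> y i = y j"
  proof (cases "i < j")
    case True
    then show ?thesis using ij by (intro exI[of _ i] exI[of _ j]) auto
  next
    case False
    then show ?thesis using ij by (intro exI[of _ j] exI[of _ i]) auto
  qed
  then obtain i j where ij: "i \<in> {1..N}" "j \<in> {i+1..N}" "y i = y j" by blast
  then have "1 / ereal (norm (y i - y j)) = \<infinity>" by simp
  then have "(\<Sum>j=i+1..N. 1 / ereal (norm (y i - y j))) = \<infinity>"
    using ij by (subst sum_Pinfty) auto
  then have "\<exists>i\<in>{1..N}. (\<Sum>j=i+1..N. 1 / ereal (norm (y i - y j))) = \<infinity>"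
    using ij(1) by blast
  then have "(\<Sum>i=1..N. \<Sum>j=i+1..N. 1 / ereal (norm (y i - y j))) = \<infinity>"
    by (simp only: sum_Pinfty finite_atLeastAtMost simp_thms)
  then show ?thesis unfolding coulomb_energy_def by simp
qed

text \<open>Coinciding electrons have infinite energy, so one admissible configuration of finite
  energy is enough: distinct points far out on a ray.\<close>

lemma distinct: "inj_on x {1..N}"
proof (rule ccontr)
  assume "\<not> inj_on x {1..N}"
  \<comment> \<open>A point of norm at least \<open>K\<close> keeps distance at least
    \<open>d\<close> from every nucleus, by the triangle inequality.\<close>
  define K where "K = d + (\<Sum>\<alpha>=1..M. norm (R \<alpha>))"
  define y :: "nat \<Rightarrow> real^3" where "y i = (K + real i) *\<^sub>R axis 1 1" for i
  have "inj_on y {1..N}" by (auto simp: y_def inj_on_def axis_eq_0_iff)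
  moreover have "norm (y i - R \<alpha>) \<ge> d" if "\<alpha> \<in> {1..M}" for i \<alpha>
  proof -
    have K: "norm (R \<alpha>) \<le> (\<Sum>\<alpha>=1..M. norm (R \<alpha>))" using that by (intro member_le_sum) auto
    have "norm (y i) = K + real i"
      using d by (simp add: y_def K_def sum_nonneg add_nonneg_nonneg)
    then show ?thesis using norm_triangle_ineq2[of "y i" "R \<alpha>"] K unfolding K_def by linarith
  qed
  ultimately show False
    using energy_le[of y] coulomb_energy_coincidence[OF \<open>\<not> inj_on x {1..N}\<close>] coulomb_energy_distinct by simp
qed

lemma coulomb_energy_eq: "coulomb_energy M R N Z x = ereal (attraction x + repulsion x)"
  by (rule coulomb_energy_distinct[OF distinct])

definition electron_potential :: "nat \<Rightarrow> real^3 \<Rightarrow> real" where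
  "electron_potential i p = nuclear_potential M R Z p + (\<Sum>j\<in>{1..N}-{i}. 1 / norm (p - x j))"

text \<open>Energy terms not involving electron \<open>i\<close> cancel. Places of other electrons
  must be excluded: there the real sum counts 1/0 = 0 while the energy is infinite.\<close>

lemma electron_potential_minimal:
  assumes i: "i \<in> {1..N}" and p: "\<And>\<alpha>. \<alpha> \<in> {1..M} \<Longrightarrow> norm (p - R \<alpha>) \<ge> d" and px: "p \<notin> x ` ({1..N}-{i})"
  shows "electron_potential i (x i) \<le> electron_potential i p"
proof -
  define I where "I = {1..N} - {i}"
  have I: "finite I" "i \<notin> I" "{1..N} = insert i I" using i by (auto simp: I_def)
  have split: "attraction y + repulsion y = (\<Sum>j\<in>I. nuclear_potential M R Z (y j)) + (\<Sum>j\<in>I. \<Sum>k\<in>I. 1 / norm (y j - y k)) / 2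
      + (nuclear_potential M R Z (y i) + (\<Sum>j\<in>I. 1 / norm (y i - y j)))" for y
    unfolding attraction_def repulsion_def I(3) using I(1,2)
    by (simp add: sum.distrib norm_minus_commute[of "y _" "y i"] add_divide_distrib)
  define y where "y = x(i := p)"
  have inj: "inj_on y {1..N}"
    using distinct px unfolding y_def I(3) I_def[symmetric] by (auto simp: inj_on_def)
  have "coulomb_energy M R N Z x \<le> coulomb_energy M R N Z y"
    using admissible p by (intro energy_le) (auto simp: y_def)
  then have "attraction x + repulsion x \<le> attraction y + repulsion y"
    by (simp add: coulomb_energy_eq coulomb_energy_distinct[OF inj])
  moreover have "(\<Sum>j\<in>I. nuclear_potential M R Z (y j)) = (\<Sum>j\<in>I. nuclear_potential M R Z (x j))"
    "(\<Sum>j\<in>I. \<Sum>k\<in>I. 1 / norm (y j - y k)) = (\<Sum>j\<in>I. \<Sum>k\<in>I. 1 / norm (x j - x k))"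
    "(\<Sum>j\<in>I. 1 / norm (y i - y j)) = (\<Sum>j\<in>I. 1 / norm (p - x j))"
    "y i = p"
    using I(2) by (auto simp: y_def intro!: sum.cong)
  ultimately show ?thesis
    unfolding electron_potential_def I_def[symmetric] split[of x] split[of y] by simp
qed

text \<open>Each electron is moved to a random place, distributed like the sphere charge that neutralizes the nuclei.\<close>

lemma energy_upper_bound: "attraction x + repulsion x \<le> - sphere_self_energy M R d Z / 2"
proof -
  let ?v = "nuclear_potential M R Z"
  let ?D = "sphere_self_energy M R d Z"
  define A where "A = attraction x"
  have avg: "electron_potential i (x i) \<le> (\<Sum>\<beta>=1..M. - Z \<beta> * nuclear_interaction R d \<alpha> \<beta>) + (\<Sum>j\<in>{1..N}-{i}. 1 / norm (x j - R \<alpha>))"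
    if i: "i \<in> {1..N}" and \<alpha>: "\<alpha> \<in> {1..M}" for i \<alpha>
  proof -
    have hb: "has_bochner_integral unit_sphere_measure
        (\<lambda>y. (\<Sum>\<beta>=1..M. - Z \<beta> * (1 / norm ((R \<alpha> + d *\<^sub>R y) - R \<beta>))) + (\<Sum>j\<in>{1..N}-{i}. 1 / norm ((R \<alpha> + d *\<^sub>R y) - x j)))
        ((\<Sum>\<beta>=1..M. - Z \<beta> * nuclear_interaction R d \<alpha> \<beta>) + (\<Sum>j\<in>{1..N}-{i}. 1 / norm (x j - R \<alpha>)))"
      using \<alpha> d admissible
      by (intro has_bochner_integral_add has_bochner_integral_sum has_bochner_integral_mult_right
            has_bochner_integral_nuclear_interaction has_bochner_integral_coulomb_sphere) auto
    have eq: "(\<Sum>\<beta>=1..M. - Z \<beta> * (1 / norm ((R \<alpha> + d *\<^sub>R y) - R \<beta>))) + (\<Sum>j\<in>{1..N}-{i}. 1 / norm ((R \<alpha> + d *\<^sub>R y) - x j))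
        = electron_potential i (R \<alpha> + d *\<^sub>R y)" for y
      by (simp add: electron_potential_def nuclear_potential_def)
    \<comment> \<open>Positions occupied by another electron are outside the scope of minimality,
      but form a null set.\<close>
    have "AE y in unit_sphere_measure. \<forall>j\<in>{1..N}-{i}. y \<noteq> (x j - R \<alpha>) /\<^sub>R d"
    proof (rule AE_finite_allI)
      fix j
      have "emeasure unit_sphere_measure {(x j - R \<alpha>) /\<^sub>R d} = 0" by (rule unit_sphere_no_atom)
      then show "AE y in unit_sphere_measure. y \<noteq> (x j - R \<alpha>) /\<^sub>R d"
        by (intro AE_I[of _ _ "{(x j - R \<alpha>) /\<^sub>R d}"]) auto
    qed simp
    then have "AE y in unit_sphere_measure. electron_potential i (x i) \<le> electron_potential i (R \<alpha> + d *\<^sub>R y)"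
      using AE_unit_sphere_norm
    proof eventually_elim
      case (elim y)
      have "norm ((R \<alpha> + d *\<^sub>R y) - R \<alpha>) = d" using elim d by simp
      moreover have "R \<alpha> + d *\<^sub>R y \<notin> x ` ({1..N}-{i})"
      proof
        assume "R \<alpha> + d *\<^sub>R y \<in> x ` ({1..N}-{i})"
        then obtain j where j: "R \<alpha> + d *\<^sub>R y = x j" "j \<in> {1..N}-{i}" by (rule imageE)
        then have "x j - R \<alpha> = d *\<^sub>R y" by (simp add: algebra_simps)
        then have "(x j - R \<alpha>) /\<^sub>R d = y" using d by simp
        then show False using elim(1) j by auto
      qed
      ultimately show ?case using i \<alpha> by (intro electron_potential_minimal sphere_outside) auto
    qed
    then have "(\<integral>y. electron_potential i (x i) \<partial>unit_sphere_measure) \<le> (\<integral>y. electron_potential i (R \<alpha> + d *\<^sub>R y) \<partial>unit_sphere_measure)"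
      using hb unfolding eq by (intro integral_mono_AE) (auto simp: has_bochner_integral_iff)
    moreover have "measure unit_sphere_measure UNIV = 1" using usm.prob_space by simp
    ultimately show ?thesis using hb unfolding eq by (simp add: has_bochner_integral_iff)
  qed
  have av2: "real N * electron_potential i (x i) \<le> - ?D - (\<Sum>j\<in>{1..N}-{i}. ?v (x j))" if i: "i \<in> {1..N}" for i
  proof -
    \<comment> \<open>Neutrality: the sphere charges serve as weights of total mass N.\<close>
    have "real N * electron_potential i (x i) = (\<Sum>\<alpha>=1..M. Z \<alpha> * electron_potential i (x i))"
      by (simp add: neutral sum_distrib_right)
    also have "\<dots> \<le> (\<Sum>\<alpha>=1..M. Z \<alpha> * ((\<Sum>\<beta>=1..M. - Z \<beta> * nuclear_interaction R d \<alpha> \<beta>) + (\<Sum>j\<in>{1..N}-{i}. 1 / norm (x j - R \<alpha>))))"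
      using avg[OF i] Z_pos by (intro sum_mono mult_left_mono) (auto intro: less_imp_le)
    also have "\<dots> = - ?D + (\<Sum>\<alpha>=1..M. \<Sum>j\<in>{1..N}-{i}. Z \<alpha> / norm (x j - R \<alpha>))"
      by (simp add: sphere_self_energy_def right_diff_distrib sum_subtractf sum_distrib_left sum_negf mult.assoc)
    also have "(\<Sum>\<alpha>=1..M. \<Sum>j\<in>{1..N}-{i}. Z \<alpha> / norm (x j - R \<alpha>)) = - (\<Sum>j\<in>{1..N}-{i}. ?v (x j))"
      by (subst sum.swap) (simp add: nuclear_potential_def sum_negf)
    finally show ?thesis by simp
  qed
  have "(\<Sum>i=1..N. real N * electron_potential i (x i)) \<le> (\<Sum>i=1..N. - ?D - (\<Sum>j\<in>{1..N}-{i}. ?v (x j)))"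
    by (intro sum_mono av2) auto
  also have "(\<Sum>i=1..N. - ?D - (\<Sum>j\<in>{1..N}-{i}. ?v (x j))) = (\<Sum>i=1..N. - ?D - (A - ?v (x i)))"
    by (intro sum.cong refl) (simp add: A_def attraction_def sum_diff1)
  also have "\<dots> = - real N * ?D - real N * A + A"
    by (simp add: sum_subtractf A_def attraction_def sum.distrib sum_negf)
  also have "(\<Sum>i=1..N. real N * electron_potential i (x i)) = real N * (A + 2 * repulsion x)"
  proof -
    have "electron_potential i (x i) = ?v (x i) + (\<Sum>j=1..N. 1 / norm (x i - x j))" if "i \<in> {1..N}" for i
      using that sum.remove[of "{1..N}" i "\<lambda>j. 1 / norm (x i - x j)"] unfolding electron_potential_def by simp
    then have "(\<Sum>i=1..N. electron_potential i (x i)) = A + 2 * repulsion x"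
      by (simp add: sum.distrib A_def attraction_def repulsion_def)
    then show ?thesis by (simp add: sum_distrib_left[symmetric])
  qed
  finally have 1: "real N * (A + 2 * repulsion x) \<le> - real N * ?D - real N * A + A" .
  have "A \<le> 0"
    unfolding A_def attraction_def nuclear_potential_def
    by (intro sum_nonpos) (auto intro!: divide_nonneg_nonneg less_imp_le[OF Z_pos])
  with 1 have "real N * (2 * (A + repulsion x)) \<le> real N * (- ?D)"
    by (simp add: algebra_simps)
  then have "2 * (A + repulsion x) \<le> - ?D" by (rule mult_left_le_imp_le) (simp add: N_pos)
  then show ?thesis by (simp add: A_def)
qed

end

section \<open>Electrons lie on the spheres\<close>

context nuclei
begin

definition exterior :: "(real^3) set" where
  "exterior = {p. \<forall>\<alpha>\<in>{1..M}. d < norm (p - R \<alpha>)}"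

text \<open>Finitely many strict inequalities leave slack; it gives each ball a collar disjoint from
  the other collars.\<close>

lemma enlarged_radius:
  obtains d' where "d < d'" "\<And>\<alpha> \<beta>. \<alpha> \<in> {1..M} \<Longrightarrow> \<beta> \<in> {1..M} \<Longrightarrow> \<alpha> \<noteq> \<beta> \<Longrightarrow> 2 * d' < norm (R \<alpha> - R \<beta>)"
proof -
  \<comment> \<open>The added element keeps the set nonempty when there is only one nucleus.\<close>
  define S where "S = insert (2 * d + 2) ((\<lambda>(\<alpha>, \<beta>). norm (R \<alpha> - R \<beta>)) ` {(\<alpha>, \<beta>) \<in> {1..M} \<times> {1..M}. \<alpha> \<noteq> \<beta>})"
  have "finite {(\<alpha>, \<beta>) \<in> {1..M} \<times> {1..M}. \<alpha> \<noteq> \<beta>}"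
    by (rule finite_subset[of _ "{1..M} \<times> {1..M}"]) auto
  then have S: "finite S" "S \<noteq> {}" by (auto simp: S_def)
  have "2 * d < Min S"
    unfolding Min_gr_iff[OF S] by (auto simp: S_def separated)
  then show ?thesis
  proof (intro that[of "(d + Min S / 2) / 2"])
    fix \<alpha> \<beta> assume "\<alpha> \<in> {1..M}" "\<beta> \<in> {1..M}" "\<alpha> \<noteq> \<beta>"
    then have "norm (R \<alpha> - R \<beta>) \<in> S" unfolding S_def by force
    then have "Min S \<le> norm (R \<alpha> - R \<beta>)" using S by simp
    with \<open>2 * d < Min S\<close> show "2 * ((d + Min S / 2) / 2) < norm (R \<alpha> - R \<beta>)" by simp
  qed simp
qed

lemma open_exterior: "open exterior"
proof -
  have "exterior = (\<Inter>\<alpha>\<in>{1..M}. {p. d < norm (p - R \<alpha>)})" by (auto simp: exterior_def)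
  also have "open \<dots>" by (intro open_INT ballI open_Collect_less continuous_intros) auto
  finally show ?thesis .
qed

text \<open>The exterior is the image of the complement of the centres under a map that inflates each centre
  to a ball: it sends the punctured ball of radius \<open>d'\<close> radially onto the shell between \<open>d\<close> and \<open>d'\<close>.\<close>

lemma connected_exterior: "connected exterior"
proof -
  obtain d' where d': "d < d'" and sep: "\<And>\<alpha> \<beta>. \<alpha> \<in> {1..M} \<Longrightarrow> \<beta> \<in> {1..M} \<Longrightarrow> \<alpha> \<noteq> \<beta> \<Longrightarrow> 2 * d' < norm (R \<alpha> - R \<beta>)"
    by (rule enlarged_radius) blast
  \<comment> \<open>At distance s < d' from a centre the map moves points outward by d - d s / d',
    so s becomes d + s (1 - d / d'), which fixes d' and sends 0 to d. Beyond d' the maximum is 0,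
    and disjointness of the balls leaves at most one nonzero summand.\<close>
  define f where "f p = p + (\<Sum>\<alpha>=1..M. (max 0 (d - d * norm (p - R \<alpha>) / d') / norm (p - R \<alpha>)) *\<^sub>R (p - R \<alpha>))" for p
  have far: "norm (p - R \<beta>) > 2 * d' - norm (p - R \<alpha>)" if "\<alpha> \<in> {1..M}" "\<beta> \<in> {1..M}" "\<alpha> \<noteq> \<beta>" for p \<alpha> \<beta>
    using norm_triangle_ineq4[of "p - R \<beta>" "p - R \<alpha>"] sep[OF that] by (simp add: norm_minus_commute)
  have zero: "max 0 (d - d * s / d') = 0" if "d' \<le> s" for s
    using that d d' by (simp add: field_simps max_def)
  have f_far: "f p = p" if "\<And>\<alpha>. \<alpha> \<in> {1..M} \<Longrightarrow> d' \<le> norm (p - R \<alpha>)" for p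
    using that unfolding f_def by (simp add: zero)
  have f_near: "f p = R \<alpha> + ((d + norm (p - R \<alpha>) * (1 - d / d')) / norm (p - R \<alpha>)) *\<^sub>R (p - R \<alpha>)"
    if \<alpha>: "\<alpha> \<in> {1..M}" and s: "p \<noteq> R \<alpha>" "norm (p - R \<alpha>) < d'" for p \<alpha>
  proof -
    let ?s = "norm (p - R \<alpha>)"
    have "(\<Sum>\<beta>=1..M. (max 0 (d - d * norm (p - R \<beta>) / d') / norm (p - R \<beta>)) *\<^sub>R (p - R \<beta>))
        = (\<Sum>\<beta>\<in>{\<alpha>}. (max 0 (d - d * norm (p - R \<beta>) / d') / norm (p - R \<beta>)) *\<^sub>R (p - R \<beta>))"
    proof (rule sum.mono_neutral_right)
      show "\<forall>\<beta>\<in>{1..M} - {\<alpha>}. (max 0 (d - d * norm (p - R \<beta>) / d') / norm (p - R \<beta>)) *\<^sub>R (p - R \<beta>) = 0"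
      proof
        fix \<beta> assume "\<beta> \<in> {1..M} - {\<alpha>}"
        then have "d' \<le> norm (p - R \<beta>)" using far[of \<alpha> \<beta> p] \<alpha> s by auto
        then show "(max 0 (d - d * norm (p - R \<beta>) / d') / norm (p - R \<beta>)) *\<^sub>R (p - R \<beta>) = 0" by (simp add: zero)
      qed
    qed (use \<alpha> in auto)
    also have "\<dots> = ((d - d * ?s / d') / ?s) *\<^sub>R (p - R \<alpha>)"
      using s d d' by (simp add: max_def field_simps)
    finally have "f p = R \<alpha> + (1 + (d - d * ?s / d') / ?s) *\<^sub>R (p - R \<alpha>)"
      unfolding f_def by (simp add: algebra_simps)
    also have "1 + (d - d * ?s / d') / ?s = (d + ?s * (1 - d / d')) / ?s"
      using s by (simp add: field_simps)
    finally show ?thesis .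
  qed
  have grow: "d + s * (1 - d / d') > d" if "s > 0" for s
    using that d d' by (auto intro!: mult_pos_pos)
  have shrink: "d + s * (1 - d / d') < d'" if "s < d'" for s
  proof -
    have "s * (1 - d / d') < d' * (1 - d / d')" using that d d' by (intro mult_strict_right_mono) auto
    also have "\<dots> = d' - d" using d d' by (simp add: field_simps)
    finally show ?thesis by simp
  qed
  have "f ` (UNIV - R ` {1..M}) = exterior"
  proof (intro equalityI subsetI)
    fix q assume "q \<in> f ` (UNIV - R ` {1..M})"
    then obtain p where "q = f p" "p \<in> UNIV - R ` {1..M}" by (rule imageE)
    then have p: "q = f p" "\<And>\<alpha>. \<alpha> \<in> {1..M} \<Longrightarrow> p \<noteq> R \<alpha>" by auto
    show "q \<in> exterior"
    proof (cases "\<exists>\<alpha>\<in>{1..M}. norm (p - R \<alpha>) < d'")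
      case True
      then obtain \<alpha> where \<alpha>: "\<alpha> \<in> {1..M}" "norm (p - R \<alpha>) < d'" by auto
      let ?s = "norm (p - R \<alpha>)"
      have s: "?s > 0" using p(2)[OF \<alpha>(1)] by simp
      have "norm (q - R \<alpha>) = \<bar>d + ?s * (1 - d / d')\<bar>"
        using f_near[OF \<alpha>(1) p(2)[OF \<alpha>(1)] \<alpha>(2)] s p(1) by simp
      then have n: "d < norm (q - R \<alpha>)" "norm (q - R \<alpha>) < d'"
        using grow[OF s] shrink[OF \<alpha>(2)] d by auto
      show ?thesis unfolding exterior_def
      proof (clarify)
        fix \<beta> assume "\<beta> \<in> {1..M}"
        then show "d < norm (q - R \<beta>)" using n far[OF \<alpha>(1), of \<beta> q] d' by (cases "\<beta> = \<alpha>") auto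
      qed
    next
      case False
      then have "f p = p" by (intro f_far) (auto simp: not_less)
      with False d' show ?thesis using p(1) by (force simp: exterior_def not_less)
    qed
  next
    fix q assume q: "q \<in> exterior"
    show "q \<in> f ` (UNIV - R ` {1..M})"
    proof (cases "\<exists>\<alpha>\<in>{1..M}. norm (q - R \<alpha>) < d'")
      case True
      then obtain \<alpha> where \<alpha>: "\<alpha> \<in> {1..M}" "norm (q - R \<alpha>) < d'" by auto
      define t where "t = norm (q - R \<alpha>)"
      have t: "d < t" "t < d'" using q \<alpha> by (auto simp: exterior_def t_def)
      \<comment> \<open>Inverse of the affine radial map s to d + s (1 - d / d').\<close>
      define s where "s = (t - d) * d' / (d' - d)"
      have s: "s > 0" "s < d'" "d + s * (1 - d / d') = t"
        using t d d' by (auto simp: s_def field_simps)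
      define p where "p = R \<alpha> + (s / t) *\<^sub>R (q - R \<alpha>)"
      have np: "norm (p - R \<alpha>) = s" using s t d by (simp add: p_def t_def[symmetric])
      then have "p \<noteq> R \<alpha>" using s by auto
      have "f p = R \<alpha> + (t / s) *\<^sub>R (p - R \<alpha>)"
        using f_near[OF \<alpha>(1) \<open>p \<noteq> R \<alpha>\<close>] s np by simp
      also have "\<dots> = q" using s t d by (simp add: p_def)
      finally have "q = f p" by simp
      moreover have "p \<noteq> R \<beta>" if "\<beta> \<in> {1..M}" for \<beta>
        using far[OF \<alpha>(1) that, of p] \<open>p \<noteq> R \<alpha>\<close> np s by (cases "\<beta> = \<alpha>") auto
      ultimately show ?thesis by blast
    next
      case False
      then have "f q = q" by (intro f_far) (auto simp: not_less)
      moreover have "q \<noteq> R \<alpha>" if "\<alpha> \<in> {1..M}" for \<alpha> using q that d by (force simp: exterior_def)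
      then have "q \<in> UNIV - R ` {1..M}" by blast
      ultimately show ?thesis by (metis image_eqI)
    qed
  qed
  moreover have "connected (UNIV - R ` {1..M})"
    by (rule connected_open_delete_finite) auto
  moreover have "continuous_on (UNIV - R ` {1..M}) f"
    unfolding f_def using d d' by (intro continuous_intros) auto
  ultimately show ?thesis using connected_continuous_image by metis
qed

text \<open>A point on one of the spheres is pushed radially outward; the collar prevents it from
  entering another ball.\<close>

lemma islimpt_exterior:
  assumes p: "\<And>\<alpha>. \<alpha> \<in> {1..M} \<Longrightarrow> d \<le> norm (p - R \<alpha>)"
  shows "p islimpt exterior"
proof (cases "p \<in> exterior")
  case True
  then show ?thesis using open_exterior by (simp add: interior_limit_point interior_open)
next
  case False
  then obtain \<alpha> where \<alpha>: "\<alpha> \<in> {1..M}" "norm (p - R \<alpha>) = d"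
    using p by (force simp: exterior_def not_less)
  obtain d' where d': "d < d'" and sep: "\<And>\<alpha> \<beta>. \<alpha> \<in> {1..M} \<Longrightarrow> \<beta> \<in> {1..M} \<Longrightarrow> \<alpha> \<noteq> \<beta> \<Longrightarrow> 2 * d' < norm (R \<alpha> - R \<beta>)"
    by (rule enlarged_radius) blast
  show ?thesis unfolding islimpt_approachable
  proof (intro allI impI)
    fix e :: real assume e: "e > 0"
    \<comment> \<open>Small enough to stay within the collar and within e / 2 of
      \<open>p\<close>.\<close>
    define t where "t = min ((d' - d) / d) (e / (2 * d))"
    have "t \<le> (d' - d) / d" "t \<le> e / (2 * d)" by (auto simp: t_def)
    then have "t * d \<le> d' - d" "t * d \<le> e / 2" using d by (auto simp: field_simps)
    moreover have "t > 0" using d d' e by (simp add: t_def)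
    ultimately have t: "t > 0" "t * d \<le> d' - d" "t * d < e" using e by auto
    define q where "q = p + t *\<^sub>R (p - R \<alpha>)"
    have "q - R \<alpha> = (1 + t) *\<^sub>R (p - R \<alpha>)" by (simp add: q_def algebra_simps)
    then have "norm (q - R \<alpha>) = \<bar>1 + t\<bar> * norm (p - R \<alpha>)" by simp
    then have nq: "norm (q - R \<alpha>) = d + t * d" using t(1) \<alpha>(2) by (simp add: distrib_right)
    have "d < norm (q - R \<beta>)" if \<beta>: "\<beta> \<in> {1..M}" for \<beta>
    proof (cases "\<beta> = \<alpha>")
      case True
      then show ?thesis using nq t d by simp
    next
      case False
      have "norm (R \<alpha> - R \<beta>) \<le> norm (q - R \<alpha>) + norm (q - R \<beta>)"
        using norm_triangle_ineq4[of "q - R \<beta>" "q - R \<alpha>"] by (simp add: norm_minus_commute)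
      then show ?thesis using sep[OF \<alpha>(1) \<beta>] False nq t d' by auto
    qed
    then have "q \<in> exterior" by (simp add: exterior_def)
    moreover have "dist q p = t * d" using t \<alpha> by (simp add: q_def dist_norm)
    moreover have "t * d > 0" using t d by simp
    ultimately show "\<exists>x'\<in>exterior. x' \<noteq> p \<and> dist x' p < e" using t by (intro bexI[of _ q]) auto
  qed
qed

end

context ground_state
begin

text \<open>Strong minimum principle: away from the other electrons the potential is harmonic in the exterior,
  so an electron in the exterior would make it constant there, although it blows up at the other electrons.\<close>

lemma not_in_exterior:
  assumes N: "N \<ge> 2" and i: "i \<in> {1..N}"
  shows "x i \<notin> exterior"
proof
  assume ext: "x i \<in> exterior"
  define K where "K = x ` ({1..N} - {i})"
  define \<Phi> where "\<Phi> = electron_potential i"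
  define m where "m = \<Phi> (x i)"
  \<comment> \<open>The set where the minimum is attained; it will be shown to be both open and
    closed in a connected set.\<close>
  define E where "E = {p \<in> exterior - K. \<Phi> p = m}"
  have fK: "finite K" by (simp add: K_def)
  have op: "open (exterior - K)" using open_exterior fK by (simp add: open_Diff finite_imp_closed)
  have \<Phi>_eq: "\<Phi> p = (\<Sum>\<beta>=1..M. - Z \<beta> * (1 / norm (p - R \<beta>))) + (\<Sum>j\<in>{1..N}-{i}. 1 / norm (p - x j))" for p
    by (simp add: \<Phi>_def electron_potential_def nuclear_potential_def)
  have not_R: "p \<noteq> R \<alpha>" if "p \<in> exterior" "\<alpha> \<in> {1..M}" for p \<alpha> using that d by (force simp: exterior_def)
  have not_x: "p \<noteq> x j" if "p \<notin> K" "j \<in> {1..N} - {i}" for p j using that by (auto simp: K_def)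
  have cont: "continuous_on (exterior - K) \<Phi>"
    unfolding \<Phi>_eq by (intro continuous_intros) (use not_R not_x in auto)
  have min: "m \<le> \<Phi> p" if "p \<in> exterior - K" for p
    unfolding m_def \<Phi>_def using that i
    by (intro electron_potential_minimal) (auto simp: exterior_def K_def intro: less_imp_le)
  have above: "open {p \<in> exterior - K. m < \<Phi> p}"
  proof -
    have "open ((exterior - K) \<inter> \<Phi> -` {m<..})" by (rule continuous_open_preimage[OF cont op]) simp
    then show ?thesis by (simp add: vimage_def Int_def)
  qed
  have "open E"
  proof (subst open_contains_ball, intro ballI)
    fix p assume p: "p \<in> E"
    then obtain e where e: "e > 0" "ball p e \<subseteq> exterior - K"
      using op open_contains_ball unfolding E_def by blast
    have "ball p e \<subseteq> E"
    proof
      fix q assume q: "q \<in> ball p e"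
      show "q \<in> E"
      proof (rule ccontr)
        assume "q \<notin> E"
        then have q1: "q \<in> exterior - K" "m < \<Phi> q" using q e min[of q] by (auto simp: E_def)
        \<comment> \<open>The sphere about \<open>p\<close> through \<open>q\<close>: its mean is m,
          no value on it is below m, yet near \<open>q\<close> the values exceed m.\<close>
        define r where "r = norm (q - p)"
        have "q \<noteq> p" using \<open>q \<notin> E\<close> p by auto
        then have r: "r > 0" "r < e" using q by (auto simp: r_def dist_norm norm_minus_commute)
        have in_ball: "p + r *\<^sub>R y \<in> exterior - K" if "norm y = 1" for y
          using e(2) that r by (intro subsetD[OF e(2)]) (simp add: dist_norm)
        have far_R: "r \<le> norm (R \<beta> - p)" if "\<beta> \<in> {1..M}" for \<beta>
        proof -
          have "R \<beta> \<notin> ball p e" using e(2) not_R that by blast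
          then show ?thesis using r by (simp add: dist_norm norm_minus_commute)
        qed
        have far_x: "r \<le> norm (x j - p)" if "j \<in> {1..N} - {i}" for j
        proof -
          have "x j \<notin> ball p e" using e(2) not_x that by blast
          then show ?thesis using r by (simp add: dist_norm norm_minus_commute)
        qed
        \<comment> \<open>Mean value property, as an instance of Newton's theorem: all nuclei and
          other electrons lie at distance at least \<open>r\<close> from \<open>p\<close>.\<close>
        have "has_bochner_integral unit_sphere_measure (\<lambda>y. \<Phi> (p + r *\<^sub>R y))
           ((\<Sum>\<beta>=1..M. - Z \<beta> * (1 / norm (R \<beta> - p))) + (\<Sum>j\<in>{1..N}-{i}. 1 / norm (x j - p)))"
          unfolding \<Phi>_eq
          by (intro has_bochner_integral_add has_bochner_integral_sum has_bochner_integral_mult_right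
              has_bochner_integral_coulomb_sphere r far_R far_x)
        also have "(\<Sum>\<beta>=1..M. - Z \<beta> * (1 / norm (R \<beta> - p))) + (\<Sum>j\<in>{1..N}-{i}. 1 / norm (x j - p)) = \<Phi> p"
          unfolding \<Phi>_eq by (simp add: norm_minus_commute)
        also have "\<Phi> p = m" using p by (simp add: E_def)
        finally have hb: "has_bochner_integral unit_sphere_measure (\<lambda>y. \<Phi> (p + r *\<^sub>R y)) m" .
        have "has_bochner_integral unit_sphere_measure (\<lambda>y. m) m"
          using usm.prob_space by (simp add: has_bochner_integral_iff)
        from has_bochner_integral_diff[OF hb this]
        have hb2: "has_bochner_integral unit_sphere_measure (\<lambda>y. \<Phi> (p + r *\<^sub>R y) - m) 0" by simp
        have "AE y in unit_sphere_measure. 0 \<le> \<Phi> (p + r *\<^sub>R y) - m"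
          using AE_unit_sphere_norm by eventually_elim (use min in_ball in auto)
        then have "AE y in unit_sphere_measure. \<Phi> (p + r *\<^sub>R y) - m = 0"
          using hb2 by (subst integral_nonneg_eq_0_iff_AE[symmetric]) (simp_all add: has_bochner_integral_iff)
        then have "AE y in unit_sphere_measure. y \<notin> (\<lambda>y. p + r *\<^sub>R y) -` {p \<in> exterior - K. m < \<Phi> p}"
          by eventually_elim auto
        moreover define U where "U = (\<lambda>y. p + r *\<^sub>R y) -` {p \<in> exterior - K. m < \<Phi> p}"
        ultimately have "AE y in unit_sphere_measure. y \<notin> U" by simp
        moreover have oU: "open U" unfolding U_def by (intro open_vimage above continuous_intros)
        ultimately have "emeasure unit_sphere_measure U = 0"
          by (subst (asm) AE_iff_measurable[of U]) (auto simp: borel_open)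
        moreover have "(q - p) /\<^sub>R r \<in> U" "norm ((q - p) /\<^sub>R r) = 1"
          using r q1 by (auto simp: U_def r_def[symmetric])
        ultimately show False using unit_sphere_open_pos[OF oU] by force
      qed
    qed
    then show "\<exists>e>0. ball p e \<subseteq> E" using e by blast
  qed
  then have "openin (top_of_set (exterior - K)) E"
    by (subst openin_open_eq[OF op]) (auto simp: E_def)
  moreover have "closedin (top_of_set (exterior - K)) E"
    unfolding E_def by (rule continuous_closedin_preimage_constant[OF cont])
  \<comment> \<open>Removing finitely many points from a connected open set does not disconnect it
    in dimension three.\<close>
  moreover have "connected (exterior - K)"
    by (rule connected_open_delete_finite) (auto simp: open_exterior connected_exterior fK)
  moreover have "x i \<in> E"
    using ext i distinct by (auto simp: E_def m_def K_def dest: inj_onD)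
  ultimately have E: "E = exterior - K"
    unfolding connected_clopen by blast
  obtain j where j: "j \<in> {1..N} - {i}"
  proof (cases "i = 1")
    case True
    then show ?thesis using N that[of 2] by auto
  next
    case False
    then show ?thesis using N that[of 1] by auto
  qed
  have "x j islimpt exterior" using admissible j by (intro islimpt_exterior) auto
  then have "x j islimpt (K \<union> (exterior - K))" by (rule islimpt_subset) auto
  then have lim: "x j islimpt (exterior - K)" using islimpt_Un_finite[OF fK] by blast
  \<comment> \<open>Constancy would bound the repulsion from electron \<open>j\<close> by m plus the
    largest possible attraction, hence below \<open>c\<close>; within distance 1 / c of that
    electron it exceeds \<open>c\<close>.\<close>
  define c where "c = \<bar>m\<bar> + (\<Sum>\<beta>=1..M. Z \<beta> / d) + 1"
  have "(\<Sum>\<beta>=1..M. Z \<beta> / d) \<ge> 0" using Z_pos d by (intro sum_nonneg) (auto intro: less_imp_le)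
  then have c: "c > 0" by (simp add: c_def)
  then obtain p where p: "p \<in> exterior - K" "p \<noteq> x j" "dist p (x j) < 1 / c"
    using lim unfolding islimpt_approachable by (metis zero_less_divide_1_iff)
  have "1 / norm (p - x j) \<le> (\<Sum>j\<in>{1..N}-{i}. 1 / norm (p - x j))"
    using j by (intro member_le_sum) auto
  moreover have "- (\<Sum>\<beta>=1..M. Z \<beta> / d) \<le> (\<Sum>\<beta>=1..M. - Z \<beta> * (1 / norm (p - R \<beta>)))"
    unfolding sum_negf[symmetric]
  proof (rule sum_mono)
    fix \<beta> assume \<beta>: "\<beta> \<in> {1..M}"
    then have "d < norm (p - R \<beta>)" using p by (auto simp: exterior_def)
    moreover from this have "0 < norm (p - R \<beta>) * d" using d by (intro mult_pos_pos) linarith+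
    ultimately have "Z \<beta> / norm (p - R \<beta>) \<le> Z \<beta> / d"
      using Z_pos[OF \<beta>] d by (intro divide_left_mono) auto
    then show "- (Z \<beta> / d) \<le> - Z \<beta> * (1 / norm (p - R \<beta>))" by simp
  qed
  moreover have "\<Phi> p = m" using p(1) E by (auto simp: E_def)
  ultimately have "1 / norm (p - x j) \<le> m + (\<Sum>\<beta>=1..M. Z \<beta> / d)"
    using \<Phi>_eq[of p] by linarith
  also have "\<dots> < c" by (simp add: c_def)
  finally have "1 / norm (p - x j) < c" .
  moreover have "c < 1 / norm (p - x j)"
    using p(2,3) c by (simp add: dist_norm field_simps)
  ultimately show False by simp
qed

lemma on_some_sphere:
  assumes "N \<ge> 2" "i \<in> {1..N}"
  obtains \<alpha> where "\<alpha> \<in> {1..M}" "norm (x i - R \<alpha>) = d"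
  using not_in_exterior[OF assms] admissible[OF assms(2)] by (force simp: exterior_def not_less)

end

section \<open>The lower energy bound\<close>

definition sphere_uniform :: "real^3 \<Rightarrow> real \<Rightarrow> (real^3) measure" where
  "sphere_uniform c r = distr unit_sphere_measure borel (\<lambda>y. c + r *\<^sub>R y)"

lemma affine_measurable [measurable]: "(\<lambda>y. c + r *\<^sub>R y) \<in> borel_measurable (borel :: (real^3) measure)"
  by (intro borel_measurable_continuous_onI continuous_intros)

lemma sets_sphere_uniform [simp, measurable_cong]: "sets (sphere_uniform c r) = sets borel"
  and space_sphere_uniform [simp]: "space (sphere_uniform c r) = UNIV"
  by (auto simp: sphere_uniform_def)

lemma prob_space_sphere_uniform: "prob_space (sphere_uniform c r)"
  unfolding sphere_uniform_def by (rule usm.prob_space_distr) measurable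

lemma AE_sphere_uniform: "r > 0 \<Longrightarrow> AE p in sphere_uniform c r. norm (p - c) = r"
  unfolding sphere_uniform_def
  by (subst AE_distr_iff) (use AE_unit_sphere_norm in \<open>auto elim: eventually_mono\<close>)

lemma integral_soft_coulomb_sphere_uniform:
  assumes "r > 0" "p \<noteq> c"
  shows "(\<integral>y. soft_coulomb \<epsilon> p y \<partial>sphere_uniform c r) = sphere_potential \<epsilon> r (norm (p - c))"
proof -
  have [measurable]: "soft_coulomb \<epsilon> p \<in> borel_measurable borel"
    unfolding soft_coulomb_def by measurable
  show ?thesis
    using has_bochner_integral_soft_coulomb_sphere[OF assms, of \<epsilon>] unfolding sphere_uniform_def
    by (subst integral_distr) (auto simp: has_bochner_integral_iff)
qed

context ground_state
begin

section \<open>The difference of electron and sphere charges\<close>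

abbreviation charge_index :: "(nat + nat) set" where
  "charge_index \<equiv> {1..N} <+> {1..M}"

text \<open>Dividing by N makes the total charge 0 and the total variation exactly 2, whatever N
  is.\<close>

definition charge_weight :: "nat + nat \<Rightarrow> real" where
  "charge_weight j = (case j of Inl i \<Rightarrow> 1 / N | Inr \<alpha> \<Rightarrow> - Z \<alpha> / N)"

definition charge_measure :: "nat + nat \<Rightarrow> (real^3) measure" where
  "charge_measure j = (case j of Inl i \<Rightarrow> return borel (x i) | Inr \<alpha> \<Rightarrow> sphere_uniform (R \<alpha>) d)"

definition radius_bound :: real where
  "radius_bound = d + (\<Sum>\<alpha>=1..M. norm (R \<alpha>))"

lemma norm_le_radius_bound:
  assumes "\<alpha> \<in> {1..M}" "norm (p - R \<alpha>) = d"
  shows "norm p \<le> radius_bound"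
proof -
  have "norm (R \<alpha>) \<le> (\<Sum>\<alpha>=1..M. norm (R \<alpha>))" using assms(1) by (intro member_le_sum) auto
  then show ?thesis using norm_triangle_ineq[of "p - R \<alpha>" "R \<alpha>"] assms(2) by (simp add: radius_bound_def)
qed

text \<open>As the electrons lie on the spheres, \<open>radius_bound\<close> depends only on the
  nuclei and \<open>d\<close>; both bounds of the family are therefore independent of N and the
  charges.\<close>

lemma signed_family_charge:
  assumes "N \<ge> 2"
  shows "signed_family charge_index charge_weight charge_measure radius_bound 2"
proof (rule signed_family.intro)
  show "finite charge_index" by simp
  show "prob_space (charge_measure j)" if "j \<in> charge_index" for j
    by (auto simp: charge_measure_def prob_space_return prob_space_sphere_uniform split: sum.split)
  show "sets (charge_measure j) = sets borel" if "j \<in> charge_index" for j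
    by (auto simp: charge_measure_def split: sum.split)
  show "AE p in charge_measure j. norm p \<le> radius_bound" if j: "j \<in> charge_index" for j
    using j
  proof (elim PlusE)
    fix i assume i: "i \<in> {1..N}" "j = Inl i"
    obtain \<alpha> where "\<alpha> \<in> {1..M}" "norm (x i - R \<alpha>) = d" by (rule on_some_sphere[OF assms i(1)])
    then have "norm (x i) \<le> radius_bound" by (rule norm_le_radius_bound)
    moreover have "charge_measure j = return borel (x i)" using i(2) by (simp add: charge_measure_def)
    moreover have "AE p in return borel (x i). norm p \<le> radius_bound"
      by (subst AE_return) (use \<open>norm (x i) \<le> radius_bound\<close> in auto)
    ultimately show ?thesis by metis
  next
    fix \<alpha> assume \<alpha>: "\<alpha> \<in> {1..M}" "j = Inr \<alpha>"
    have "AE p in sphere_uniform (R \<alpha>) d. norm p \<le> radius_bound"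
      using AE_sphere_uniform[OF d] by eventually_elim (rule norm_le_radius_bound[OF \<alpha>(1)])
    moreover have "charge_measure j = sphere_uniform (R \<alpha>) d" using \<alpha>(2) by (simp add: charge_measure_def)
    ultimately show ?thesis by metis
  qed
  show "(\<Sum>j\<in>charge_index. \<bar>charge_weight j\<bar>) \<le> 2"
  proof -
    have "(\<Sum>j\<in>charge_index. \<bar>charge_weight j\<bar>) = (\<Sum>i=1..N. 1 / real N) + (\<Sum>\<alpha>=1..M. Z \<alpha> / real N)"
      by (subst sum.Plus) (auto simp: charge_weight_def abs_of_pos[OF Z_pos] intro!: sum.cong)
    also have "(\<Sum>\<alpha>=1..M. Z \<alpha> / real N) = 1"
      unfolding sum_divide_distrib[symmetric] neutral[symmetric] using N_pos by simp
    finally show ?thesis using N_pos by simp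
  qed
  show "radius_bound > 0" unfolding radius_bound_def using d by (intro add_pos_nonneg sum_nonneg) auto
qed

abbreviation charge_functional :: "(real^3 \<Rightarrow> real) \<Rightarrow> real" where
  "charge_functional \<equiv> lincomb_integral charge_index charge_weight charge_measure"

lemma charge_functional_eq:
  assumes [measurable]: "f \<in> borel_measurable borel"
  shows "charge_functional f = (\<Sum>i=1..N. f (x i)) / N - (\<Sum>\<alpha>=1..M. Z \<alpha> / N * (\<integral>p. f p \<partial>sphere_uniform (R \<alpha>) d))"
proof -
  have "charge_functional f = (\<Sum>i=1..N. 1 / N * f (x i)) + (\<Sum>\<alpha>=1..M. - Z \<alpha> / N * (\<integral>p. f p \<partial>sphere_uniform (R \<alpha>) d))"
    unfolding lincomb_integral_def
    by (subst sum.Plus) (auto simp: charge_weight_def charge_measure_def integral_return)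
  then show ?thesis by (simp add: sum_divide_distrib sum_negf)
qed

text \<open>Expands the square into electron-electron, electron-sphere and sphere-sphere terms.
  Unlike in \<open>repulsion\<close>, the diagonal of the first sum counts: these are the self
  energies.\<close>

lemma charge_energy_eq:
  assumes N: "N \<ge> 2" and \<epsilon>: "\<epsilon> > 0"
  shows "real N ^ 2 * signed_family.energy charge_index charge_weight charge_measure \<epsilon>
    = (\<Sum>i=1..N. \<Sum>j=1..N. soft_coulomb \<epsilon> (x i) (x j))
      - 2 * (\<Sum>i=1..N. \<Sum>\<alpha>=1..M. Z \<alpha> * sphere_potential \<epsilon> d (norm (x i - R \<alpha>)))
      + (\<Sum>\<alpha>=1..M. \<Sum>\<beta>=1..M. Z \<alpha> * Z \<beta> * (\<integral>p. sphere_potential \<epsilon> d (norm (p - R \<beta>)) \<partial>sphere_uniform (R \<alpha>) d))"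
proof -
  interpret F: signed_family charge_index charge_weight charge_measure radius_bound 2
    by (rule signed_family_charge[OF N])
  let ?k = "soft_coulomb \<epsilon>"
  let ?u = "\<lambda>\<alpha> p. sphere_potential \<epsilon> d (norm (p - R \<alpha>))"
  have n0: "real N \<noteq> 0" using N by simp
  have alg: "n\<^sup>2 * e = a - 2 * b + c" if "n \<noteq> 0" "e = (a - b) / n / n - (b - c) / (n * n)" for n e a b c :: real
  proof -
    have "e = (a - 2 * b + c) / n\<^sup>2"
      using that(2) by (simp add: power2_eq_square diff_divide_distrib add_divide_distrib)
    then show ?thesis using that(1) by simp
  qed
  have km[measurable]: "?k p \<in> borel_measurable borel" for p
    unfolding soft_coulomb_def by measurable
  have km'[measurable]: "(\<lambda>p. ?k p q) \<in> borel_measurable borel" for q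
    unfolding soft_coulomb_def by measurable
  have um[measurable]: "?u \<alpha> \<in> borel_measurable borel" for \<alpha>
    unfolding sphere_potential_def by measurable
  have k_sym: "?k p q = ?k q p" for p q by (simp add: soft_coulomb_def norm_minus_commute)
  have neq: "x i \<noteq> R \<alpha>" if "i \<in> {1..N}" "\<alpha> \<in> {1..M}" for i \<alpha> using admissible[OF that] d by auto
  have inner: "charge_functional (?k p) = (\<Sum>j=1..N. ?k p (x j)) / N - (\<Sum>\<beta>=1..M. Z \<beta> * ?u \<beta> p) / N"
    if "\<And>\<beta>. \<beta> \<in> {1..M} \<Longrightarrow> p \<noteq> R \<beta>" for p
    unfolding charge_functional_eq[OF km] using that d by (simp add: integral_soft_coulomb_sphere_uniform sum_divide_distrib)
  have Lm: "(\<lambda>p. charge_functional (?k p)) \<in> borel_measurable borel"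
  proof (rule F.L_measurable)
    have "continuous_on UNIV (\<lambda>q::(real^3)\<times>(real^3). ?k (fst q) (snd q))"
      unfolding soft_coulomb_def using \<epsilon> by (intro continuous_intros) (auto simp: add_nonneg_eq_0_iff)
    then show "case_prod ?k \<in> borel_measurable (borel \<Otimes>\<^sub>M borel)"
      using borel_measurable_continuous_onI by (simp add: borel_prod case_prod_beta')
  qed
  \<comment> \<open>The softened kernel is bounded, which provides all integrability below.\<close>
  have k_bound: "\<bar>?k p q\<bar> \<le> 1 / \<epsilon>" for p q
  proof -
    have "\<epsilon> \<le> sqrt ((norm (p - q))\<^sup>2 + \<epsilon>\<^sup>2)" using \<epsilon> by (intro real_le_rsqrt) auto
    then show ?thesis using \<epsilon> unfolding soft_coulomb_def by (auto intro!: divide_left_mono mult_pos_pos add_nonneg_pos)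
  qed
  have int_sphere: "(\<integral>p. charge_functional (?k p) \<partial>sphere_uniform (R \<alpha>) d)
     = (\<Sum>j=1..N. ?u \<alpha> (x j)) / N - (\<Sum>\<beta>=1..M. Z \<beta> * (\<integral>p. ?u \<beta> p \<partial>sphere_uniform (R \<alpha>) d)) / N"
    if \<alpha>: "\<alpha> \<in> {1..M}" for \<alpha>
  proof -
    interpret S: prob_space "sphere_uniform (R \<alpha>) d" by (rule prob_space_sphere_uniform)
    have ki: "integrable (sphere_uniform (R \<alpha>) d) (\<lambda>p. ?k p q)" for q
      by (rule S.integrable_const_bound[where B="1/\<epsilon>"]) (auto simp: k_bound)
    have ui: "integrable (sphere_uniform (R \<alpha>) d) (?u \<beta>)" if \<beta>: "\<beta> \<in> {1..M}" for \<beta>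
    proof (rule S.integrable_const_bound[where B="1/\<epsilon>"])
      show "AE p in sphere_uniform (R \<alpha>) d. norm (?u \<beta> p) \<le> 1 / \<epsilon>"
        using AE_sphere_uniform[OF d]
      proof eventually_elim
        case (elim p)
        interpret S': prob_space "sphere_uniform (R \<beta>) d" by (rule prob_space_sphere_uniform)
        have "p \<noteq> R \<beta>" using sphere_outside[OF \<alpha> \<beta> elim] d by auto
        then have "\<bar>?u \<beta> p\<bar> = \<bar>\<integral>y. ?k p y \<partial>sphere_uniform (R \<beta>) d\<bar>"
          using d by (simp add: integral_soft_coulomb_sphere_uniform)
        also have "\<dots> \<le> (\<integral>y. \<bar>?k p y\<bar> \<partial>sphere_uniform (R \<beta>) d)" by (rule integral_abs_bound)
        also have "\<dots> \<le> (\<integral>y. 1 / \<epsilon> \<partial>sphere_uniform (R \<beta>) d)"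
          by (intro integral_mono integrable_abs S'.integrable_const_bound[where B="1/\<epsilon>"]) (use \<epsilon> k_bound in \<open>auto simp: abs_of_pos\<close>)
        also have "\<dots> = 1 / \<epsilon>" using S'.prob_space by simp
        finally show ?case by simp
      qed
    qed simp
    have "(\<integral>p. charge_functional (?k p) \<partial>sphere_uniform (R \<alpha>) d)
      = (\<integral>p. (\<Sum>j=1..N. ?k p (x j)) / N - (\<Sum>\<beta>=1..M. Z \<beta> * ?u \<beta> p) / N \<partial>sphere_uniform (R \<alpha>) d)"
    proof (rule integral_cong_AE)
      show "AE p in sphere_uniform (R \<alpha>) d. charge_functional (?k p) = (\<Sum>j=1..N. ?k p (x j)) / N - (\<Sum>\<beta>=1..M. Z \<beta> * ?u \<beta> p) / N"
        using AE_sphere_uniform[OF d]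
      proof eventually_elim
        case (elim p)
        show ?case using sphere_outside[OF \<alpha> _ elim] d by (intro inner) force
      qed
    qed (use Lm in \<open>simp_all cong: measurable_cong_sets\<close>)
    also have "\<dots> = (\<Sum>j=1..N. \<integral>p. ?k p (x j) \<partial>sphere_uniform (R \<alpha>) d) / N - (\<Sum>\<beta>=1..M. Z \<beta> * (\<integral>p. ?u \<beta> p \<partial>sphere_uniform (R \<alpha>) d)) / N"
    proof (subst Bochner_Integration.integral_diff)
      show "integrable (sphere_uniform (R \<alpha>) d) (\<lambda>p. (\<Sum>j=1..N. ?k p (x j)) / N)"
        by (intro integrable_divide Bochner_Integration.integrable_sum ki)
      show "integrable (sphere_uniform (R \<alpha>) d) (\<lambda>p. (\<Sum>\<beta>=1..M. Z \<beta> * ?u \<beta> p) / N)"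
        by (intro integrable_divide Bochner_Integration.integrable_sum integrable_mult_right ui)
    qed (simp add: Bochner_Integration.integral_sum ki ui)
    also have "(\<Sum>j=1..N. \<integral>p. ?k p (x j) \<partial>sphere_uniform (R \<alpha>) d) = (\<Sum>j=1..N. ?u \<alpha> (x j))"
      using neq \<alpha> d by (subst k_sym) (auto intro!: sum.cong integral_soft_coulomb_sphere_uniform)
    finally show ?thesis .
  qed
  have "F.energy \<epsilon> = (\<Sum>i=1..N. charge_functional (?k (x i))) / N
      - (\<Sum>\<alpha>=1..M. Z \<alpha> / N * (\<integral>p. charge_functional (?k p) \<partial>sphere_uniform (R \<alpha>) d))"
    unfolding F.energy_def by (rule charge_functional_eq[OF Lm])
  also have "(\<Sum>i=1..N. charge_functional (?k (x i))) = (\<Sum>i=1..N. (\<Sum>j=1..N. ?k (x i) (x j)) / N - (\<Sum>\<beta>=1..M. Z \<beta> * ?u \<beta> (x i)) / N)"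
    by (intro sum.cong refl inner neq)
  also have "\<dots> = ((\<Sum>i=1..N. \<Sum>j=1..N. ?k (x i) (x j)) - (\<Sum>i=1..N. \<Sum>\<beta>=1..M. Z \<beta> * ?u \<beta> (x i))) / N"
    by (simp add: sum_subtractf sum_divide_distrib diff_divide_distrib)
  also have "(\<Sum>\<alpha>=1..M. Z \<alpha> / N * (\<integral>p. charge_functional (?k p) \<partial>sphere_uniform (R \<alpha>) d))
      = (\<Sum>\<alpha>=1..M. Z \<alpha> / N * ((\<Sum>j=1..N. ?u \<alpha> (x j)) / N - (\<Sum>\<beta>=1..M. Z \<beta> * (\<integral>p. ?u \<beta> p \<partial>sphere_uniform (R \<alpha>) d)) / N))"
    by (intro sum.cong refl arg_cong2[where f="(*)"] int_sphere)
  also have "\<dots> = ((\<Sum>\<alpha>=1..M. \<Sum>j=1..N. Z \<alpha> * ?u \<alpha> (x j)) - (\<Sum>\<alpha>=1..M. \<Sum>\<beta>=1..M. Z \<alpha> * Z \<beta> * (\<integral>p. ?u \<beta> p \<partial>sphere_uniform (R \<alpha>) d))) / (real N * real N)"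
    by (simp add: sum_subtractf sum_divide_distrib diff_divide_distrib right_diff_distrib sum_distrib_left mult.assoc)
  also have "(\<Sum>\<alpha>=1..M. \<Sum>j=1..N. Z \<alpha> * ?u \<alpha> (x j)) = (\<Sum>i=1..N. \<Sum>\<alpha>=1..M. Z \<alpha> * ?u \<alpha> (x i))"
    by (rule sum.swap)
  finally show ?thesis using alg[OF n0] by blast
qed

text \<open>Three comparisons with the Coulomb kernel: the self energies add
  \<open>1 / \<epsilon>\<close> per electron, each electron loses at most
  \<open>\<epsilon> / (2 * d\<^sup>2)\<close> per unit nuclear charge in the cross term, and
  softening only lowers the sphere-sphere term.\<close>

lemma charge_energy_le:
  assumes N: "N \<ge> 2" and \<epsilon>: "\<epsilon> > 0"
  shows "real N ^ 2 * signed_family.energy charge_index charge_weight charge_measure \<epsilon>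
    \<le> 2 * (attraction x + repulsion x) + sphere_self_energy M R d Z + N / \<epsilon> + (real N)\<^sup>2 * \<epsilon> / d\<^sup>2"
proof -
  let ?k = "soft_coulomb \<epsilon>"
  let ?u = "\<lambda>\<alpha> p. sphere_potential \<epsilon> d (norm (p - R \<alpha>))"
  have k_le: "?k p q \<le> 1 / norm (p - q)" if "p \<noteq> q" for p q
  proof -
    have "norm (p - q) \<le> sqrt ((norm (p - q))\<^sup>2 + \<epsilon>\<^sup>2)" by (intro real_le_rsqrt) auto
    then show ?thesis using that unfolding soft_coulomb_def by (intro divide_left_mono mult_pos_pos) (auto simp: add_pos_nonneg)
  qed
  have "(\<Sum>i=1..N. \<Sum>j=1..N. ?k (x i) (x j)) \<le> (\<Sum>i=1..N. (\<Sum>j=1..N. 1 / norm (x i - x j)) + 1 / \<epsilon>)"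
  proof (rule sum_mono)
    fix i assume i: "i \<in> {1..N}"
    have "(\<Sum>j\<in>{1..N}-{i}. ?k (x i) (x j)) \<le> (\<Sum>j\<in>{1..N}-{i}. 1 / norm (x i - x j))"
      using i distinct by (intro sum_mono k_le) (auto dest: inj_onD)
    moreover have "?k (x i) (x i) = 1 / \<epsilon>" using \<epsilon> by (simp add: soft_coulomb_def)
    ultimately show "(\<Sum>j=1..N. ?k (x i) (x j)) \<le> (\<Sum>j=1..N. 1 / norm (x i - x j)) + 1 / \<epsilon>"
      using i sum.remove[of "{1..N}" i "\<lambda>j. ?k (x i) (x j)"] sum.remove[of "{1..N}" i "\<lambda>j. 1 / norm (x i - x j)"]
      by simp
  qed
  also have "\<dots> = 2 * repulsion x + N / \<epsilon>" by (simp add: sum.distrib repulsion_def)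
  finally have 1: "(\<Sum>i=1..N. \<Sum>j=1..N. ?k (x i) (x j)) \<le> 2 * repulsion x + N / \<epsilon>" .
  have "(\<Sum>i=1..N. \<Sum>\<alpha>=1..M. Z \<alpha> * (1 / norm (x i - R \<alpha>) - \<epsilon> / (2 * d\<^sup>2))) \<le> (\<Sum>i=1..N. \<Sum>\<alpha>=1..M. Z \<alpha> * ?u \<alpha> (x i))"
    using Z_pos d \<epsilon> admissible
    by (intro sum_mono mult_left_mono sphere_potential_ge) (auto intro: less_imp_le)
  also have "(\<Sum>i=1..N. \<Sum>\<alpha>=1..M. Z \<alpha> * (1 / norm (x i - R \<alpha>) - \<epsilon> / (2 * d\<^sup>2)))
      = - attraction x - (real N)\<^sup>2 * (\<epsilon> / (2 * d\<^sup>2))"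
    unfolding right_diff_distrib sum_subtractf sum_distrib_right[symmetric] neutral[symmetric]
    by (simp add: attraction_def nuclear_potential_def sum_negf power2_eq_square)
  finally have 2: "- attraction x - (real N)\<^sup>2 * (\<epsilon> / (2 * d\<^sup>2)) \<le> (\<Sum>i=1..N. \<Sum>\<alpha>=1..M. Z \<alpha> * ?u \<alpha> (x i))" .
  have 3: "(\<Sum>\<alpha>=1..M. \<Sum>\<beta>=1..M. Z \<alpha> * Z \<beta> * (\<integral>p. ?u \<beta> p \<partial>sphere_uniform (R \<alpha>) d)) \<le> sphere_self_energy M R d Z"
    unfolding sphere_self_energy_def
  proof (intro sum_mono mult_left_mono)
    fix \<alpha> \<beta> assume ab: "\<alpha> \<in> {1..M}" "\<beta> \<in> {1..M}"
    show "0 \<le> Z \<alpha> * Z \<beta>" using Z_pos ab by (auto intro: less_imp_le)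
    have hb: "has_bochner_integral unit_sphere_measure (\<lambda>y. 1 / norm ((R \<alpha> + d *\<^sub>R y) - R \<beta>)) (nuclear_interaction R d \<alpha> \<beta>)"
      by (rule has_bochner_integral_nuclear_interaction[OF ab])
    have um[measurable]: "?u \<beta> \<in> borel_measurable borel"
      unfolding sphere_potential_def by measurable
    have "(\<integral>p. ?u \<beta> p \<partial>sphere_uniform (R \<alpha>) d) = (\<integral>y. ?u \<beta> (R \<alpha> + d *\<^sub>R y) \<partial>unit_sphere_measure)"
      unfolding sphere_uniform_def by (rule integral_distr) measurable
    also have "\<dots> \<le> (\<integral>y. 1 / norm ((R \<alpha> + d *\<^sub>R y) - R \<beta>) \<partial>unit_sphere_measure)"
    proof (rule integral_mono_AE')
      show "integrable unit_sphere_measure (\<lambda>y. 1 / norm ((R \<alpha> + d *\<^sub>R y) - R \<beta>))"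
        using hb by (simp add: has_bochner_integral_iff)
      show "AE y in unit_sphere_measure. ?u \<beta> (R \<alpha> + d *\<^sub>R y) \<le> 1 / norm ((R \<alpha> + d *\<^sub>R y) - R \<beta>)"
        using AE_unit_sphere_norm
      proof eventually_elim
        case (elim y)
        have "norm ((R \<alpha> + d *\<^sub>R y) - R \<alpha>) = d" using elim d by simp
        from sphere_outside[OF ab this] show ?case by (rule sphere_potential_le[OF d])
      qed
      show "AE y in unit_sphere_measure. 0 \<le> 1 / norm ((R \<alpha> + d *\<^sub>R y) - R \<beta>)" by simp
    qed
    also have "\<dots> = nuclear_interaction R d \<alpha> \<beta>" using hb by (simp add: has_bochner_integral_iff)
    finally show "(\<integral>p. ?u \<beta> p \<partial>sphere_uniform (R \<alpha>) d) \<le> nuclear_interaction R d \<alpha> \<beta>" .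
  qed
  define Y where "Y = (real N)\<^sup>2 * (\<epsilon> / (2 * d\<^sup>2))"
  have Y: "(real N)\<^sup>2 * \<epsilon> / d\<^sup>2 = 2 * Y" by (simp add: Y_def)
  show ?thesis
    unfolding charge_energy_eq[OF N \<epsilon>] Y using 1 2[folded Y_def] 3 by argo
qed

text \<open>One inequality is read in two ways: with the upper energy bound it makes the charge
  energy small, and with nonnegativity of the charge energy it bounds the total energy from
  below.\<close>

lemma energy_asymptotics:
  assumes N: "N \<ge> 2"
  shows "signed_family.energy charge_index charge_weight charge_measure 1 \<le> (1 + 1 / d\<^sup>2) / sqrt N"
    and "- sphere_self_energy M R d Z / (2 * (real N)\<^sup>2) - (1 + 1 / d\<^sup>2) / (2 * sqrt N) \<le> (attraction x + repulsion x) / (real N)\<^sup>2"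
    and "(attraction x + repulsion x) / (real N)\<^sup>2 \<le> - sphere_self_energy M R d Z / (2 * (real N)\<^sup>2)"
proof -
  interpret F: signed_family charge_index charge_weight charge_measure radius_bound 2
    by (rule signed_family_charge[OF N])
  let ?V = "attraction x + repulsion x" and ?D = "sphere_self_energy M R d Z"
  \<comment> \<open>Makes \<open>N / \<epsilon>\<close> and
    \<open>(real N)\<^sup>2 * \<epsilon>\<close> of equal order.\<close>
  define \<epsilon> where "\<epsilon> = 1 / sqrt N"
  have n: "real N > 0" "sqrt N > 0" using N by auto
  have \<epsilon>: "\<epsilon> > 0" "\<epsilon> \<le> 1" using N by (auto simp: \<epsilon>_def)
  have nn: "real N = sqrt N * sqrt N" by simp
  have err: "N / \<epsilon> + (real N)\<^sup>2 * \<epsilon> / d\<^sup>2 = (real N)\<^sup>2 * ((1 + 1 / d\<^sup>2) / sqrt N)"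
  proof -
    have "N / \<epsilon> = real N * sqrt N" by (simp add: \<epsilon>_def)
    also have "\<dots> = real N * (real N / sqrt N)" by (simp add: real_div_sqrt)
    also have "\<dots> = (real N)\<^sup>2 / sqrt N" by (simp add: power2_eq_square)
    finally show ?thesis by (simp add: \<epsilon>_def distrib_left add_divide_distrib)
  qed
  note le = charge_energy_le[OF N \<epsilon>(1)]
  have up: "2 * ?V \<le> - ?D" using energy_upper_bound by simp
  have "(real N)\<^sup>2 * F.energy \<epsilon> \<le> (real N)\<^sup>2 * ((1 + 1 / d\<^sup>2) / sqrt N)"
    using le up err by linarith
  then have "F.energy \<epsilon> \<le> (1 + 1 / d\<^sup>2) / sqrt N" by (rule mult_left_le_imp_le) (use n in simp)
  \<comment> \<open>Passage from the shrinking softening length to the fixed length 1 at which weak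
    convergence is tested.\<close>
  with F.energy_antimono[OF \<epsilon>] show "F.energy 1 \<le> (1 + 1 / d\<^sup>2) / sqrt N" by linarith
  have pos: "0 \<le> (real N)\<^sup>2 * F.energy \<epsilon>" using F.energy_nonneg[OF \<epsilon>(1)] by simp
  define X where "X = (real N)\<^sup>2 * ((1 + 1 / d\<^sup>2) / sqrt N)"
  have "0 \<le> 2 * ?V + ?D + (N / \<epsilon> + (real N)\<^sup>2 * \<epsilon> / d\<^sup>2)"
    using order_trans[OF pos le] by (simp only: add.assoc)
  then have "0 \<le> 2 * ?V + ?D + X" unfolding err[folded X_def] .
  then have "- ?D / 2 - X / 2 \<le> ?V" by argo
  then have "- ?D / 2 - (real N)\<^sup>2 * ((1 + 1 / d\<^sup>2) / sqrt N) / 2 \<le> ?V" unfolding X_def .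
  then have "(- ?D / 2 - (real N)\<^sup>2 * ((1 + 1 / d\<^sup>2) / sqrt N) / 2) / (real N)\<^sup>2 \<le> ?V / (real N)\<^sup>2"
    by (rule divide_right_mono) simp
  moreover have "(- ?D / 2 - (real N)\<^sup>2 * ((1 + 1 / d\<^sup>2) / sqrt N) / 2) / (real N)\<^sup>2 = - ?D / (2 * (real N)\<^sup>2) - (1 + 1 / d\<^sup>2) / (2 * sqrt N)"
    using n by (simp add: diff_divide_distrib)
  ultimately show "- ?D / (2 * (real N)\<^sup>2) - (1 + 1 / d\<^sup>2) / (2 * sqrt N) \<le> ?V / (real N)\<^sup>2" by simp
  have "?V \<le> - ?D / 2" using up by simp
  then have "?V / (real N)\<^sup>2 \<le> (- ?D / 2) / (real N)\<^sup>2" by (rule divide_right_mono) simp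
  then show "?V / (real N)\<^sup>2 \<le> - ?D / (2 * (real N)\<^sup>2)" by simp
qed

end

section \<open>Weak convergence and counting\<close>

text \<open>The Borel measure underlying \<open>sphere_area\<close>; computations are made here and
  transferred through the completion.\<close>

definition surface_measure :: "real^3 \<Rightarrow> real \<Rightarrow> (real^3) measure" where
  "surface_measure c r = distr (density lborel (\<lambda>p. ennreal (r\<^sup>2 * sin (fst p)) * indicator ({0..pi} \<times> {0..2*pi}) p))
        borel (sphere_param c r)"

lemma sphere_area_eq: "sphere_area c r = completion (surface_measure c r)"
  by (simp add: sphere_area_def surface_measure_def)

lemma sets_surface_measure [simp]: "sets (surface_measure c r) = sets borel"
  by (simp add: surface_measure_def)

lemma emeasure_surface_measure:
  assumes A: "A \<in> sets borel"
  shows "emeasure (surface_measure c r) A = ennreal (4 * pi * r\<^sup>2) * emeasure (sphere_uniform c r) A"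
proof -
  let ?I = "indicator ({0..pi} \<times> {0..2*pi}) :: real \<times> real \<Rightarrow> ennreal"
  let ?g = "\<lambda>p. ennreal (sin (fst p) / (4 * pi)) * ?I p"
  have [measurable]: "{0..pi} \<times> {0..2*pi} \<in> sets (borel :: (real \<times> real) measure)"
    by (intro borel_closed closed_Times) auto
  have [measurable]: "(\<lambda>q :: real \<times> real. sin (fst q)) \<in> borel_measurable borel"
    by (intro borel_measurable_continuous_onI continuous_intros)
  have B[measurable]: "sphere_param c r -` A \<in> sets borel"
    by (rule measurable_sets_borel[OF sphere_param_measurable A])
  have "sphere_uniform c r = distr (density lborel ?g) borel (\<lambda>p. c + r *\<^sub>R sphere_param 0 1 p)"
    unfolding sphere_uniform_def unit_sphere_measure_def
    by (subst distr_distr) (auto simp: comp_def)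
  also have "(\<lambda>p. c + r *\<^sub>R sphere_param 0 1 p) = sphere_param c r"
    by (rule ext) (rule sphere_param_eq[symmetric])
  finally have su: "emeasure (sphere_uniform c r) A = (\<integral>\<^sup>+p. ?g p * indicator (sphere_param c r -` A) p \<partial>lborel)"
    using A by (simp add: emeasure_distr emeasure_density)
  have "emeasure (surface_measure c r) A
      = (\<integral>\<^sup>+p. ennreal (r\<^sup>2 * sin (fst p)) * ?I p * indicator (sphere_param c r -` A) p \<partial>lborel)"
    using A unfolding surface_measure_def by (simp add: emeasure_distr emeasure_density)
  also have "\<dots> = (\<integral>\<^sup>+p. ennreal (4 * pi * r\<^sup>2) * (?g p * indicator (sphere_param c r -` A) p) \<partial>lborel)"
  proof (rule nn_integral_cong)
    fix p :: "real \<times> real"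
    have "ennreal (r\<^sup>2 * sin (fst p)) = ennreal (4 * pi * r\<^sup>2) * ennreal (sin (fst p) / (4 * pi))"
      by (subst ennreal_mult'[symmetric]) auto
    then show "ennreal (r\<^sup>2 * sin (fst p)) * ?I p * indicator (sphere_param c r -` A) p
        = ennreal (4 * pi * r\<^sup>2) * (?g p * indicator (sphere_param c r -` A) p)"
      by (simp add: mult.assoc)
  qed
  also have "\<dots> = ennreal (4 * pi * r\<^sup>2) * emeasure (sphere_uniform c r) A"
    unfolding su by (rule nn_integral_cmult) measurable
  finally show ?thesis .
qed

lemma measure_sphere_area:
  assumes "A \<in> sets borel"
  shows "measure (sphere_area c r) A = 4 * pi * r\<^sup>2 * measure (sphere_uniform c r) A"
proof -
  have "measure (sphere_area c r) A = measure (surface_measure c r) A"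
    unfolding sphere_area_eq using assms by (simp add: measure_completion)
  then show ?thesis
    unfolding measure_def emeasure_surface_measure[OF assms] by (simp add: enn2real_mult)
qed

lemma finite_measure_sphere_area: "finite_measure (sphere_area c r)"
proof
  interpret prob_space "sphere_uniform c r" by (rule prob_space_sphere_uniform)
  have "space (sphere_area c r) = UNIV" by (simp add: sphere_area_def)
  moreover have "emeasure (sphere_area c r) UNIV = ennreal (4 * pi * r\<^sup>2) * emeasure (sphere_uniform c r) UNIV"
    unfolding sphere_area_eq by (subst emeasure_completion) (auto simp: emeasure_surface_measure)
  moreover have "\<dots> \<noteq> \<infinity>" using emeasure_space_1 by simp
  ultimately show "emeasure (sphere_area c r) (space (sphere_area c r)) \<noteq> \<infinity>" by simp
qed

text \<open>Closure and interior relative to the sphere enclose \<open>\<Omega>\<close> and differ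
  by its null boundary. They are Borel even when \<open>\<Omega>\<close> is measurable only for the
  completion, so weak convergence can be applied to them.\<close>

lemma sphere_area_jordan:
  assumes r: "r > 0" and \<Omega>: "\<Omega> \<subseteq> sphere c r" "\<Omega> \<in> sets (sphere_area c r)"
    and fr: "measure (sphere_area c r) ((top_of_set (sphere c r)) frontier_of \<Omega>) = 0"
  obtains K L where "closed K" "closed (sphere c r - L)" "L \<subseteq> \<Omega>" "\<Omega> \<subseteq> K" "K \<subseteq> sphere c r" "L \<in> sets borel"
    "measure (sphere_uniform c r) K = measure (sphere_area c r) \<Omega> / measure (sphere_area c r) (sphere c r)"
    "measure (sphere_uniform c r) L = measure (sphere_area c r) \<Omega> / measure (sphere_area c r) (sphere c r)"
proof -
  interpret U: prob_space "sphere_uniform c r" by (rule prob_space_sphere_uniform)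
  interpret S: finite_measure "sphere_area c r" by (rule finite_measure_sphere_area)
  define T where "T = top_of_set (sphere c r)"
  define K where "K = T closure_of \<Omega>"
  define L where "L = T interior_of \<Omega>"
  have "closedin T K" by (simp add: K_def)
  then have K: "closed K" "K \<subseteq> sphere c r"
    unfolding T_def using closedin_closed_trans closedin_subset by fastforce+
  have "openin T L" by (simp add: L_def)
  then have "closedin T (topspace T - L)" by (rule openin_closedin_eq[THEN iffD1, THEN conjunct2])
  then have cL: "closed (sphere c r - L)"
    unfolding T_def using closedin_closed_trans by fastforce
  have L: "L \<subseteq> \<Omega>" unfolding L_def by (rule interior_of_subset)
  have KO: "\<Omega> \<subseteq> K" unfolding K_def using \<Omega>(1) by (intro closure_of_subset) (simp add: T_def)
  have bK: "K \<in> sets borel" using K by simp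
  have "L = sphere c r - (sphere c r - L)" using L \<Omega>(1) by auto
  also have "\<dots> \<in> sets borel" by (rule sets.Diff[OF borel_closed borel_closed]) (use cL in simp_all)
  finally have bL: "L \<in> sets borel" .
  have sub: "A \<in> sets (sphere_area c r)" if "A \<in> sets borel" for A
    using that unfolding sphere_area_eq by (intro sets_completionI_sets) simp
  have c0: "4 * pi * r\<^sup>2 > 0" using r by simp
  have "measure (sphere_area c r) (K - L) = 0"
    using fr by (simp add: frontier_of_def T_def K_def L_def)
  then have "measure (sphere_uniform c r) (K - L) = 0"
    using measure_sphere_area[of "K - L" c r] bK bL c0 by auto
  then have eq: "measure (sphere_uniform c r) K = measure (sphere_uniform c r) L"
    using U.finite_measure_Diff[of K L] bK bL L KO by auto
  have "measure (sphere_area c r) L \<le> measure (sphere_area c r) \<Omega>"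
    by (rule S.finite_measure_mono[OF L \<Omega>(2)])
  moreover have "measure (sphere_area c r) \<Omega> \<le> measure (sphere_area c r) K"
    by (rule S.finite_measure_mono[OF KO sub[OF bK]])
  ultimately have mO: "measure (sphere_area c r) \<Omega> = 4 * pi * r\<^sup>2 * measure (sphere_uniform c r) K"
    using measure_sphere_area[OF bK, of c r] measure_sphere_area[OF bL, of c r] eq by simp
  have "measure (sphere_uniform c r) (sphere c r) = 1"
    using AE_sphere_uniform[OF r, of c] U.prob_eq_1[of "sphere c r"]
    by (auto simp: dist_norm norm_minus_commute)
  then have mS: "measure (sphere_area c r) (sphere c r) = 4 * pi * r\<^sup>2"
    by (subst measure_sphere_area) auto
  have "measure (sphere_uniform c r) K = measure (sphere_area c r) \<Omega> / measure (sphere_area c r) (sphere c r)"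
    unfolding mO mS using r by simp
  then show ?thesis using that[OF K(1) cL L KO K(2) bL] eq by simp
qed

text \<open>The empty set is a genuine exception: \<open>infdist\<close> to it is 0, so the cutoffs
  would be constantly 1.\<close>

lemma cutoff_tendsto_indicator:
  assumes "closed A" "A \<noteq> {}"
  shows "(\<lambda>k. max 0 (1 - real k * infdist p A)) \<longlonglongrightarrow> indicator A p"
proof (cases "p \<in> A")
  case True
  then show ?thesis by simp
next
  case False
  then have pos: "infdist p A > 0"
    using in_closed_iff_infdist_zero[OF assms] infdist_nonneg[of p A] by (simp add: less_le)
  obtain k0 :: nat where k0: "1 / infdist p A < real k0" using reals_Archimedean2 by blast
  have "max 0 (1 - real k * infdist p A) = 0" if "k \<ge> k0" for k
  proof -
    have "1 / infdist p A < real k" using k0 that by linarith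
    then show ?thesis using pos by (simp add: field_simps max_def)
  qed
  then show ?thesis using False
    by (auto intro!: tendsto_eventually eventually_sequentiallyI[of k0])
qed

section \<open>Limits along a sequence of minimizers\<close>

locale ground_state_sequence = nuclei +
  fixes N :: "nat \<Rightarrow> nat" and Z :: "nat \<Rightarrow> nat \<Rightarrow> real" and z :: "nat \<Rightarrow> real" and x :: "nat \<Rightarrow> nat \<Rightarrow> real^3"
  assumes gs: "\<And>n. ground_state M R d (N n) (Z n) (x n)"
    and N_lim: "filterlim N at_top sequentially"
    and Z_lim: "\<And>\<alpha>. \<alpha> \<in> {1..M} \<Longrightarrow> (\<lambda>n. Z n \<alpha> / real (N n)) \<longlonglongrightarrow> z \<alpha>"
begin

lemma eventually_N_ge_2: "\<forall>\<^sub>F n in sequentially. N n \<ge> 2"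
  using N_lim by (simp add: filterlim_at_top)

lemma div_sqrt_N_tendsto_0: "(\<lambda>n. c / sqrt (N n)) \<longlonglongrightarrow> 0"
proof -
  have "filterlim (\<lambda>n. sqrt (N n)) at_top sequentially"
    by (rule filterlim_compose[OF sqrt_at_top filterlim_compose[OF filterlim_real_sequentially N_lim]])
  then show ?thesis
    by (intro tendsto_divide_0[OF tendsto_const] filterlim_at_top_imp_at_infinity)
qed

lemma z_nonneg: "\<alpha> \<in> {1..M} \<Longrightarrow> z \<alpha> \<ge> 0"
  by (rule LIMSEQ_le_const[OF Z_lim]) (auto intro!: exI[of _ 0] divide_nonneg_nonneg less_imp_le[OF ground_state.Z_pos[OF gs]])

text \<open>Neutrality survives in the limit: the limiting charge distribution has mass 1, so masses
  of complements can be used.\<close>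

lemma sum_z: "(\<Sum>\<alpha>=1..M. z \<alpha>) = 1"
proof -
  have "(\<lambda>n. \<Sum>\<alpha>=1..M. Z n \<alpha> / real (N n)) \<longlonglongrightarrow> (\<Sum>\<alpha>=1..M. z \<alpha>)"
    by (intro tendsto_sum Z_lim)
  moreover have "(\<Sum>\<alpha>=1..M. Z n \<alpha> / real (N n)) = 1" for n
    unfolding sum_divide_distrib[symmetric] ground_state.neutral[OF gs, symmetric]
    using ground_state.N_pos[OF gs, of n] by simp
  ultimately have "(\<lambda>n. 1) \<longlonglongrightarrow> (\<Sum>\<alpha>=1..M. z \<alpha>)" by (simp only:)
  then show ?thesis by (rule LIMSEQ_unique[OF _ tendsto_const])
qed

lemma empirical_tendsto:
  assumes f: "continuous_on UNIV f"
  shows "(\<lambda>n. (\<Sum>i=1..N n. f (x n i)) / N n) \<longlonglongrightarrow> (\<Sum>\<alpha>=1..M. z \<alpha> * (\<integral>p. f p \<partial>sphere_uniform (R \<alpha>) d))"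
proof -
  \<comment> \<open>The common bounds hold only once there are two electrons, so the sequence is
    shifted and shifted back afterwards.\<close>
  obtain n0 where n0: "\<And>n. n \<ge> n0 \<Longrightarrow> N n \<ge> 2"
    using eventually_N_ge_2 by (auto simp: eventually_sequentially)
  define J where "J n = ({1..N n} <+> {1..M})" for n
  define w where "w n = ground_state.charge_weight (N n) (Z n)" for n
  define m where "m n = ground_state.charge_measure R d (x n)" for n
  have fam: "signed_family (J (n + n0)) (w (n + n0)) (m (n + n0)) (ground_state.radius_bound M R d) 2" for n
    unfolding J_def w_def m_def by (rule ground_state.signed_family_charge[OF gs n0]) simp
  have "(\<lambda>n. signed_family.energy (J (n + n0)) (w (n + n0)) (m (n + n0)) 1) \<longlonglongrightarrow> 0"
  proof (rule tendsto_sandwich[OF always_eventually always_eventually tendsto_const])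
    show "(\<lambda>n. (1 + 1 / d\<^sup>2) / sqrt (N (n + n0))) \<longlonglongrightarrow> 0"
      by (rule LIMSEQ_ignore_initial_segment[OF div_sqrt_N_tendsto_0])
    show "\<forall>n. 0 \<le> signed_family.energy (J (n + n0)) (w (n + n0)) (m (n + n0)) 1"
      using signed_family.energy_nonneg[OF fam] by simp
    show "\<forall>n. signed_family.energy (J (n + n0)) (w (n + n0)) (m (n + n0)) 1 \<le> (1 + 1 / d\<^sup>2) / sqrt (N (n + n0))"
      unfolding J_def w_def m_def by (intro allI ground_state.energy_asymptotics(1)[OF gs n0]) simp
  qed
  then have "(\<lambda>n. lincomb_integral (J (n + n0)) (w (n + n0)) (m (n + n0)) f) \<longlonglongrightarrow> 0"
    by (rule lincomb_integral_tendsto_0[OF fam _ f])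
  then have L: "(\<lambda>n. lincomb_integral (J n) (w n) (m n) f) \<longlonglongrightarrow> 0"
    by (rule LIMSEQ_offset)
  have eq: "lincomb_integral (J n) (w n) (m n) f
      = (\<Sum>i=1..N n. f (x n i)) / N n - (\<Sum>\<alpha>=1..M. Z n \<alpha> / N n * (\<integral>p. f p \<partial>sphere_uniform (R \<alpha>) d))" for n
    unfolding J_def w_def m_def
    by (intro ground_state.charge_functional_eq[OF gs] borel_measurable_continuous_onI f)
  have "(\<lambda>n. \<Sum>\<alpha>=1..M. Z n \<alpha> / N n * (\<integral>p. f p \<partial>sphere_uniform (R \<alpha>) d)) \<longlonglongrightarrow> (\<Sum>\<alpha>=1..M. z \<alpha> * (\<integral>p. f p \<partial>sphere_uniform (R \<alpha>) d))"
    by (intro tendsto_intros Z_lim)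
  from tendsto_add[OF L this] show ?thesis unfolding eq by simp
qed

definition frequency :: "nat \<Rightarrow> (real^3) set \<Rightarrow> real" where
  "frequency n A = (\<Sum>i=1..N n. indicator A (x n i)) / N n"

definition limit_measure :: "(real^3) set \<Rightarrow> real" where
  "limit_measure A = (\<Sum>\<alpha>=1..M. z \<alpha> * measure (sphere_uniform (R \<alpha>) d) A)"

text \<open>The cardinality counts positions, the frequency counts electrons; they agree because
  minimizers have distinct points.\<close>

lemma frequency_card: "real (card {x n i |i. i \<in> {1..N n} \<and> x n i \<in> A}) / real (N n) = frequency n A"
proof -
  have "{x n i |i. i \<in> {1..N n} \<and> x n i \<in> A} = x n ` {i \<in> {1..N n}. x n i \<in> A}" by auto
  then have "card {x n i |i. i \<in> {1..N n} \<and> x n i \<in> A} = card {i \<in> {1..N n}. x n i \<in> A}"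
    by (simp only:) (rule card_image, rule inj_on_subset[OF ground_state.distinct[OF gs]], auto)
  also have "real \<dots> = (\<Sum>i=1..N n. indicator A (x n i))"
    by (simp add: indicator_def sum.If_cases Int_def)
  finally show ?thesis by (simp add: frequency_def)
qed

text \<open>The closed-set half of the portmanteau theorem: continuous cutoffs lie above the
  indicator, and their limit integrals converge to the mass of the set.\<close>

lemma frequency_closed_le:
  assumes A: "closed A" and e: "e > 0"
  shows "\<forall>\<^sub>F n in sequentially. frequency n A < limit_measure A + e"
proof (cases "A = {}")
  case True
  then show ?thesis using e by (simp add: frequency_def limit_measure_def)
next
  case False
  define f where "f k p = max 0 (1 - real k * infdist p A)" for k p
  have f: "continuous_on UNIV (f k)" for k
    unfolding f_def by (intro continuous_intros)
  have "(\<lambda>k. \<integral>p. f k p \<partial>sphere_uniform (R \<alpha>) d) \<longlonglongrightarrow> measure (sphere_uniform (R \<alpha>) d) A" for \<alpha>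
  proof -
    interpret U: prob_space "sphere_uniform (R \<alpha>) d" by (rule prob_space_sphere_uniform)
    have "(\<lambda>k. \<integral>p. f k p \<partial>sphere_uniform (R \<alpha>) d) \<longlonglongrightarrow> (\<integral>p. indicator A p \<partial>sphere_uniform (R \<alpha>) d)"
    proof (rule integral_dominated_convergence[where w="\<lambda>_. 1"])
      show "AE p in sphere_uniform (R \<alpha>) d. (\<lambda>k. f k p) \<longlonglongrightarrow> indicator A p"
        unfolding f_def using cutoff_tendsto_indicator[OF A False] by simp
      show "f k \<in> borel_measurable (sphere_uniform (R \<alpha>) d)" for k
        using borel_measurable_continuous_onI[OF f] by simp
      show "AE p in sphere_uniform (R \<alpha>) d. norm (f k p) \<le> 1" for k
        by (intro AE_I2) (auto simp: f_def max_def infdist_nonneg)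
    qed (use borel_closed[OF A] in simp_all)
    then show ?thesis using A by simp
  qed
  then have "(\<lambda>k. \<Sum>\<alpha>=1..M. z \<alpha> * (\<integral>p. f k p \<partial>sphere_uniform (R \<alpha>) d)) \<longlonglongrightarrow> limit_measure A"
    unfolding limit_measure_def by (intro tendsto_intros)
  then have "\<forall>\<^sub>F k in sequentially. (\<Sum>\<alpha>=1..M. z \<alpha> * (\<integral>p. f k p \<partial>sphere_uniform (R \<alpha>) d)) < limit_measure A + e"
    by (rule order_tendstoD) (use e in simp)
  then obtain k where k: "(\<Sum>\<alpha>=1..M. z \<alpha> * (\<integral>p. f k p \<partial>sphere_uniform (R \<alpha>) d)) < limit_measure A + e"
    by (auto simp: eventually_sequentially)
  have "\<forall>\<^sub>F n in sequentially. (\<Sum>i=1..N n. f k (x n i)) / N n < limit_measure A + e"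
    using empirical_tendsto[OF f] k by (rule order_tendstoD)
  then show ?thesis
  proof eventually_elim
    case (elim n)
    have "frequency n A \<le> (\<Sum>i=1..N n. f k (x n i)) / N n"
      unfolding frequency_def
      by (intro divide_right_mono sum_mono) (auto simp: f_def indicator_def)
    with elim show ?case by simp
  qed
qed

lemma spheres_disjoint:
  assumes "\<alpha> \<in> {1..M}" "\<beta> \<in> {1..M}" "\<alpha> \<noteq> \<beta>"
  shows "sphere (R \<alpha>) d \<inter> sphere (R \<beta>) d = {}"
proof -
  have "norm (p - R \<beta>) \<noteq> d" if "norm (p - R \<alpha>) = d" for p
    using norm_triangle_ineq4[of "p - R \<beta>" "p - R \<alpha>"] separated[OF assms] that by (simp add: norm_minus_commute)
  then show ?thesis by (force simp: disjoint_iff dist_norm norm_minus_commute)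
qed

lemma measure_sphere_uniform_other:
  assumes "\<alpha> \<in> {1..M}" "\<beta> \<in> {1..M}" "\<alpha> \<noteq> \<beta>" "A \<subseteq> sphere (R \<alpha>) d"
  shows "measure (sphere_uniform (R \<beta>) d) A = 0"
proof -
  interpret U: prob_space "sphere_uniform (R \<beta>) d" by (rule prob_space_sphere_uniform)
  have "AE p in sphere_uniform (R \<beta>) d. p \<notin> sphere (R \<alpha>) d"
    using AE_sphere_uniform[OF d, of "R \<beta>"]
  proof eventually_elim
    case (elim p)
    then have "p \<in> sphere (R \<beta>) d" by (simp add: dist_norm norm_minus_commute)
    then show ?case using spheres_disjoint[OF assms(1-3)] by blast
  qed
  then have "measure (sphere_uniform (R \<beta>) d) (sphere (R \<alpha>) d) = 0"
    by (subst U.prob_eq_0) auto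
  moreover have "measure (sphere_uniform (R \<beta>) d) A \<le> measure (sphere_uniform (R \<beta>) d) (sphere (R \<alpha>) d)"
    by (rule U.finite_measure_mono[OF assms(4)]) auto
  ultimately show ?thesis using measure_nonneg[of "sphere_uniform (R \<beta>) d" A] by simp
qed

lemma limit_measure_sphere_subset:
  assumes "\<alpha> \<in> {1..M}" "A \<subseteq> sphere (R \<alpha>) d"
  shows "limit_measure A = z \<alpha> * measure (sphere_uniform (R \<alpha>) d) A"
proof -
  have "limit_measure A = (\<Sum>\<beta>\<in>{\<alpha>}. z \<beta> * measure (sphere_uniform (R \<beta>) d) A)"
    unfolding limit_measure_def using assms measure_sphere_uniform_other
    by (intro sum.mono_neutral_right) auto
  then show ?thesis by simp
qed

text \<open>Lower bounds for the frequency come from upper bounds for the closed complement in the union of the spheres.\<close>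

lemma frequency_tendsto:
  assumes \<alpha>: "\<alpha> \<in> {1..M}" and K: "closed K" "K \<subseteq> sphere (R \<alpha>) d" "\<Omega> \<subseteq> K"
    and L: "closed (sphere (R \<alpha>) d - L)" "L \<subseteq> \<Omega>" "L \<in> sets borel"
    and mK: "measure (sphere_uniform (R \<alpha>) d) K = a" and mL: "measure (sphere_uniform (R \<alpha>) d) L = a"
  shows "(\<lambda>n. frequency n \<Omega>) \<longlonglongrightarrow> z \<alpha> * a"
proof (rule LIMSEQ_I)
  fix e :: real assume e: "e > 0"
  \<comment> \<open>Everything on the spheres outside \<open>L\<close>; a closed set disjoint from
    \<open>L\<close>, which covers the union of the spheres together with \<open>L\<close>.\<close>
  define C where "C = (sphere (R \<alpha>) d - L) \<union> (\<Union>\<beta>\<in>{1..M}-{\<alpha>}. sphere (R \<beta>) d)"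
  have C: "closed C" unfolding C_def using L by (intro closed_Un closed_UN) auto
  have CL: "C \<inter> L = {}"
    using spheres_disjoint[OF \<alpha>] K L unfolding C_def by blast
  have lC: "limit_measure C \<le> 1 - z \<alpha> * a"
  proof -
    have "limit_measure C \<le> (\<Sum>\<beta>=1..M. z \<beta> * (1 - measure (sphere_uniform (R \<beta>) d) L))"
      unfolding limit_measure_def
    proof (intro sum_mono mult_left_mono z_nonneg)
      fix \<beta>
      interpret U: prob_space "sphere_uniform (R \<beta>) d" by (rule prob_space_sphere_uniform)
      have "measure (sphere_uniform (R \<beta>) d) (C \<union> L) = measure (sphere_uniform (R \<beta>) d) C + measure (sphere_uniform (R \<beta>) d) L"
        using C L CL by (intro U.finite_measure_Union) auto
      then show "measure (sphere_uniform (R \<beta>) d) C \<le> 1 - measure (sphere_uniform (R \<beta>) d) L"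
        using U.prob_le_1[of "C \<union> L"] by linarith
    qed
    also have "\<dots> = 1 - limit_measure L"
      using sum_z by (simp add: right_diff_distrib sum_subtractf limit_measure_def)
    also have "limit_measure L = z \<alpha> * a"
      using limit_measure_sphere_subset[OF \<alpha>, of L] K L mL by auto
    finally show ?thesis .
  qed
  have lK: "limit_measure K = z \<alpha> * a"
    using limit_measure_sphere_subset[OF \<alpha> K(2)] mK by simp
  have "\<forall>\<^sub>F n in sequentially. norm (frequency n \<Omega> - z \<alpha> * a) < e"
    using frequency_closed_le[OF K(1) e] frequency_closed_le[OF C e] eventually_N_ge_2
  proof eventually_elim
    case (elim n)
    have "frequency n \<Omega> \<le> frequency n K"
      unfolding frequency_def using K(3) by (intro divide_right_mono sum_mono) (auto simp: indicator_def)
    moreover have "1 - frequency n C \<le> frequency n \<Omega>"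
    proof -
      \<comment> \<open>Every electron lies on some sphere, hence in \<open>C\<close> or in
        \<open>L\<close>, which is part of \<open>\<Omega>\<close>.\<close>
      have "(\<Sum>i=1..N n. 1) \<le> (\<Sum>i=1..N n. indicator C (x n i) + indicator \<Omega> (x n i) :: real)"
      proof (rule sum_mono)
        fix i assume i: "i \<in> {1..N n}"
        obtain \<beta> where \<beta>: "\<beta> \<in> {1..M}" "norm (x n i - R \<beta>) = d"
          by (rule ground_state.on_some_sphere[OF gs elim(3) i])
        then have "x n i \<in> sphere (R \<beta>) d" by (simp add: dist_norm norm_minus_commute)
        then have "x n i \<in> C \<union> \<Omega>" using \<beta>(1) L unfolding C_def by (cases "\<beta> = \<alpha>") auto
        then show "1 \<le> (indicator C (x n i) + indicator \<Omega> (x n i) :: real)" by (auto simp: indicator_def)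
      qed
      then have "real (N n) / N n \<le> (\<Sum>i=1..N n. indicator C (x n i) + indicator \<Omega> (x n i)) / N n"
        by (intro divide_right_mono) auto
      then show ?thesis using elim(3) by (simp add: frequency_def sum.distrib add_divide_distrib)
    qed
    ultimately show ?case using elim lC lK by (auto simp: abs_less_iff)
  qed
  then show "\<exists>no. \<forall>n\<ge>no. norm (frequency n \<Omega> - z \<alpha> * a) < e" by (simp add: eventually_sequentially)
qed

lemma equidistribution:
  assumes \<alpha>: "\<alpha> \<in> {1..M}" and \<Omega>: "\<Omega> \<subseteq> sphere (R \<alpha>) d" "\<Omega> \<in> sets (sphere_area (R \<alpha>) d)"
    and fr: "measure (sphere_area (R \<alpha>) d) ((top_of_set (sphere (R \<alpha>) d)) frontier_of \<Omega>) = 0"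
  shows "(\<lambda>n. real (card {x n i |i. i \<in> {1..N n} \<and> x n i \<in> \<Omega>}) / real (N n)) \<longlonglongrightarrow>
    z \<alpha> * (measure (sphere_area (R \<alpha>) d) \<Omega> / measure (sphere_area (R \<alpha>) d) (sphere (R \<alpha>) d))"
  unfolding frequency_card
  by (rule sphere_area_jordan[OF d \<Omega> fr]) (rule frequency_tendsto[OF \<alpha>])

text \<open>The whole sphere is its own closure and interior relative to itself. Dividing its
  frequency by Z \<alpha> / N, whose limit \<open>z \<alpha>\<close> is positive, converts the count
  relative to N into one relative to the nuclear charge.\<close>

lemma neutrality:
  assumes \<alpha>: "\<alpha> \<in> {1..M}" and z: "z \<alpha> > 0"
  shows "(\<lambda>n. real (card {x n i |i. i \<in> {1..N n} \<and> x n i \<in> sphere (R \<alpha>) d}) / Z n \<alpha>) \<longlonglongrightarrow> 1"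
proof -
  interpret U: prob_space "sphere_uniform (R \<alpha>) d" by (rule prob_space_sphere_uniform)
  have 1: "measure (sphere_uniform (R \<alpha>) d) (sphere (R \<alpha>) d) = 1"
    using AE_sphere_uniform[OF d, of "R \<alpha>"] U.prob_eq_1[of "sphere (R \<alpha>) d"]
    by (auto simp: dist_norm norm_minus_commute)
  have "(\<lambda>n. frequency n (sphere (R \<alpha>) d)) \<longlonglongrightarrow> z \<alpha> * 1"
    by (rule frequency_tendsto[OF \<alpha>, where K="sphere (R \<alpha>) d" and L="sphere (R \<alpha>) d"]) (use 1 in auto)
  from tendsto_divide[OF this Z_lim[OF \<alpha>]] z
  have "(\<lambda>n. frequency n (sphere (R \<alpha>) d) / (Z n \<alpha> / N n)) \<longlonglongrightarrow> 1" by simp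
  moreover have "frequency n (sphere (R \<alpha>) d) / (Z n \<alpha> / N n) = real (card {x n i |i. i \<in> {1..N n} \<and> x n i \<in> sphere (R \<alpha>) d}) / Z n \<alpha>" for n
    unfolding frequency_card[symmetric] using ground_state.N_pos[OF gs, of n] by simp
  ultimately show ?thesis by (simp only:)
qed

text \<open>The self energy is homogeneous of degree two in the charges, so dividing by N^2 replaces
  them by their fractions, and continuity gives the limit of both bounds.\<close>

lemma limit_energy:
  "(\<lambda>n. coulomb_energy M R (N n) (Z n) (x n) / ereal ((real (N n))\<^sup>2)) \<longlonglongrightarrow>
    ereal (- 1/2 * (\<Sum>\<alpha>=1..M. (z \<alpha>)\<^sup>2 / d) - (\<Sum>\<alpha>=1..M. \<Sum>\<beta>=\<alpha>+1..M. z \<alpha> * z \<beta> / norm (R \<alpha> - R \<beta>)))"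
proof -
  define V where "V n = ground_state.attraction M R (N n) (Z n) (x n) + ground_state.repulsion (N n) (x n)" for n
  define D where "D n = sphere_self_energy M R d (Z n)" for n
  have "(\<lambda>n. \<Sum>\<alpha>=1..M. \<Sum>\<beta>=1..M. (Z n \<alpha> / N n) * (Z n \<beta> / N n) * nuclear_interaction R d \<alpha> \<beta>)
      \<longlonglongrightarrow> sphere_self_energy M R d z"
    unfolding sphere_self_energy_def by (intro tendsto_intros Z_lim)
  moreover have "(\<Sum>\<alpha>=1..M. \<Sum>\<beta>=1..M. (Z n \<alpha> / N n) * (Z n \<beta> / N n) * nuclear_interaction R d \<alpha> \<beta>) = D n / (real (N n))\<^sup>2" for n
    by (simp add: D_def sphere_self_energy_def sum_divide_distrib power2_eq_square)
  ultimately have "(\<lambda>n. D n / (real (N n))\<^sup>2) \<longlonglongrightarrow> sphere_self_energy M R d z" by simp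
  then have D: "(\<lambda>n. - (D n / (real (N n))\<^sup>2) / 2) \<longlonglongrightarrow> - sphere_self_energy M R d z / 2"
    by (intro tendsto_intros) auto
  have "(\<lambda>n. - (D n / (real (N n))\<^sup>2) / 2 - ((1 + 1 / d\<^sup>2) / 2) / sqrt (N n)) \<longlonglongrightarrow> - sphere_self_energy M R d z / 2 - 0"
    by (intro tendsto_diff D div_sqrt_N_tendsto_0)
  then have D': "(\<lambda>n. - (D n / (real (N n))\<^sup>2) / 2 - ((1 + 1 / d\<^sup>2) / 2) / sqrt (N n)) \<longlonglongrightarrow> - sphere_self_energy M R d z / 2" by simp
  have "(\<lambda>n. V n / (real (N n))\<^sup>2) \<longlonglongrightarrow> - sphere_self_energy M R d z / 2"
  proof (rule tendsto_sandwich[OF _ _ D' D])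
    show "\<forall>\<^sub>F n in sequentially. - (D n / (real (N n))\<^sup>2) / 2 - ((1 + 1 / d\<^sup>2) / 2) / sqrt (N n) \<le> V n / (real (N n))\<^sup>2"
      using eventually_N_ge_2
    proof eventually_elim
      case (elim n)
      show ?case using ground_state.energy_asymptotics(2)[OF gs elim] by (simp add: V_def D_def mult.commute)
    qed
    show "\<forall>\<^sub>F n in sequentially. V n / (real (N n))\<^sup>2 \<le> - (D n / (real (N n))\<^sup>2) / 2"
      using eventually_N_ge_2
    proof eventually_elim
      case (elim n)
      show ?case using ground_state.energy_asymptotics(3)[OF gs elim] by (simp add: V_def D_def mult.commute)
    qed
  qed
  then have "(\<lambda>n. ereal (V n / (real (N n))\<^sup>2)) \<longlonglongrightarrow> ereal (- sphere_self_energy M R d z / 2)" by simp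
  moreover have "coulomb_energy M R (N n) (Z n) (x n) / ereal ((real (N n))\<^sup>2) = ereal (V n / (real (N n))\<^sup>2)" for n
    using ground_state.N_pos[OF gs, of n] by (simp add: ground_state.coulomb_energy_eq[OF gs] V_def)
  moreover have "- sphere_self_energy M R d z / 2
      = - 1/2 * (\<Sum>\<alpha>=1..M. (z \<alpha>)\<^sup>2 / d) - (\<Sum>\<alpha>=1..M. \<Sum>\<beta>=\<alpha>+1..M. z \<alpha> * z \<beta> / norm (R \<alpha> - R \<beta>))"
  proof -
    have "(\<Sum>\<beta>=1..M. z \<alpha> * z \<beta> * nuclear_interaction R d \<alpha> \<beta>) = (z \<alpha>)\<^sup>2 / d + (\<Sum>\<beta>=1..M. z \<alpha> * z \<beta> / norm (R \<alpha> - R \<beta>))"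
      if "\<alpha> \<in> {1..M}" for \<alpha>
    proof -
      have "(\<Sum>\<beta>=1..M. z \<alpha> * z \<beta> * nuclear_interaction R d \<alpha> \<beta>)
          = (\<Sum>\<beta>=1..M. (if \<beta> = \<alpha> then (z \<alpha>)\<^sup>2 / d else 0) + z \<alpha> * z \<beta> / norm (R \<alpha> - R \<beta>))"
        by (intro sum.cong refl) (auto simp: nuclear_interaction_def power2_eq_square)
      then show ?thesis using that by (simp add: sum.distrib)
    qed
    then have "sphere_self_energy M R d z = (\<Sum>\<alpha>=1..M. (z \<alpha>)\<^sup>2 / d) + (\<Sum>\<alpha>=1..M. \<Sum>\<beta>=1..M. z \<alpha> * z \<beta> / norm (R \<alpha> - R \<beta>))"
      by (simp add: sphere_self_energy_def sum.distrib)
    also have "(\<Sum>\<alpha>=1..M. \<Sum>\<beta>=1..M. z \<alpha> * z \<beta> / norm (R \<alpha> - R \<beta>)) = 2 * (\<Sum>\<alpha>=1..M. \<Sum>\<beta>=\<alpha>+1..M. z \<alpha> * z \<beta> / norm (R \<alpha> - R \<beta>))"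
      by (rule sum_upper_triangle_symmetric[symmetric]) (auto simp: norm_minus_commute mult.commute)
    finally show ?thesis by simp
  qed
  ultimately show ?thesis by simp
qed

end

theorem theorem1p1:
  fixes M :: nat
    and R :: "nat \<Rightarrow> real^3"
    and d :: real
    and N :: "nat \<Rightarrow> nat"
    and Z :: "nat \<Rightarrow> nat \<Rightarrow> real"
    and z :: "nat \<Rightarrow> real"
    and x :: "nat \<Rightarrow> nat \<Rightarrow> real^3"
  assumes "M \<ge> 1"
    and "d > 0"
    and "M \<ge> 2 \<Longrightarrow> d < 1/2 * Min {norm (R \<alpha> - R \<beta>) |\<alpha> \<beta>. \<alpha> \<in> {1..M} \<and> \<beta> \<in> {1..M} \<and> \<alpha> \<noteq> \<beta>}"
    and "\<And>n \<alpha>. \<alpha> \<in> {1..M} \<Longrightarrow> Z n \<alpha> > 0"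
    and "\<And>n. real (N n) = (\<Sum>\<alpha>=1..M. Z n \<alpha>)"
    and "filterlim N at_top sequentially"
    and "\<And>\<alpha>. \<alpha> \<in> {1..M} \<Longrightarrow> (\<lambda>n. Z n \<alpha> / (\<Sum>\<beta>=1..M. Z n \<beta>)) \<longlonglongrightarrow> z \<alpha>"
    and "\<And>n. energy_minimizer M R d (N n) (Z n) (x n)"
  shows "(\<forall>\<alpha>\<in>{1..M}. z \<alpha> > 0 \<longrightarrow>
            (\<lambda>n. real (card {x n i |i. i \<in> {1..N n} \<and> x n i \<in> sphere (R \<alpha>) d}) / Z n \<alpha>) \<longlonglongrightarrow> 1)
       \<and> (\<forall>\<alpha>\<in>{1..M}. \<forall>\<Omega> \<subseteq> sphere (R \<alpha>) d.
            \<Omega> \<in> sets (sphere_area (R \<alpha>) d) \<and>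
            measure (sphere_area (R \<alpha>) d) ((top_of_set (sphere (R \<alpha>) d)) frontier_of \<Omega>) = 0 \<longrightarrow>
            (\<lambda>n. real (card {x n i |i. i \<in> {1..N n} \<and> x n i \<in> \<Omega>}) / real (N n)) \<longlonglongrightarrow>
              z \<alpha> * (measure (sphere_area (R \<alpha>) d) \<Omega> / measure (sphere_area (R \<alpha>) d) (sphere (R \<alpha>) d)))
       \<and> (\<lambda>n. coulomb_energy M R (N n) (Z n) (x n) / ereal ((real (N n))\<^sup>2)) \<longlonglongrightarrow>
            ereal (- 1/2 * (\<Sum>\<alpha>=1..M. (z \<alpha>)\<^sup>2 / d)
                   - (\<Sum>\<alpha>=1..M. \<Sum>\<beta>=\<alpha>+1..M. z \<alpha> * z \<beta> / norm (R \<alpha> - R \<beta>)))"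
proof -
  have sep: "2 * d < norm (R \<alpha> - R \<beta>)" if ab: "\<alpha> \<in> {1..M}" "\<beta> \<in> {1..M}" "\<alpha> \<noteq> \<beta>" for \<alpha> \<beta>
  proof -
    let ?S = "{norm (R \<alpha> - R \<beta>) |\<alpha> \<beta>. \<alpha> \<in> {1..M} \<and> \<beta> \<in> {1..M} \<and> \<alpha> \<noteq> \<beta>}"
    have "?S \<subseteq> (\<lambda>(\<alpha>, \<beta>). norm (R \<alpha> - R \<beta>)) ` ({1..M} \<times> {1..M})" by force
    then have "finite ?S" by (rule finite_subset) auto
    moreover have "norm (R \<alpha> - R \<beta>) \<in> ?S" using ab by blast
    ultimately have "Min ?S \<le> norm (R \<alpha> - R \<beta>)" by (rule Min_le)
    moreover have "M \<ge> 2" using ab by auto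
    ultimately show ?thesis using assms(3) by linarith
  qed
  interpret nuclei M R d by unfold_locales (use assms(1,2) sep in auto)
  have "ground_state M R d (N n) (Z n) (x n)" for n
    by unfold_locales (use assms(4,5,8) in auto)
  moreover have "(\<lambda>n. Z n \<alpha> / real (N n)) \<longlonglongrightarrow> z \<alpha>" if "\<alpha> \<in> {1..M}" for \<alpha>
    unfolding assms(5) by (rule assms(7)[OF that])
  ultimately interpret ground_state_sequence M R d N Z z x
    by (intro ground_state_sequence.intro ground_state_sequence_axioms.intro nuclei_axioms assms(6))
  show ?thesis
    using neutrality equidistribution limit_energy by blast
qed

end
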